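(* There is a universal constant $c>0$ such that for all $n\ge1$, $0<\epsilon\le1/3$ and $\eta\ge0$ the following holds. (Incoherent) Consider an incoherent adaptive protocol with $N$ channel uses in which either every input state $\rho_{SA}^{\mathbf o_{<\ell}}$ used satisfies $H_{\min}(S\mid A)\ge-\eta$ (POVMs unrestricted), or every POVM used satisfies $H_{\min}(S\mid A)\ge-\eta$ (input states unrestricted). If it solves Pauli channel learning for $n$-qubit Pauli channels (accuracy $\epsilon$, success probability at least $2/3$), then $N\ge c\,\epsilon^{-2}2^{n-\eta}$. (Coherent) Consider a protocol with $N$ channel uses that belongs either to the input-restricted coherent adaptive model with every fresh input state satisfying $H_{\min}(S_\ell\mid A_\ell)\ge-\eta$, or to the measurement-restricted coherent adaptive model with every POVM on $S_\ell A_\ell$ satisfying $H_{\min}(S_\ell\mid A_\ell)\ge-\eta$. If it solves Pauli channel learning for $n$-qubit Pauli channels (accuracy $\epsilon$, success probability at least $2/3$), then $N\ge c\,\epsilon^{-1}2^{(n-\eta)/2}$.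
   Context: All quantum systems are finite-dimensional and POVMs/instruments have finitely many outcomes; $X\le Y$ means $Y-X$ is positive semidefinite. Pauli channels: let $\mathcal P_n=\{I,X,Y,Z\}^{\otimes n}$. An $n$-qubit Pauli channel is a map $\Lambda(\rho)=\sum_{P\in\mathcal P_n}p_P\,P\rho P$ with $\{p_P\}$ a probability distribution; $\Lambda(P)=\lambda_P P$ defines the Pauli eigenvalues $\lambda_P$. Pauli channel learning: given $N$ uses of an unknown $n$-qubit Pauli channel $\Lambda$, the learner outputs estimates $\{\hat\lambda_P\}_{P\in\mathcal P_n}$ such that, for every $\Lambda$, $\max_{P}|\hat\lambda_P-\lambda_P|\le\epsilon$ with probability at least $2/3$. Conditional min-entropy of a density operator: $H_{\min}(S\mid A)_\rho:=\max_{\sigma_A}\sup\{\kappa\in\mathbb R:\rho_{SA}\le2^{-\kappa}I_S\otimes\sigma_A\}$, the maximum being over density operators $\sigma_A$ on $A$. For a POVM $\{E_o\}$ on $SA$ with $\dim S=d_S=2^n$, "$H_{\min}(S\mid A)\ge-\eta$" means: for every outcome with $\mathrm{Tr}\,E_o>0$ there is a density operator $\sigma_A^o$ such that $\dfrac{E_o}{\mathrm{Tr}\,E_o}\le2^\eta I_S\otimes\sigma_A^o$, and $\sum_o\mathrm{Tr}(E_o)\,\sigma_A^o=d_S I_A$. Notation: $\mathbf o_{<\ell}=(o_1,\dots,o_{\ell-1})$, $\mathbf o_{\le\ell}=(o_1,\dots,o_\ell)$. In all models the estimates are computed from the full outcome record $\mathbf o_{\le N}$. $S$ and each $S_\ell$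 are $n$-qubit registers; $A$ and each $A_\ell$ are ancillas of arbitrary dimension. Incoherent adaptive protocol: in round $\ell=1,\dots,N$, conditioned on $\mathbf o_{<\ell}$, the learner prepares a state $\rho_{SA}^{\mathbf o_{<\ell}}$, applies $\Lambda\otimes\mathrm{id}_A$ once, and measures $SA$ with a POVM $\{E_{o_\ell}^{\mathbf o_{<\ell}}\}_{o_\ell}$, obtaining $o_\ell$. State and POVM may depend arbitrarily on $\mathbf o_{<\ell}$, but no quantum memory is kept between rounds. Input-restricted coherent adaptive model: there are quantum memories $W_0,\dots,W_N$ of arbitrary dimension, with $W_0$ and $W_N$ one-dimensional. In round $\ell$, conditioned on $\mathbf o_{<\ell}$, the learner prepares a fresh state $\rho_\ell^{\mathbf o_{<\ell}}$ on $S_\ell A_\ell$, in a product state with the retained memory $W_{\ell-1}$ (uncorrelated conditioned on $\mathbf o_{<\ell}$). After $\Lambda$ acts on $S_\ell$, the learner applies an arbitrary quantum instrument $\{\mathcal J_{\mathbf o_{<\ell},o_\ell}\}_{o_\ell}$ (completely positive trace-nonincreasing maps from operators on $W_{\ell-1}S_\ell A_\ell$ to operators on $W_\ell$ whose sum over $o_\ell$ is trace preserving), which may depend on $\mathbf o_{<\ell}$, producing $o_\ell$ and the new memory $W_\ell$. Measurement-restricted coherent adaptive model: the learner starts with an arbitrary state on $S_1A_1\cdots S_NA_N$ (possibly entangled across rounds). In round $\ell$, $\Lambda$ acts on $S_\ell$; then, conditioned on $\mathbf o_{<\ell}$, a POVM $\{E_{o_\ell}^{\mathbf o_{<\ell}}\}_{o_\ell}$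 acting only on $S_\ell A_\ell$ is measured, giving outcome $o_\ell$ (and $S_\ell A_\ell$ is discarded); then a CPTP map depending on $\mathbf o_{\le\ell}$ is applied to the remaining registers $C_\ell=S_{\ell+1}A_{\ell+1}\cdots S_NA_N$. *)

theory Defs
  imports
    "Jordan_Normal_Form.Schur_Decomposition"
    "HOL-Library.Extended_Real"
begin

section \<open>Matrices and operators\<close>

text \<open>
  Operators on a \<open>d\<close>-dimensional system are complex \<open>d\<close> by \<open>d\<close> matrices. The basis vector
  \<open>i \<otimes> j\<close> of a bipartite system has index \<open>i * k + j\<close>, where \<open>k\<close> is the dimension of
  the second factor. The order of the matrix library is entrywise, so positivity and the Loewner
  order are defined here.
\<close>

definition psd :: "nat \<Rightarrow> complex mat \<Rightarrow> bool" where
  "psd d X \<longleftrightarrow> X \<in> carrier_mat d d \<and> mat_adjoint X = X \<and>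
     (\<forall>v \<in> carrier_vec d. 0 \<le> Re ((X *\<^sub>v v) \<bullet>c v))"

definition loewner_le :: "nat \<Rightarrow> complex mat \<Rightarrow> complex mat \<Rightarrow> bool" where
  "loewner_le d X Y \<longleftrightarrow> X \<in> carrier_mat d d \<and> Y \<in> carrier_mat d d \<and> psd d (Y - X)"

definition mat_trace :: "complex mat \<Rightarrow> complex" where
  "mat_trace X = (\<Sum>i<dim_row X. X $$ (i, i))"

definition density_operator :: "nat \<Rightarrow> complex mat \<Rightarrow> bool" where
  "density_operator d \<rho> \<longleftrightarrow> psd d \<rho> \<and> mat_trace \<rho> = 1"

definition tensor_mat :: "complex mat \<Rightarrow> complex mat \<Rightarrow> complex mat" where
  "tensor_mat A B = mat (dim_row A * dim_row B) (dim_col A * dim_col B)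
     (\<lambda>(r, c). A $$ (r div dim_row B, c div dim_col B) * B $$ (r mod dim_row B, c mod dim_col B))"

definition finite_mat_sum :: "nat \<Rightarrow> ('i \<Rightarrow> complex mat) \<Rightarrow> 'i set \<Rightarrow> complex mat" where
  "finite_mat_sum d F S = mat d d (\<lambda>rc. \<Sum>s\<in>S. F s $$ rc)"

text \<open>Partial trace over the first factor, of dimension \<open>d\<close>; the second has dimension \<open>k\<close>.\<close>

definition partial_trace_fst :: "nat \<Rightarrow> nat \<Rightarrow> complex mat \<Rightarrow> complex mat" where
  "partial_trace_fst d k X = mat k k (\<lambda>(a, b). \<Sum>i<d. X $$ (i * k + a, i * k + b))"

section \<open>Maps on operators\<close>

text \<open>
  \<open>map_tensor_id din dout k \<Phi>\<close> is \<open>\<Phi> \<otimes> id\<close> with an identity on a \<open>k\<close>-dimensional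
  second factor: for each pair \<open>a, b\<close> of basis indices of that factor, \<open>\<Phi>\<close> is applied to
  the block of entries \<open>((i, a), (j, b))\<close>.
\<close>

definition map_tensor_id ::
  "nat \<Rightarrow> nat \<Rightarrow> nat \<Rightarrow> (complex mat \<Rightarrow> complex mat) \<Rightarrow> complex mat \<Rightarrow> complex mat" where
  "map_tensor_id din dout k \<Phi> X = mat (dout * k) (dout * k)
     (\<lambda>(r, c). \<Phi> (mat din din (\<lambda>(i, j). X $$ (i * k + r mod k, j * k + c mod k)))
                 $$ (r div k, c div k))"

definition linear_map :: "nat \<Rightarrow> nat \<Rightarrow> (complex mat \<Rightarrow> complex mat) \<Rightarrow> bool" where
  "linear_map din dout \<Phi> \<longleftrightarrow>
     (\<forall>X \<in> carrier_mat din din. \<Phi> X \<in> carrier_mat dout dout) \<and>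
     (\<forall>X \<in> carrier_mat din din. \<forall>Y \<in> carrier_mat din din. \<Phi> (X + Y) = \<Phi> X + \<Phi> Y) \<and>
     (\<forall>a. \<forall>X \<in> carrier_mat din din. \<Phi> (a \<cdot>\<^sub>m X) = a \<cdot>\<^sub>m \<Phi> X)"

definition completely_positive :: "nat \<Rightarrow> nat \<Rightarrow> (complex mat \<Rightarrow> complex mat) \<Rightarrow> bool" where
  "completely_positive din dout \<Phi> \<longleftrightarrow> linear_map din dout \<Phi> \<and>
     (\<forall>k X. psd (din * k) X \<longrightarrow> psd (dout * k) (map_tensor_id din dout k \<Phi> X))"

definition cptp :: "nat \<Rightarrow> nat \<Rightarrow> (complex mat \<Rightarrow> complex mat) \<Rightarrow> bool" where
  "cptp din dout \<Phi> \<longleftrightarrow> completely_positive din dout \<Phi> \<and>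
     (\<forall>X \<in> carrier_mat din din. mat_trace (\<Phi> X) = mat_trace X)"

definition instrument ::
  "nat \<Rightarrow> nat \<Rightarrow> nat set \<Rightarrow> (nat \<Rightarrow> complex mat \<Rightarrow> complex mat) \<Rightarrow> bool" where
  "instrument din dout Out J \<longleftrightarrow>
     (\<forall>x \<in> Out. completely_positive din dout (J x) \<and>
        (\<forall>X. psd din X \<longrightarrow> Re (mat_trace (J x X)) \<le> Re (mat_trace X))) \<and>
     (\<forall>X \<in> carrier_mat din din. (\<Sum>x\<in>Out. mat_trace (J x X)) = mat_trace X)"

definition povm :: "nat \<Rightarrow> nat set \<Rightarrow> (nat \<Rightarrow> complex mat) \<Rightarrow> bool" where
  "povm d Out E \<longleftrightarrow> (\<forall>x \<in> Out. psd d (E x)) \<and> finite_mat_sum d E Out = 1\<^sub>m d"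

section \<open>Conditional min-entropy\<close>

text \<open>
  The value is an extended real because, for a \<open>\<sigma>\<close> whose support is too small, no \<open>\<kappa>\<close> is
  admissible and the inner supremum is \<open>-\<infinity>\<close>.
\<close>

definition hmin :: "nat \<Rightarrow> nat \<Rightarrow> complex mat \<Rightarrow> ereal" where
  "hmin dS dA \<rho> = (SUP \<sigma> \<in> {\<sigma>. density_operator dA \<sigma>}.
     SUP \<kappa> \<in> {\<kappa> :: real. loewner_le (dS * dA) \<rho>
                 (complex_of_real (2 powr (- \<kappa>)) \<cdot>\<^sub>m tensor_mat (1\<^sub>m dS) \<sigma>)}. ereal \<kappa>)"

text \<open>
  The relation \<open>H\<^sub>m\<^sub>i\<^sub>n(S|A) \<ge> -\<eta>\<close> for a measurement. Outcomes of trace zero carry no \<open>\<sigma>\<close>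
  and contribute nothing to the sum.
\<close>

definition povm_hmin_ge ::
  "nat \<Rightarrow> nat \<Rightarrow> nat set \<Rightarrow> (nat \<Rightarrow> complex mat) \<Rightarrow> real \<Rightarrow> bool" where
  "povm_hmin_ge dS dA Out E \<eta> \<longleftrightarrow>
     (let Out' = {x \<in> Out. 0 < Re (mat_trace (E x))} in
      \<exists>\<sigma>. (\<forall>x \<in> Out'. density_operator dA (\<sigma> x) \<and>
              loewner_le (dS * dA) ((1 / mat_trace (E x)) \<cdot>\<^sub>m E x)
                (complex_of_real (2 powr \<eta>) \<cdot>\<^sub>m tensor_mat (1\<^sub>m dS) (\<sigma> x))) \<and>
          finite_mat_sum dA (\<lambda>x. mat_trace (E x) \<cdot>\<^sub>m \<sigma> x) Out' = of_nat dS \<cdot>\<^sub>m 1\<^sub>m dA)"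

section \<open>Pauli channels\<close>

datatype pauli = Pauli_I | Pauli_X | Pauli_Y | Pauli_Z

fun pauli_matrix :: "pauli \<Rightarrow> complex mat" where
  "pauli_matrix Pauli_I = 1\<^sub>m 2"
| "pauli_matrix Pauli_X = mat_of_rows_list 2 [[0, 1], [1, 0]]"
| "pauli_matrix Pauli_Y = mat_of_rows_list 2 [[0, - \<i>], [\<i>, 0]]"
| "pauli_matrix Pauli_Z = mat_of_rows_list 2 [[1, 0], [0, - 1]]"

fun pauli_op :: "pauli list \<Rightarrow> complex mat" where
  "pauli_op [] = 1\<^sub>m 1"
| "pauli_op (P # Ps) = tensor_mat (pauli_matrix P) (pauli_op Ps)"

definition pauli_strings :: "nat \<Rightarrow> pauli list set" where
  "pauli_strings n = {Ps. length Ps = n}"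

definition pauli_distribution :: "nat \<Rightarrow> (pauli list \<Rightarrow> real) \<Rightarrow> bool" where
  "pauli_distribution n p \<longleftrightarrow>
     (\<forall>P \<in> pauli_strings n. 0 \<le> p P) \<and> (\<Sum>P\<in>pauli_strings n. p P) = 1"

definition pauli_channel :: "nat \<Rightarrow> (pauli list \<Rightarrow> real) \<Rightarrow> complex mat \<Rightarrow> complex mat" where
  "pauli_channel n p \<rho> = finite_mat_sum (2 ^ n)
     (\<lambda>P. complex_of_real (p P) \<cdot>\<^sub>m (pauli_op P * \<rho> * pauli_op P)) (pauli_strings n)"

definition pauli_eigenvalue :: "(complex mat \<Rightarrow> complex mat) \<Rightarrow> pauli list \<Rightarrow> real" where
  "pauli_eigenvalue \<Lambda> P = (THE l. \<Lambda> (pauli_op P) = complex_of_real l \<cdot>\<^sub>m pauli_op P)"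

text \<open>
  \<open>pauli_eigenvalue\<close> is well defined: every Pauli string is an eigenvector of every Pauli channel,
  with a unique real eigenvalue.
\<close>

lemma tensor_mat_carrier [simp]:
  "A \<in> carrier_mat a b \<Longrightarrow> B \<in> carrier_mat c d \<Longrightarrow> tensor_mat A B \<in> carrier_mat (a * c) (b * d)"
  by (auto simp: tensor_mat_def)

lemma tensor_mat_mult:
  assumes A: "A \<in> carrier_mat a a" and B: "B \<in> carrier_mat b b"
    and C: "C \<in> carrier_mat a a" and D: "D \<in> carrier_mat b b"
  shows "tensor_mat A B * tensor_mat C D = tensor_mat (A * C) (B * D)"
proof (rule eq_matI)
  fix r c assume "r < dim_row (tensor_mat (A * C) (B * D))" "c < dim_col (tensor_mat (A * C) (B * D))"
  then have r: "r < a * b" and c: "c < a * b"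
    using assms by (auto simp: tensor_mat_def)
  have b: "0 < b" using r by (cases b) auto
  have rd: "r div b < a" "c div b < a" "r mod b < b" "c mod b < b"
    using r c b by (auto simp: less_mult_imp_div_less)
  let ?f = "\<lambda>i j. A $$ (r div b, i) * B $$ (r mod b, j) * (C $$ (i, c div b) * D $$ (j, c mod b))"
  have "(tensor_mat A B * tensor_mat C D) $$ (r, c) = (\<Sum>k<a * b. ?f (k div b) (k mod b))"
    using assms r c by (simp add: tensor_mat_def scalar_prod_def atLeast0LessThan)
  also have "\<dots> = (\<Sum>(i, j)\<in>{..<a} \<times> {..<b}. ?f i j)"
  proof (rule sum.reindex_bij_witness[where i = "\<lambda>(i, j). i * b + j" and j = "\<lambda>k. (k div b, k mod b)"])
    fix x assume "x \<in> {..<a} \<times> {..<b}"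
    then obtain i j where x: "x = (i, j)" "i < a" "j < b" by auto
    have "i * b + j < Suc i * b" using x by simp
    also have "\<dots> \<le> a * b" using x by (intro mult_right_mono) auto
    finally show "(case x of (i, j) \<Rightarrow> i * b + j) \<in> {..<a * b}" using x by simp
    show "((case x of (i, j) \<Rightarrow> i * b + j) div b, (case x of (i, j) \<Rightarrow> i * b + j) mod b) = x"
      using x by simp
  qed (use b in \<open>auto simp: less_mult_imp_div_less\<close>)
  also have "\<dots> = (\<Sum>i<a. A $$ (r div b, i) * C $$ (i, c div b)) * (\<Sum>j<b. B $$ (r mod b, j) * D $$ (j, c mod b))"
    by (simp add: sum_product sum.cartesian_product ac_simps)
  also have "\<dots> = tensor_mat (A * C) (B * D) $$ (r, c)"
    using assms r c rd by (simp add: tensor_mat_def scalar_prod_def atLeast0LessThan)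
  finally show "(tensor_mat A B * tensor_mat C D) $$ (r, c) = tensor_mat (A * C) (B * D) $$ (r, c)" .
qed (use assms in \<open>auto simp: tensor_mat_def\<close>)

lemma tensor_mat_smult:
  assumes A: "A \<in> carrier_mat a a" and B: "B \<in> carrier_mat b b"
  shows "tensor_mat (s \<cdot>\<^sub>m A) (t \<cdot>\<^sub>m B) = (s * t) \<cdot>\<^sub>m tensor_mat A B"
proof (rule eq_matI)
  fix r c assume "r < dim_row ((s * t) \<cdot>\<^sub>m tensor_mat A B)" "c < dim_col ((s * t) \<cdot>\<^sub>m tensor_mat A B)"
  then have r: "r < a * b" and c: "c < a * b"
    using assms by (auto simp: tensor_mat_def)
  have "0 < b" using r by (cases b) auto
  then have "r div b < a" "c div b < a" "r mod b < b" "c mod b < b"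
    using r c by (auto simp: less_mult_imp_div_less)
  then show "tensor_mat (s \<cdot>\<^sub>m A) (t \<cdot>\<^sub>m B) $$ (r, c) = ((s * t) \<cdot>\<^sub>m tensor_mat A B) $$ (r, c)"
    using assms r c by (simp add: tensor_mat_def)
qed (use assms in \<open>auto simp: tensor_mat_def\<close>)

lemma tensor_mat_one: "tensor_mat (1\<^sub>m a) (1\<^sub>m b) = 1\<^sub>m (a * b)"
proof (rule eq_matI)
  fix r c assume "r < dim_row (1\<^sub>m (a * b) :: complex mat)" "c < dim_col (1\<^sub>m (a * b) :: complex mat)"
  then have r: "r < a * b" and c: "c < a * b" by auto
  have "0 < b" using r by (cases b) auto
  then have "r div b < a" "c div b < a" "r mod b < b" "c mod b < b"
    using r c by (auto simp: less_mult_imp_div_less)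
  moreover have "r div b = c div b \<and> r mod b = c mod b \<longleftrightarrow> r = c"
    by (metis div_mult_mod_eq)
  ultimately show "tensor_mat (1\<^sub>m a) (1\<^sub>m b) $$ (r, c) = 1\<^sub>m (a * b) $$ (r, c)"
    using r c by (auto simp: tensor_mat_def)
qed (auto simp: tensor_mat_def)

lemma pauli_matrix_carrier [simp]: "pauli_matrix P \<in> carrier_mat 2 2"
  by (cases P) (auto simp: mat_of_rows_list_def)

lemma pauli_op_carrier [simp]: "pauli_op Ps \<in> carrier_mat (2 ^ length Ps) (2 ^ length Ps)"
  by (induction Ps) auto

lemma pauli_matrix_square: "pauli_matrix P * pauli_matrix P = 1\<^sub>m 2"
  by (cases P; intro eq_matI)
    (auto simp: mat_of_rows_list_def scalar_prod_def less_Suc_eq numeral_2_eq_2)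

lemma pauli_op_square: "pauli_op P * pauli_op P = 1\<^sub>m (2 ^ length P)"
proof (induction P)
  case (Cons x P)
  show ?case
    using tensor_mat_mult[OF pauli_matrix_carrier pauli_op_carrier pauli_matrix_carrier pauli_op_carrier, of x P x]
    by (simp add: pauli_matrix_square Cons tensor_mat_one)
qed auto

lemma pauli_matrix_conj:
  "\<exists>s :: real. pauli_matrix P * pauli_matrix Q * pauli_matrix P = complex_of_real s \<cdot>\<^sub>m pauli_matrix Q"
proof -
  let ?s = "if P = Q \<or> P = Pauli_I \<or> Q = Pauli_I then 1 else - 1 :: real"
  have "pauli_matrix P * pauli_matrix Q * pauli_matrix P = complex_of_real ?s \<cdot>\<^sub>m pauli_matrix Q"
    by (cases P; cases Q; intro eq_matI)
      (auto simp: mat_of_rows_list_def scalar_prod_def less_Suc_eq numeral_2_eq_2)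
  then show ?thesis by blast
qed

lemma pauli_op_conj:
  assumes "length P = length Q"
  shows "\<exists>s :: real. pauli_op P * pauli_op Q * pauli_op P = complex_of_real s \<cdot>\<^sub>m pauli_op Q"
  using assms
proof (induction P Q rule: list_induct2)
  case Nil
  show ?case by (intro exI[of _ 1]) auto
next
  case (Cons x xs y ys)
  obtain s where s: "pauli_op xs * pauli_op ys * pauli_op xs = complex_of_real s \<cdot>\<^sub>m pauli_op ys"
    using Cons.IH by blast
  obtain t where t: "pauli_matrix x * pauli_matrix y * pauli_matrix x = complex_of_real t \<cdot>\<^sub>m pauli_matrix y"
    using pauli_matrix_conj by blast
  have cx: "pauli_op xs \<in> carrier_mat (2 ^ length ys) (2 ^ length ys)"
    using pauli_op_carrier[of xs] Cons.hyps by simp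
  have cxy: "pauli_op xs * pauli_op ys \<in> carrier_mat (2 ^ length ys) (2 ^ length ys)"
    "pauli_matrix x * pauli_matrix y \<in> carrier_mat 2 2"
    using cx by (auto intro!: mult_carrier_mat[where n = 2] pauli_matrix_carrier)
  show ?case
    by (intro exI[of _ "t * s"])
      (simp add: tensor_mat_mult[OF pauli_matrix_carrier cx pauli_matrix_carrier pauli_op_carrier]
        tensor_mat_mult[OF cxy(2) cxy(1) pauli_matrix_carrier cx] s t
        tensor_mat_smult[OF pauli_matrix_carrier pauli_op_carrier])
qed

lemma pauli_eigenvalue:
  assumes "length P = n"
  shows "pauli_channel n p (pauli_op P) =
    complex_of_real (pauli_eigenvalue (pauli_channel n p) P) \<cdot>\<^sub>m pauli_op P"
proof -
  have cP: "pauli_op P \<in> carrier_mat (2 ^ n) (2 ^ n)"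
    using assms pauli_op_carrier by blast
  have "\<forall>Q. \<exists>s. length Q = n \<longrightarrow> pauli_op Q * pauli_op P * pauli_op Q = complex_of_real s \<cdot>\<^sub>m pauli_op P"
    using pauli_op_conj assms by blast
  then obtain s where s: "\<And>Q. length Q = n \<Longrightarrow>
      pauli_op Q * pauli_op P * pauli_op Q = complex_of_real (s Q) \<cdot>\<^sub>m pauli_op P"
    by metis
  have ex: "pauli_channel n p (pauli_op P) =
      complex_of_real (\<Sum>Q\<in>pauli_strings n. p Q * s Q) \<cdot>\<^sub>m pauli_op P"
    using cP by (intro eq_matI)
      (auto simp: pauli_channel_def finite_mat_sum_def pauli_strings_def s sum_distrib_left sum_distrib_right ac_simps
         intro!: sum.cong)
  have uniq: "l = m" if "complex_of_real l \<cdot>\<^sub>m pauli_op P = complex_of_real m \<cdot>\<^sub>m pauli_op P" for l m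
  proof -
    have "complex_of_real l \<cdot>\<^sub>m 1\<^sub>m (2 ^ n) = (complex_of_real l \<cdot>\<^sub>m pauli_op P) * pauli_op P"
      using pauli_op_square[of P] assms mult_smult_assoc_mat[OF cP cP] by simp
    also have "\<dots> = complex_of_real m \<cdot>\<^sub>m 1\<^sub>m (2 ^ n)"
      using pauli_op_square[of P] assms mult_smult_assoc_mat[OF cP cP] that by simp
    finally have "(complex_of_real l \<cdot>\<^sub>m 1\<^sub>m (2 ^ n)) $$ (0, 0) = (complex_of_real m \<cdot>\<^sub>m 1\<^sub>m (2 ^ n)) $$ (0, 0)"
      by simp
    then show ?thesis by simp
  qed
  show ?thesis
    unfolding pauli_eigenvalue_def
    by (rule theI[where P = "\<lambda>l. pauli_channel n p (pauli_op P) = complex_of_real l \<cdot>\<^sub>m pauli_op P", OF ex])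
      (use ex uniq in metis)
qed

section \<open>Outcome records and the learning task\<close>

text \<open>
  Rounds are numbered from \<open>0\<close>. Outcomes are natural numbers, and the finite set of possible
  outcomes of a round may depend on the record of earlier outcomes. In round \<open>l\<close> the record
  before the measurement is \<open>take l h\<close> and the outcome is \<open>h ! l\<close>.
\<close>

record protocol =
  outcomes :: "nat list \<Rightarrow> nat set"
  estimate :: "nat list \<Rightarrow> pauli list \<Rightarrow> real"

definition histories :: "(nat list \<Rightarrow> nat set) \<Rightarrow> nat \<Rightarrow> nat list set" where
  "histories Out l = {h. length h = l \<and> (\<forall>i<l. h ! i \<in> Out (take i h))}"

definition solves_learning ::
  "nat \<Rightarrow> real \<Rightarrow> nat \<Rightarrow> ('a protocol_scheme \<Rightarrow> (complex mat \<Rightarrow> complex mat) \<Rightarrow> nat list \<Rightarrow> real) \<Rightarrow>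
   'a protocol_scheme \<Rightarrow> bool" where
  "solves_learning n \<epsilon> N record_prob \<pi> \<longleftrightarrow>
     (\<forall>p. pauli_distribution n p \<longrightarrow>
        (let \<Lambda> = pauli_channel n p in
         2 / 3 \<le> (\<Sum>h \<in> {h \<in> histories (outcomes \<pi>) N.
                        Max ((\<lambda>P. \<bar>estimate \<pi> h P - pauli_eigenvalue \<Lambda> P\<bar>) ` pauli_strings n) \<le> \<epsilon>}.
                   record_prob \<pi> \<Lambda> h)))"

section \<open>Incoherent adaptive protocols\<close>

record incoherent_protocol = protocol +
  inc_anc_dim :: nat
  inc_input :: "nat list \<Rightarrow> complex mat"
  inc_povm :: "nat list \<Rightarrow> nat \<Rightarrow> complex mat"

definition valid_incoherent :: "nat \<Rightarrow> nat \<Rightarrow> incoherent_protocol \<Rightarrow> bool" where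
  "valid_incoherent n N \<pi> \<longleftrightarrow>
     (\<forall>l<N. \<forall>h \<in> histories (outcomes \<pi>) l.
        finite (outcomes \<pi> h) \<and>
        density_operator (2 ^ n * inc_anc_dim \<pi>) (inc_input \<pi> h) \<and>
        povm (2 ^ n * inc_anc_dim \<pi>) (outcomes \<pi> h) (inc_povm \<pi> h))"

definition incoherent_inputs_hmin_ge :: "nat \<Rightarrow> nat \<Rightarrow> real \<Rightarrow> incoherent_protocol \<Rightarrow> bool" where
  "incoherent_inputs_hmin_ge n N \<eta> \<pi> \<longleftrightarrow>
     (\<forall>l<N. \<forall>h \<in> histories (outcomes \<pi>) l.
        ereal (- \<eta>) \<le> hmin (2 ^ n) (inc_anc_dim \<pi>) (inc_input \<pi> h))"

definition incoherent_povms_hmin_ge :: "nat \<Rightarrow> nat \<Rightarrow> real \<Rightarrow> incoherent_protocol \<Rightarrow> bool" where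
  "incoherent_povms_hmin_ge n N \<eta> \<pi> \<longleftrightarrow>
     (\<forall>l<N. \<forall>h \<in> histories (outcomes \<pi>) l.
        povm_hmin_ge (2 ^ n) (inc_anc_dim \<pi>) (outcomes \<pi> h) (inc_povm \<pi> h) \<eta>)"

definition incoherent_prob ::
  "nat \<Rightarrow> nat \<Rightarrow> incoherent_protocol \<Rightarrow> (complex mat \<Rightarrow> complex mat) \<Rightarrow> nat list \<Rightarrow> real" where
  "incoherent_prob n N \<pi> \<Lambda> h =
     (\<Prod>l<N. Re (mat_trace (inc_povm \<pi> (take l h) (h ! l) *
        map_tensor_id (2 ^ n) (2 ^ n) (inc_anc_dim \<pi>) \<Lambda> (inc_input \<pi> (take l h)))))"

section \<open>Input-restricted coherent adaptive protocols\<close>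

text \<open>
  \<open>ir_mem_dim \<pi> l\<close> is the dimension of the memory after \<open>l\<close> rounds, and \<open>ir_anc_dim \<pi> l\<close> is
  that of the ancilla of round \<open>l\<close>.
\<close>

record input_restricted_protocol = protocol +
  ir_mem_dim :: "nat \<Rightarrow> nat"
  ir_anc_dim :: "nat \<Rightarrow> nat"
  ir_input :: "nat list \<Rightarrow> complex mat"
  ir_instrument :: "nat list \<Rightarrow> nat \<Rightarrow> complex mat \<Rightarrow> complex mat"

definition valid_input_restricted :: "nat \<Rightarrow> nat \<Rightarrow> input_restricted_protocol \<Rightarrow> bool" where
  "valid_input_restricted n N \<pi> \<longleftrightarrow>
     ir_mem_dim \<pi> 0 = 1 \<and> ir_mem_dim \<pi> N = 1 \<and>
     (\<forall>l<N. \<forall>h \<in> histories (outcomes \<pi>) l.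
        finite (outcomes \<pi> h) \<and>
        density_operator (2 ^ n * ir_anc_dim \<pi> l) (ir_input \<pi> h) \<and>
        instrument (ir_mem_dim \<pi> l * (2 ^ n * ir_anc_dim \<pi> l)) (ir_mem_dim \<pi> (Suc l))
          (outcomes \<pi> h) (ir_instrument \<pi> h))"

definition input_restricted_hmin_ge ::
  "nat \<Rightarrow> nat \<Rightarrow> real \<Rightarrow> input_restricted_protocol \<Rightarrow> bool" where
  "input_restricted_hmin_ge n N \<eta> \<pi> \<longleftrightarrow>
     (\<forall>l<N. \<forall>h \<in> histories (outcomes \<pi>) l.
        ereal (- \<eta>) \<le> hmin (2 ^ n) (ir_anc_dim \<pi> l) (ir_input \<pi> h))"

text \<open>
  The memory after \<open>l\<close> rounds with record \<open>take l h\<close>, not normalised: its trace is the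
  probability of that record.
\<close>

fun ir_memory ::
  "nat \<Rightarrow> input_restricted_protocol \<Rightarrow> (complex mat \<Rightarrow> complex mat) \<Rightarrow> nat list \<Rightarrow> nat \<Rightarrow> complex mat" where
  "ir_memory n \<pi> \<Lambda> h 0 = 1\<^sub>m 1"
| "ir_memory n \<pi> \<Lambda> h (Suc l) =
     ir_instrument \<pi> (take l h) (h ! l)
       (tensor_mat (ir_memory n \<pi> \<Lambda> h l)
          (map_tensor_id (2 ^ n) (2 ^ n) (ir_anc_dim \<pi> l) \<Lambda> (ir_input \<pi> (take l h))))"

definition input_restricted_prob ::
  "nat \<Rightarrow> nat \<Rightarrow> input_restricted_protocol \<Rightarrow> (complex mat \<Rightarrow> complex mat) \<Rightarrow> nat list \<Rightarrow> real" where
  "input_restricted_prob n N \<pi> \<Lambda> h = Re (mat_trace (ir_memory n \<pi> \<Lambda> h N))"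

section \<open>Measurement-restricted coherent adaptive protocols\<close>

record measurement_restricted_protocol = protocol +
  mr_anc_dim :: "nat \<Rightarrow> nat"
  mr_initial :: "complex mat"
  mr_povm :: "nat list \<Rightarrow> nat \<Rightarrow> complex mat"
  mr_map :: "nat list \<Rightarrow> complex mat \<Rightarrow> complex mat"

text \<open>
  The dimension of the registers of the rounds \<open>l, \<dots>, N - 1\<close>, ordered by round with the system
  before the ancilla in each.
\<close>

definition mr_rest_dim :: "nat \<Rightarrow> nat \<Rightarrow> measurement_restricted_protocol \<Rightarrow> nat \<Rightarrow> nat" where
  "mr_rest_dim n N \<pi> l = (\<Prod>j\<in>{l..<N}. 2 ^ n * mr_anc_dim \<pi> j)"

definition valid_measurement_restricted ::
  "nat \<Rightarrow> nat \<Rightarrow> measurement_restricted_protocol \<Rightarrow> bool" where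
  "valid_measurement_restricted n N \<pi> \<longleftrightarrow>
     density_operator (mr_rest_dim n N \<pi> 0) (mr_initial \<pi>) \<and>
     (\<forall>l<N. \<forall>h \<in> histories (outcomes \<pi>) l.
        finite (outcomes \<pi> h) \<and>
        povm (2 ^ n * mr_anc_dim \<pi> l) (outcomes \<pi> h) (mr_povm \<pi> h)) \<and>
     (\<forall>l<N. \<forall>h \<in> histories (outcomes \<pi>) (Suc l).
        cptp (mr_rest_dim n N \<pi> (Suc l)) (mr_rest_dim n N \<pi> (Suc l)) (mr_map \<pi> h))"

definition measurement_restricted_hmin_ge ::
  "nat \<Rightarrow> nat \<Rightarrow> real \<Rightarrow> measurement_restricted_protocol \<Rightarrow> bool" where
  "measurement_restricted_hmin_ge n N \<eta> \<pi> \<longleftrightarrow>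
     (\<forall>l<N. \<forall>h \<in> histories (outcomes \<pi>) l.
        povm_hmin_ge (2 ^ n) (mr_anc_dim \<pi> l) (outcomes \<pi> h) (mr_povm \<pi> h) \<eta>)"

text \<open>
  The state of the remaining registers after \<open>l\<close> rounds with record \<open>take l h\<close>, not normalised:
  its trace is the probability of that record.
\<close>

fun mr_state ::
  "nat \<Rightarrow> nat \<Rightarrow> measurement_restricted_protocol \<Rightarrow> (complex mat \<Rightarrow> complex mat) \<Rightarrow> nat list \<Rightarrow> nat \<Rightarrow>
   complex mat" where
  "mr_state n N \<pi> \<Lambda> h 0 = mr_initial \<pi>"
| "mr_state n N \<pi> \<Lambda> h (Suc l) =
     (let dC = mr_rest_dim n N \<pi> (Suc l); a = mr_anc_dim \<pi> l in
      mr_map \<pi> (take (Suc l) h)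
        (partial_trace_fst (2 ^ n * a) dC
           (tensor_mat (mr_povm \<pi> (take l h) (h ! l)) (1\<^sub>m dC) *
            map_tensor_id (2 ^ n) (2 ^ n) (a * dC) \<Lambda> (mr_state n N \<pi> \<Lambda> h l))))"

definition measurement_restricted_prob ::
  "nat \<Rightarrow> nat \<Rightarrow> measurement_restricted_protocol \<Rightarrow> (complex mat \<Rightarrow> complex mat) \<Rightarrow> nat list \<Rightarrow> real" where
  "measurement_restricted_prob n N \<pi> \<Lambda> h = Re (mat_trace (mr_state n N \<pi> \<Lambda> h N))"

end

theory Submission
  imports Defs "HOL-Analysis.Convex"
begin

text \<open>
  Write the channel as a mixture of conjugations by Pauli strings \<open>Q\<close> and perturb the uniform mixture
  by \<open>\<theta> * s(P, Q)\<close>, where \<open>s(P, Q) = 1\<close> or \<open>-1\<close> records whether \<open>P\<close> and \<open>Q\<close> commute and \<open>\<theta>\<close> is a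
  little more than \<open>2 * \<epsilon>\<close>. This moves the eigenvalue of \<open>P\<close> from \<open>0\<close> to \<open>\<theta>\<close>, so a learner must tell
  each of the \<open>4 ^ n - 1\<close> perturbed channels from the depolarising one. The signs are the characters
  of an elementary abelian group, so by Parseval's identity no measurement can respond to many
  perturbations at once: the response to \<open>P\<close> is a Fourier coefficient of
  \<open>g(Q) = Tr (E (Q \<rho> Q))\<close>. A min-entropy bound on the state, \<open>\<rho> \<le> I \<otimes> s\<close>, or on the effect, is
  invariant under conjugation by \<open>Q\<close> and hence bounds \<open>g\<close> uniformly in \<open>Q\<close>.

  For incoherent protocols this bounds the chi-squared contribution of each round, and these
  contributions add up in a lower bound for the Hellinger affinity of the record distributions. In the coherent models a
  hybrid argument replaces the channel round by round: the rounds before the current one use the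
  depolarising channel, so that the state does not depend on \<open>P\<close>, and the test formed by the later
  rounds may depend on \<open>P\<close>. An operator version of the Parseval bound, proved with the
  Cauchy-Schwarz inequality for the trace form, covers tests depending on \<open>P\<close>.
\<close>

text \<open>The two rates differ in how \<theta> enters. Without a memory the likelihood ratio of a
  record is a product whose first-order term averages to zero under the depolarising channel, so a
  round costs \<theta>^2. Summed over \<open>P\<close> it costs about \<theta>^2 * 2 ^ n * 2 powr
  \<eta>, against some 4 ^ n strings to be told apart. With a memory this product form is lost and
  the telescoping is in absolute values, hence of first order in \<theta>. There an l^2 bound over
  \<open>P\<close> of squared size 2 ^ n * 2 powr \<eta> becomes an l^1 bound at the price of a
  factor 2 ^ n. This gives 1 / \<epsilon> and the square root of 2 powr (n - \<eta>).

  The factor 9 / 4 exceeds 2, which separates the eigenvalues, and keeps \<theta> at most 3 / 4 for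
  \<epsilon> \<le> 1 / 3, the range of the second-order lower bound for the logarithm that the
  incoherent case uses. The constant 1 / 500 rounds 1 / 486, where 486 = 24 * 81 / 4, from the
  incoherent case; the coherent estimate would allow 1 / 18.\<close>

lemma sum_swap3: "(\<Sum>i\<in>A. \<Sum>j\<in>B. \<Sum>k\<in>C. f i j k) = (\<Sum>k\<in>C. \<Sum>i\<in>A. \<Sum>j\<in>B. f i j k)"
proof -
  have "(\<Sum>i\<in>A. \<Sum>j\<in>B. \<Sum>k\<in>C. f i j k) = (\<Sum>i\<in>A. \<Sum>k\<in>C. \<Sum>j\<in>B. f i j k)"
    by (rule sum.cong[OF refl], rule sum.swap)
  also have "\<dots> = (\<Sum>k\<in>C. \<Sum>i\<in>A. \<Sum>j\<in>B. f i j k)" by (rule sum.swap)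
  finally show ?thesis .
qed

lemma cnj_times_self: "cnj z * z = of_real ((cmod z)\<^sup>2)"
  by (metis complex_norm_square mult.commute)

section \<open>Adjoints, traces and finite sums of matrices\<close>

lemma mat_adjoint_dim [simp]: "dim_row (mat_adjoint A) = dim_col A" "dim_col (mat_adjoint A) = dim_row A"
  by (auto simp: mat_adjoint_def)

lemma mat_adjoint_carrier [simp]: "A \<in> carrier_mat a b \<Longrightarrow> mat_adjoint A \<in> carrier_mat b a"
  by (auto intro!: carrier_matI)

lemma mat_adjoint_index:
  fixes A :: "complex mat"
  shows "i < dim_col A \<Longrightarrow> j < dim_row A \<Longrightarrow> mat_adjoint A $$ (i, j) = cnj (A $$ (j, i))"
  by (simp add: mat_adjoint_def mat_of_rows_index)

lemma times_mat_index:
  fixes A :: "'a :: semiring_0 mat"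
  shows "A \<in> carrier_mat a b \<Longrightarrow> B \<in> carrier_mat b c \<Longrightarrow> i < a \<Longrightarrow> j < c \<Longrightarrow>
    (A * B) $$ (i, j) = (\<Sum>k<b. A $$ (i, k) * B $$ (k, j))"
  by (simp add: scalar_prod_def atLeast0LessThan)

lemma mat_trace_times:
  "A \<in> carrier_mat d d \<Longrightarrow> B \<in> carrier_mat d d \<Longrightarrow>
    mat_trace (A * B) = (\<Sum>i<d. \<Sum>j<d. A $$ (i, j) * B $$ (j, i))"
  unfolding mat_trace_def by (intro sum.cong) (auto simp: times_mat_index[of A d d B d] simp del: index_mult_mat(1))

lemma mat_trace_add: "A \<in> carrier_mat d d \<Longrightarrow> B \<in> carrier_mat d d \<Longrightarrow> mat_trace (A + B) = mat_trace A + mat_trace B"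
  by (auto simp: mat_trace_def sum.distrib)

lemma mat_trace_minus: "A \<in> carrier_mat d d \<Longrightarrow> B \<in> carrier_mat d d \<Longrightarrow> mat_trace (A - B) = mat_trace A - mat_trace B"
  by (auto simp: mat_trace_def sum_subtractf)

lemma mat_trace_smult: "A \<in> carrier_mat d d \<Longrightarrow> mat_trace (c \<cdot>\<^sub>m A) = c * mat_trace A"
  by (auto simp: mat_trace_def sum_distrib_left)

lemma mat_trace_comm:
  "A \<in> carrier_mat d d \<Longrightarrow> B \<in> carrier_mat d d \<Longrightarrow> mat_trace (A * B) = mat_trace (B * A)"
  by (simp add: mat_trace_times[of _ d]) (subst sum.swap, simp add: mult.commute)

lemma mat_trace_one [simp]: "mat_trace (1\<^sub>m d) = of_nat d"
  by (simp add: mat_trace_def)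

lemma finite_mat_sum_carrier [simp]: "finite_mat_sum d F S \<in> carrier_mat d d"
  by (simp add: finite_mat_sum_def)

lemma finite_mat_sum_index: "i < d \<Longrightarrow> j < d \<Longrightarrow> finite_mat_sum d F S $$ (i, j) = (\<Sum>s\<in>S. F s $$ (i, j))"
  by (simp add: finite_mat_sum_def)

lemma finite_mat_sum_empty: "finite_mat_sum d F {} = 0\<^sub>m d d"
  by (auto simp: finite_mat_sum_def)

lemma finite_mat_sum_insert:
  "finite S \<Longrightarrow> x \<notin> S \<Longrightarrow> F x \<in> carrier_mat d d \<Longrightarrow>
    finite_mat_sum d F (insert x S) = F x + finite_mat_sum d F S"
  by (intro eq_matI) (auto simp: finite_mat_sum_def)

lemma finite_mat_sum_cong: "(\<And>x. x \<in> S \<Longrightarrow> F x = G x) \<Longrightarrow> finite_mat_sum d F S = finite_mat_sum d G S"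
  by (auto simp: finite_mat_sum_def intro!: cong_mat sum.cong)

lemma mat_trace_finite_mat_sum:
  "(\<And>x. x \<in> S \<Longrightarrow> F x \<in> carrier_mat d d) \<Longrightarrow> mat_trace (finite_mat_sum d F S) = (\<Sum>x\<in>S. mat_trace (F x))"
  by (simp add: mat_trace_def finite_mat_sum_def) (subst sum.swap, intro sum.cong, auto)

lemma mat_trace_times_finite_mat_sum:
  assumes "A \<in> carrier_mat d d" "\<And>x. x \<in> S \<Longrightarrow> F x \<in> carrier_mat d d"
  shows "mat_trace (A * finite_mat_sum d F S) = (\<Sum>x\<in>S. mat_trace (A * F x))"
proof -
  have "mat_trace (A * finite_mat_sum d F S) = (\<Sum>i<d. \<Sum>j<d. \<Sum>x\<in>S. A $$ (i, j) * F x $$ (j, i))"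
    using assms by (simp add: mat_trace_times[of _ d] finite_mat_sum_index sum_distrib_left)
  also have "\<dots> = (\<Sum>x\<in>S. \<Sum>i<d. \<Sum>j<d. A $$ (i, j) * F x $$ (j, i))"
    by (rule sum_swap3)
  also have "\<dots> = (\<Sum>x\<in>S. mat_trace (A * F x))"
    using assms by (intro sum.cong refl) (simp add: mat_trace_times[of _ d])
  finally show ?thesis .
qed

lemma mat_trace_finite_mat_sum_times:
  assumes "A \<in> carrier_mat d d" "\<And>x. x \<in> S \<Longrightarrow> F x \<in> carrier_mat d d"
  shows "mat_trace (finite_mat_sum d F S * A) = (\<Sum>x\<in>S. mat_trace (F x * A))"
proof -
  have "mat_trace (finite_mat_sum d F S * A) = (\<Sum>x\<in>S. mat_trace (A * F x))"
    using assms by (simp add: mat_trace_comm[of _ d A] mat_trace_times_finite_mat_sum)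
  then show ?thesis using assms by (simp add: mat_trace_comm[of A d])
qed

lemma finite_mat_sum_times:
  assumes "A \<in> carrier_mat d d" "\<And>x. x \<in> S \<Longrightarrow> F x \<in> carrier_mat d d"
  shows "finite_mat_sum d F S * A = finite_mat_sum d (\<lambda>x. F x * A) S"
proof (rule eq_matI)
  fix i j assume "i < dim_row (finite_mat_sum d (\<lambda>x. F x * A) S)" "j < dim_col (finite_mat_sum d (\<lambda>x. F x * A) S)"
  then have ij: "i < d" "j < d" by (auto simp: finite_mat_sum_def)
  have "(finite_mat_sum d F S * A) $$ (i, j) = (\<Sum>x\<in>S. \<Sum>k<d. F x $$ (i, k) * A $$ (k, j))"
    using assms ij by (subst times_mat_index[of _ d d _ d]) (auto simp: finite_mat_sum_index sum_distrib_right intro: sum.swap)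
  also have "\<dots> = finite_mat_sum d (\<lambda>x. F x * A) S $$ (i, j)"
    using assms ij by (simp add: finite_mat_sum_index) (intro sum.cong refl, subst times_mat_index[of _ d d _ d], auto)
  finally show "(finite_mat_sum d F S * A) $$ (i, j) = finite_mat_sum d (\<lambda>x. F x * A) S $$ (i, j)" .
qed (use assms in \<open>auto simp: finite_mat_sum_def\<close>)

section \<open>Positive semidefinite matrices\<close>

text \<open>Stated for an entry function instead of a matrix, since the remainders of the
  elimination below are built entrywise.\<close>

definition quad_form :: "nat \<Rightarrow> (nat \<Rightarrow> nat \<Rightarrow> complex) \<Rightarrow> (nat \<Rightarrow> complex) \<Rightarrow> complex" where
  "quad_form d x v = (\<Sum>i<d. \<Sum>j<d. cnj (v i) * x i j * v j)"

lemma quad_form_mat: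
  assumes "X \<in> carrier_mat d d"
  shows "(X *\<^sub>v vec d v) \<bullet>c vec d v = quad_form d (\<lambda>i j. X $$ (i, j)) v"
  using assms by (simp add: quad_form_def scalar_prod_def atLeast0LessThan sum_distrib_left sum_distrib_right)
     (simp add: ac_simps)

lemma psd_iff_quad_form:
  "psd d X \<longleftrightarrow> X \<in> carrier_mat d d \<and> (\<forall>i<d. \<forall>j<d. X $$ (i, j) = cnj (X $$ (j, i))) \<and>
     (\<forall>v. 0 \<le> Re (quad_form d (\<lambda>i j. X $$ (i, j)) v))" (is "?l \<longleftrightarrow> ?r")
proof
  assume l: ?l
  then have X: "X \<in> carrier_mat d d" "mat_adjoint X = X" by (auto simp: psd_def)
  have "X $$ (i, j) = cnj (X $$ (j, i))" if "i < d" "j < d" for i j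
    using mat_adjoint_index[of i X j] X that by auto
  moreover have "0 \<le> Re (quad_form d (\<lambda>i j. X $$ (i, j)) v)" for v
    using l quad_form_mat[OF X(1), of v] unfolding psd_def by (metis vec_carrier)
  ultimately show ?r using X by blast
next
  assume r: ?r
  then have X: "X \<in> carrier_mat d d" by blast
  have "mat_adjoint X = X"
  proof (rule eq_matI)
    fix i j assume "i < dim_row X" "j < dim_col X"
    then have "i < d" "j < d" using X by auto
    then show "mat_adjoint X $$ (i, j) = X $$ (i, j)"
      using r X mat_adjoint_index[of i X j] by (metis carrier_matD)
  qed (use X in auto)
  moreover have "0 \<le> Re ((X *\<^sub>v v) \<bullet>c v)" if v: "v \<in> carrier_vec d" for v
  proof -
    have "v = vec d (\<lambda>i. v $ i)" using v by auto
    then show ?thesis using quad_form_mat[OF X, of "\<lambda>i. v $ i"] r by metis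
  qed
  ultimately show ?l using X by (auto simp: psd_def)
qed

lemma psd_carrier [simp]: "psd d X \<Longrightarrow> X \<in> carrier_mat d d"
  by (simp add: psd_def)

lemma psdI:
  assumes "X \<in> carrier_mat d d" "\<And>i j. i < d \<Longrightarrow> j < d \<Longrightarrow> X $$ (i, j) = cnj (X $$ (j, i))"
    "\<And>v. 0 \<le> Re (quad_form d (\<lambda>i j. X $$ (i, j)) v)"
  shows "psd d X"
  unfolding psd_iff_quad_form using assms by blast

lemma psd_hermitian: "psd d X \<Longrightarrow> i < d \<Longrightarrow> j < d \<Longrightarrow> X $$ (i, j) = cnj (X $$ (j, i))"
  unfolding psd_iff_quad_form by blast

lemma psd_quad_form: "psd d X \<Longrightarrow> 0 \<le> Re (quad_form d (\<lambda>i j. X $$ (i, j)) v)"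
  unfolding psd_iff_quad_form by blast

text \<open>Changing one coordinate of \<open>v\<close> makes the form a quadratic in
  \<open>z\<close> and its conjugate. A good choice of \<open>z\<close> either violates positivity,
  which forces a row to vanish, or completes the square, which shows that eliminating an index
  preserves positivity.\<close>

lemma quad_form_shift:
  assumes h: "\<And>i j. i < d \<Longrightarrow> j < d \<Longrightarrow> x i j = cnj (x j i)" and m: "m < d"
  shows "quad_form d x (\<lambda>i. v i + (if i = m then z else 0)) =
    quad_form d x v + 2 * of_real (Re (cnj z * (\<Sum>j<d. x m j * v j))) + of_real ((cmod z)\<^sup>2) * x m m"
proof -
  let ?e = "\<lambda>i. if i = m then z else 0"
  let ?s = "\<Sum>j<d. x m j * v j"
  have "quad_form d x (\<lambda>i. v i + ?e i) = quad_form d x v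
     + (\<Sum>i<d. \<Sum>j<d. cnj (?e i) * x i j * v j) + (\<Sum>i<d. \<Sum>j<d. cnj (v i) * x i j * ?e j)
     + (\<Sum>i<d. \<Sum>j<d. cnj (?e i) * x i j * ?e j)"
    unfolding quad_form_def sum.distrib[symmetric] by (intro sum.cong refl) (simp add: algebra_simps)
  moreover have "(\<Sum>i<d. \<Sum>j<d. cnj (?e i) * x i j * v j) = cnj z * ?s"
  proof -
    have "(\<Sum>i<d. \<Sum>j<d. cnj (?e i) * x i j * v j) = (\<Sum>i<d. if i = m then cnj z * (\<Sum>j<d. x i j * v j) else 0)"
      by (intro sum.cong refl) (auto simp: sum_distrib_left ac_simps)
    then show ?thesis using m by simp
  qed
  moreover have "(\<Sum>i<d. \<Sum>j<d. cnj (v i) * x i j * ?e j) = cnj (cnj z * ?s)"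
  proof -
    have "(\<Sum>i<d. \<Sum>j<d. cnj (v i) * x i j * ?e j) = (\<Sum>i<d. cnj (v i) * x i m * z)"
      using m by (intro sum.cong refl) (simp add: if_distrib sum.delta cong: if_cong)
    also have "\<dots> = (\<Sum>i<d. cnj (v i) * cnj (x m i) * z)"
      using h m by (intro sum.cong refl) (metis lessThan_iff)
    also have "\<dots> = cnj (cnj z * ?s)" by (simp add: sum_distrib_left ac_simps)
    finally show ?thesis .
  qed
  moreover have "(\<Sum>i<d. \<Sum>j<d. cnj (?e i) * x i j * ?e j) = of_real ((cmod z)\<^sup>2) * x m m"
  proof -
    have "(\<Sum>i<d. \<Sum>j<d. cnj (?e i) * x i j * ?e j) = (\<Sum>i<d. if i = m then cnj z * x m m * z else 0)"
      using m by (intro sum.cong refl) (auto simp: if_distrib sum.delta cong: if_cong)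
    then show ?thesis using m by (simp add: complex_norm_square mult.commute mult.left_commute del: of_real_power)
  qed
  moreover have "cnj z * ?s + cnj (cnj z * ?s) = 2 * of_real (Re (cnj z * ?s))"
    by (simp only: complex_add_cnj of_real_mult of_real_numeral)
  ultimately show ?thesis by (simp only: add.assoc)
qed

text \<open>One elimination step per index (a Cholesky decomposition without pivoting): an index with
  vanishing diagonal entry has a vanishing row.\<close>

lemma gram_elimination:
  fixes x :: "nat \<Rightarrow> nat \<Rightarrow> complex"
  assumes h: "\<And>i j. i < d \<Longrightarrow> j < d \<Longrightarrow> x i j = cnj (x j i)"
    and p: "\<And>v. 0 \<le> Re (quad_form d x v)" and "m \<le> d"
  shows "\<exists>u y. (\<forall>i<d. \<forall>j<d. x i j = (\<Sum>k<m. u k i * cnj (u k j)) + y i j) \<and>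
    (\<forall>i<d. \<forall>j<d. y i j = cnj (y j i)) \<and> (\<forall>v. 0 \<le> Re (quad_form d y v)) \<and>
    (\<forall>i<d. \<forall>j<d. i < m \<longrightarrow> y i j = 0)"
  using \<open>m \<le> d\<close>
proof (induction m)
  case 0
  show ?case
  proof (intro exI conjI)
    show "\<forall>i<d. \<forall>j<d. x i j = (\<Sum>k<0. (\<lambda>_ _. 0) k i * cnj ((\<lambda>_ _. 0) k j)) + x i j" by simp
    show "\<forall>i<d. \<forall>j<d. x i j = cnj (x j i)" using h by blast
    show "\<forall>v. 0 \<le> Re (quad_form d x v)" using p by blast
  qed simp
next
  case (Suc m)
  then have m: "m < d" by simp
  from Suc.IH[OF less_imp_le[OF m]] obtain u y where uy: "(\<forall>i<d. \<forall>j<d. x i j = (\<Sum>k<m. u k i * cnj (u k j)) + y i j) \<and>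
    (\<forall>i<d. \<forall>j<d. y i j = cnj (y j i)) \<and> (\<forall>v. 0 \<le> Re (quad_form d y v)) \<and>
    (\<forall>i<d. \<forall>j<d. i < m \<longrightarrow> y i j = 0)" by (elim exE) (rule that)
  have u: "x i j = (\<Sum>k<m. u k i * cnj (u k j)) + y i j" if "i < d" "j < d" for i j
    using uy that by blast
  have yh: "y i j = cnj (y j i)" if "i < d" "j < d" for i j using uy that by blast
  have yp: "0 \<le> Re (quad_form d y v)" for v using uy by blast
  have y0: "y i j = 0" if "i < d" "j < d" "i < m" for i j using uy that by blast
  have shift: "0 \<le> Re (quad_form d y v) + 2 * Re (cnj z * (\<Sum>j<d. y m j * v j)) + (cmod z)\<^sup>2 * Re (y m m)" for v z
    using yp[of "\<lambda>i. v i + (if i = m then z else 0)"] quad_form_shift[of d y m v z, OF yh m] by simp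
  have ymm: "y m m = of_real (Re (y m m))" using yh[OF m m] by (simp add: complex_eq_iff)
  have ymm0: "0 \<le> Re (y m m)"
  proof (rule ccontr)
    assume "\<not> 0 \<le> Re (y m m)"
    then show False using shift[of "\<lambda>_. 0" 1] by (simp add: quad_form_def)
  qed
  define r where "r = Re (y m m)"
  show ?case
  proof (cases "r = 0")
    case True
    have row: "y m j = 0" if j: "j < d" for j
    proof (rule ccontr)
      assume nz: "y m j \<noteq> 0"
      define v where "v = (\<lambda>i. if i = j then 1 else 0 :: complex)"
      \<comment> \<open>A shift by z = - t * y m j lowers the form by 2 * t * |y m j|^2, and the
        zero diagonal entry contributes no quadratic term. With this \<open>t\<close> the decrease
        exceeds the value at the unit vector \<open>v\<close>, so the form becomes negative.\<close>
      define t where "t = (\<bar>Re (quad_form d y v)\<bar> + 1) / (cmod (y m j))\<^sup>2"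
      have s: "(\<Sum>k<d. y m k * v k) = y m j" using j by (simp add: v_def if_distrib sum.delta cong: if_cong)
      have "Re (cnj (- of_real t * y m j) * y m j) = - t * (cmod (y m j))\<^sup>2"
        by (simp add: cmod_power2 algebra_simps) (simp add: power2_eq_square algebra_simps)
      also have "\<dots> = - (\<bar>Re (quad_form d y v)\<bar> + 1)" using nz by (simp add: t_def)
      finally show False
        using shift[of v "- of_real t * y m j"] True s unfolding r_def by simp
    qed
    have "\<forall>i<d. \<forall>j<d. i < Suc m \<longrightarrow> y i j = 0"
    proof (intro allI impI)
      fix i j assume "i < d" "j < d" "i < Suc m"
      then show "y i j = 0" using row[of j] y0[of i j] by (cases "i = m") auto
    qed
    moreover have "\<forall>i<d. \<forall>j<d. x i j = (\<Sum>k<Suc m. (u(m := \<lambda>_. 0)) k i * cnj ((u(m := \<lambda>_. 0)) k j)) + y i j"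
      using u by simp
    moreover have "\<forall>i<d. \<forall>j<d. y i j = cnj (y j i)" "\<forall>v. 0 \<le> Re (quad_form d y v)" by (intro allI impI yh yp; assumption)+
    ultimately show ?thesis by (intro exI[of _ "u(m := \<lambda>_. 0)"] exI[of _ y] conjI)
  next
    case False
    then have r: "r > 0" using ymm0 by (simp add: r_def)
    \<comment> \<open>Column \<open>m\<close> of the remainder divided by the root of its pivot: the
      next Cholesky column. Subtracting its outer product clears row \<open>m\<close> and keeps the
      earlier rows zero.\<close>
    define w where "w i = y i m / of_real (sqrt r)" for i
    define y' where "y' i j = y i j - w i * cnj (w j)" for i j
    have w2: "w i * cnj (w j) = y i m * y m j / of_real r" if "i < d" "j < d" for i j
    proof -
      have "of_real (sqrt r) * cnj (of_real (sqrt r)) = (of_real r :: complex)"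
        using r by (simp flip: of_real_mult)
      then show ?thesis using yh[OF m that(2)] by (simp add: w_def)
    qed
    have "\<forall>i<d. \<forall>j<d. y' i j = cnj (y' j i)"
    proof (intro allI impI)
      fix i j assume "i < d" "j < d"
      from yh[OF this] show "y' i j = cnj (y' j i)" by (simp add: y'_def)
    qed
    moreover have "\<forall>v. 0 \<le> Re (quad_form d y' v)"
    proof
      fix v
      let ?s = "\<Sum>j<d. y m j * v j"
      have cs: "(\<Sum>i<d. cnj (v i) * y i m) = cnj ?s"
        using yh[OF _ m] by (simp add: mult.commute)
      have "quad_form d y' v = quad_form d y v - (\<Sum>i<d. \<Sum>j<d. cnj (v i) * (w i * cnj (w j)) * v j)"
        unfolding quad_form_def sum_subtractf[symmetric] y'_def by (intro sum.cong refl) (simp add: algebra_simps)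
      also have "(\<Sum>i<d. \<Sum>j<d. cnj (v i) * (w i * cnj (w j)) * v j) =
          (\<Sum>i<d. cnj (v i) * y i m) * ?s / of_real r"
      proof -
        have "(\<Sum>i<d. \<Sum>j<d. cnj (v i) * (w i * cnj (w j)) * v j) =
            (\<Sum>i<d. \<Sum>j<d. (cnj (v i) * y i m) * (y m j * v j) / of_real r)"
          by (intro sum.cong refl) (simp add: w2)
        also have "\<dots> = (\<Sum>i<d. cnj (v i) * y i m) * ?s / of_real r"
          by (simp only: sum_product sum_divide_distrib)
        finally show ?thesis .
      qed
      also have "\<dots> = of_real ((cmod ?s)\<^sup>2 / r)"
        unfolding cs cnj_times_self of_real_divide ..
      finally have 1: "Re (quad_form d y' v) = Re (quad_form d y v) - (cmod ?s)\<^sup>2 / r" by simp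
      \<comment> \<open>The shift z = - s / r minimises the quadratic in \<open>z\<close>, and the
        minimum is the value of the new form at \<open>v\<close>.\<close>
      have "Re (cnj (- ?s / of_real r) * ?s) = - (cmod ?s)\<^sup>2 / r"
      proof -
        have "cnj (- z / of_real r) * z = - of_real ((cmod z)\<^sup>2 / r)" for z
          unfolding of_real_divide cnj_times_self[symmetric] by simp
        then show ?thesis by (metis Re_complex_of_real of_real_minus minus_divide_left)
      qed
      moreover have "(cmod (- ?s / of_real r))\<^sup>2 * r = (cmod ?s)\<^sup>2 / r"
        using r by (simp add: norm_divide power_divide power2_eq_square)
      ultimately show "0 \<le> Re (quad_form d y' v)"
        using shift[of v "- ?s / of_real r", folded r_def] unfolding 1 by linarith
    qed
    moreover have y'0: "y' i j = 0" if "i < d" "j < d" "i < Suc m" for i j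
    proof (cases "i = m")
      case True
      have "y m m = of_real r" using ymm by (simp add: r_def)
      then show ?thesis using w2[OF that(1,2)] True r by (simp add: y'_def)
    next
      case False
      then have "i < m" using that by simp
      then show ?thesis using y0[OF that(1) that(2)] y0[OF that(1) m] w2[OF that(1,2)] by (simp add: y'_def)
    qed
    moreover have "x i j = (\<Sum>k<Suc m. (u(m := w)) k i * cnj ((u(m := w)) k j)) + y' i j" if "i < d" "j < d" for i j
      using u[OF that] by (simp add: y'_def)
    ultimately show ?thesis
      by (intro exI[of _ "u(m := w)"] exI[of _ y'] conjI) (assumption | intro allI impI, assumption)+
  qed
qed

text \<open>After all \<open>d\<close> indices are eliminated the remainder is zero. These Gram
  vectors do the work of a spectral decomposition: traces, congruences and tensor products of
  positive matrices are all computed on them.\<close>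

lemma psd_gramE:
  assumes "psd d X"
  obtains u :: "nat \<Rightarrow> nat \<Rightarrow> complex"
  where "\<And>i j. i < d \<Longrightarrow> j < d \<Longrightarrow> X $$ (i, j) = (\<Sum>k<d. u k i * cnj (u k j))"
proof -
  have "\<exists>u y. (\<forall>i<d. \<forall>j<d. X $$ (i, j) = (\<Sum>k<d. u k i * cnj (u k j)) + y i j) \<and>
    (\<forall>i<d. \<forall>j<d. y i j = cnj (y j i)) \<and> (\<forall>v. 0 \<le> Re (quad_form d y v)) \<and>
    (\<forall>i<d. \<forall>j<d. i < d \<longrightarrow> y i j = 0)"
    by (rule gram_elimination) (rule psd_hermitian[OF assms] psd_quad_form[OF assms] order.refl; assumption?)+
  then obtain u y where uy: "(\<forall>i<d. \<forall>j<d. X $$ (i, j) = (\<Sum>k<d. u k i * cnj (u k j)) + y i j) \<and>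
    (\<forall>i<d. \<forall>j<d. y i j = cnj (y j i)) \<and> (\<forall>v. 0 \<le> Re (quad_form d y v)) \<and>
    (\<forall>i<d. \<forall>j<d. i < d \<longrightarrow> y i j = 0)" by (elim exE) (rule that)
  have u: "\<forall>i<d. \<forall>j<d. X $$ (i, j) = (\<Sum>k<d. u k i * cnj (u k j)) + y i j"
    using uy by (elim conjE)
  have y: "\<forall>i<d. \<forall>j<d. i < d \<longrightarrow> y i j = 0" using uy by (elim conjE)
  show ?thesis
  proof (rule that)
    fix i j assume "i < d" "j < d"
    then show "X $$ (i, j) = (\<Sum>k<d. u k i * cnj (u k j))" using u y by simp
  qed
qed

lemma quad_form_gram:
  assumes "\<And>i j. i < d \<Longrightarrow> j < d \<Longrightarrow> x i j = (\<Sum>k\<in>K. u k i * cnj (u k j))"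
  shows "quad_form d x v = of_real (\<Sum>k\<in>K. (cmod (\<Sum>j<d. cnj (u k j) * v j))\<^sup>2)"
proof -
  have "quad_form d x v = (\<Sum>i<d. \<Sum>j<d. \<Sum>k\<in>K. (cnj (v i) * u k i) * (cnj (u k j) * v j))"
    using assms by (simp add: quad_form_def sum_distrib_left sum_distrib_right ac_simps)
  also have "\<dots> = (\<Sum>k\<in>K. \<Sum>i<d. \<Sum>j<d. (cnj (v i) * u k i) * (cnj (u k j) * v j))"
    by (rule sum_swap3)
  also have "\<dots> = (\<Sum>k\<in>K. cnj (\<Sum>j<d. cnj (u k j) * v j) * (\<Sum>j<d. cnj (u k j) * v j))"
  proof (rule sum.cong[OF refl])
    fix k
    have "(\<Sum>i<d. \<Sum>j<d. (cnj (v i) * u k i) * (cnj (u k j) * v j)) =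
        (\<Sum>i<d. cnj (v i) * u k i) * (\<Sum>j<d. cnj (u k j) * v j)" by (simp add: sum_product)
    also have "(\<Sum>i<d. cnj (v i) * u k i) = cnj (\<Sum>j<d. cnj (u k j) * v j)" by (simp add: mult.commute)
    finally show "(\<Sum>i<d. \<Sum>j<d. (cnj (v i) * u k i) * (cnj (u k j) * v j)) =
        cnj (\<Sum>j<d. cnj (u k j) * v j) * (\<Sum>j<d. cnj (u k j) * v j)" .
  qed
  finally show ?thesis by (simp only: cnj_times_self of_real_sum)
qed

lemma psd_gramI:
  assumes X: "X \<in> carrier_mat d d"
    and u: "\<And>i j. i < d \<Longrightarrow> j < d \<Longrightarrow> X $$ (i, j) = (\<Sum>k\<in>K. u k i * cnj (u k j))"
  shows "psd d X"
proof -
  have "0 \<le> Re (quad_form d (\<lambda>i j. X $$ (i, j)) v)" for v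
    by (subst quad_form_gram[OF u]) (auto intro: sum_nonneg)
  then show ?thesis using X by (intro psdI) (simp_all add: u mult.commute)
qed

lemma psd_rank_one: "psd d (mat d d (\<lambda>(i, j). v i * cnj (v j)))"
  by (rule psd_gramI[where K = "{()}" and u = "\<lambda>_. v"]) auto

text \<open>With Gram vectors \<open>u k\<close> of \<open>X\<close> and \<open>w l\<close> of
  \<open>Y\<close>, the trace is the sum of the squared moduli of all their inner products.\<close>

lemma psd_trace_times:
  assumes X: "psd d X" and Y: "psd d Y"
  shows "0 \<le> Re (mat_trace (X * Y))" "Im (mat_trace (X * Y)) = 0"
proof -
  obtain u where u: "\<And>i j. i < d \<Longrightarrow> j < d \<Longrightarrow> X $$ (i, j) = (\<Sum>k<d. u k i * cnj (u k j))"
    using psd_gramE[OF X] by blast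
  obtain w where w: "\<And>i j. i < d \<Longrightarrow> j < d \<Longrightarrow> Y $$ (i, j) = (\<Sum>k<d. w k i * cnj (w k j))"
    using psd_gramE[OF Y] by blast
  have "mat_trace (X * Y) = (\<Sum>i<d. \<Sum>j<d. \<Sum>k<d. u k i * cnj (u k j) * Y $$ (j, i))"
    using X Y by (simp add: mat_trace_times[of _ d] u sum_distrib_right)
  also have "\<dots> = (\<Sum>k<d. \<Sum>i<d. \<Sum>j<d. u k i * cnj (u k j) * Y $$ (j, i))"
    by (rule sum_swap3)
  also have "\<dots> = (\<Sum>k<d. quad_form d (\<lambda>i j. Y $$ (i, j)) (u k))"
    unfolding quad_form_def by (rule sum.cong[OF refl], subst sum.swap) (simp add: ac_simps)
  also have "\<dots> = of_real (\<Sum>k<d. \<Sum>l<d. (cmod (\<Sum>j<d. cnj (w l j) * u k j))\<^sup>2)"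
    by (subst quad_form_gram[OF w]) auto
  finally have *: "mat_trace (X * Y) = of_real (\<Sum>k<d. \<Sum>l<d. (cmod (\<Sum>j<d. cnj (w l j) * u k j))\<^sup>2)" .
  show "0 \<le> Re (mat_trace (X * Y))" "Im (mat_trace (X * Y)) = 0"
    unfolding * by (auto intro!: sum_nonneg simp del: of_real_sum)
qed

lemma psd_one: "psd d (1\<^sub>m d)"
  by (rule psd_gramI[where K = "{..<d}" and u = "\<lambda>k i. if k = i then 1 else 0"])
    (auto simp: if_distrib sum.delta cong: if_cong)

lemma psd_trace:
  assumes "psd d X"
  shows "0 \<le> Re (mat_trace X)" "Im (mat_trace X) = 0"
  using psd_trace_times[OF assms psd_one] right_mult_one_mat[OF psd_carrier[OF assms]] by simp_all

section \<open>Closure properties of the positive cone\<close>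

lemma psd_add:
  assumes X: "psd d X" and Y: "psd d Y"
  shows "psd d (X + Y)"
proof (rule psdI)
  show "X + Y \<in> carrier_mat d d" using X Y by simp
  show "(X + Y) $$ (i, j) = cnj ((X + Y) $$ (j, i))" if "i < d" "j < d" for i j
    using that psd_hermitian[OF X that] psd_hermitian[OF Y that] psd_carrier[OF X] psd_carrier[OF Y] by simp
  fix v
  have "quad_form d (\<lambda>i j. (X + Y) $$ (i, j)) v =
      quad_form d (\<lambda>i j. X $$ (i, j)) v + quad_form d (\<lambda>i j. Y $$ (i, j)) v"
    unfolding quad_form_def sum.distrib[symmetric]
    by (intro sum.cong refl) (use psd_carrier[OF X] psd_carrier[OF Y] in \<open>simp add: algebra_simps\<close>)
  then show "0 \<le> Re (quad_form d (\<lambda>i j. (X + Y) $$ (i, j)) v)"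
    using psd_quad_form[OF X] psd_quad_form[OF Y] by simp
qed

lemma psd_smult:
  assumes X: "psd d X" and c: "0 \<le> c"
  shows "psd d (of_real c \<cdot>\<^sub>m X)"
proof (rule psdI)
  show "of_real c \<cdot>\<^sub>m X \<in> carrier_mat d d" using X by simp
  show "(of_real c \<cdot>\<^sub>m X) $$ (i, j) = cnj ((of_real c \<cdot>\<^sub>m X) $$ (j, i))" if "i < d" "j < d" for i j
    using that psd_hermitian[OF X that] psd_carrier[OF X] by simp
  fix v
  have "quad_form d (\<lambda>i j. (of_real c \<cdot>\<^sub>m X) $$ (i, j)) v =
      of_real c * quad_form d (\<lambda>i j. X $$ (i, j)) v"
    unfolding quad_form_def sum_distrib_left
    by (intro sum.cong refl) (use psd_carrier[OF X] in \<open>simp add: algebra_simps\<close>)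
  then show "0 \<le> Re (quad_form d (\<lambda>i j. (of_real c \<cdot>\<^sub>m X) $$ (i, j)) v)"
    using psd_quad_form[OF X] c by simp
qed

lemma psd_zero: "psd d (0\<^sub>m d d)"
  by (rule psd_gramI[where K = "{}" and u = "\<lambda>k i. 0"]) auto

lemma psd_finite_mat_sum:
  assumes "finite S" "\<And>x. x \<in> S \<Longrightarrow> psd d (F x)"
  shows "psd d (finite_mat_sum d F S)"
  using assms
proof (induction S)
  case empty
  then show ?case by (simp add: finite_mat_sum_empty psd_zero)
next
  case (insert x S)
  then show ?case by (simp add: finite_mat_sum_insert psd_add)
qed

lemma psd_congruence:
  assumes X: "psd d X" and B: "B \<in> carrier_mat e d"
  shows "psd e (B * X * mat_adjoint B)"
proof -
  obtain u where u: "\<And>i j. i < d \<Longrightarrow> j < d \<Longrightarrow> X $$ (i, j) = (\<Sum>k<d. u k i * cnj (u k j))"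
    using psd_gramE[OF X] by blast
  let ?w = "\<lambda>k i. \<Sum>j<d. B $$ (i, j) * u k j"
  have c: "B * X \<in> carrier_mat e d" "mat_adjoint B \<in> carrier_mat d e" using X B by auto
  show ?thesis
  proof (rule psd_gramI[where K = "{..<d}" and u = ?w])
    fix i j assume ij: "i < e" "j < e"
    have "(B * X) $$ (i, l) = (\<Sum>k<d. ?w k i * cnj (u k l))" if "l < d" for l
    proof -
      have "(B * X) $$ (i, l) = (\<Sum>m<d. \<Sum>k<d. B $$ (i, m) * u k m * cnj (u k l))"
        using X B ij that by (subst times_mat_index[of B e d X d]) (simp_all add: u sum_distrib_left mult.assoc)
      also have "\<dots> = (\<Sum>k<d. ?w k i * cnj (u k l))" by (subst sum.swap) (simp add: sum_distrib_right)
      finally show ?thesis .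
    qed
    then have "(B * X * mat_adjoint B) $$ (i, j) = (\<Sum>l<d. \<Sum>k<d. ?w k i * (cnj (B $$ (j, l)) * cnj (u k l)))"
      using B ij by (subst times_mat_index[OF c ij])
        (intro sum.cong refl, simp add: mat_adjoint_index sum_distrib_right sum_distrib_left ac_simps)
    also have "\<dots> = (\<Sum>k<d. ?w k i * (\<Sum>l<d. cnj (B $$ (j, l)) * cnj (u k l)))"
      by (subst sum.swap) (simp only: sum_distrib_left)
    also have "\<dots> = (\<Sum>k<d. ?w k i * cnj (?w k j))" by simp
    finally show "(B * X * mat_adjoint B) $$ (i, j) = (\<Sum>k<d. ?w k i * cnj (?w k j))" .
  qed (use c in auto)
qed

lemma psd_adjoint: "psd d X \<Longrightarrow> mat_adjoint X = X"
  by (simp add: psd_def)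

section \<open>Pauli strings\<close>

definition commutation_sign :: "pauli \<Rightarrow> pauli \<Rightarrow> real" where
  "commutation_sign P Q = (if P = Q \<or> P = Pauli_I \<or> Q = Pauli_I then 1 else - 1)"

text \<open>Strings anticommute when an odd number of positions do, so the sign is a product over
  positions. The second equation is the base case; it also drops the surplus of a longer list, so
  that symmetry and the value 1 at the identity hold for all lists.\<close>

fun pauli_sign :: "pauli list \<Rightarrow> pauli list \<Rightarrow> real" where
  "pauli_sign (P # Ps) (Q # Qs) = commutation_sign P Q * pauli_sign Ps Qs"
| "pauli_sign _ _ = 1"

lemma UNIV_pauli: "(UNIV :: pauli set) = {Pauli_I, Pauli_X, Pauli_Y, Pauli_Z}"
  using pauli.exhaust by blast

lemma pauli_strings_0: "pauli_strings 0 = {[]}"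
  by (auto simp: pauli_strings_def)

lemma pauli_strings_Suc: "pauli_strings (Suc n) = (\<lambda>(P, Ps). P # Ps) ` (UNIV \<times> pauli_strings n)"
  by (auto simp: pauli_strings_def image_iff length_Suc_conv)

lemma sum_pauli_strings_Suc:
  "(\<Sum>Ps\<in>pauli_strings (Suc n). f Ps) = (\<Sum>P\<in>UNIV. \<Sum>Ps\<in>pauli_strings n. f (P # Ps))"
  unfolding pauli_strings_Suc
  by (subst sum.reindex) (auto simp: inj_on_def sum.cartesian_product case_prod_unfold)

lemma finite_pauli_strings [simp]: "finite (pauli_strings n)"
proof (induction n)
  case (Suc n)
  have "finite (UNIV :: pauli set)" by (simp add: UNIV_pauli)
  with Suc show ?case by (simp add: pauli_strings_Suc)
qed (simp add: pauli_strings_0)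

lemma pauli_sign_cases: "pauli_sign P Q = 1 \<or> pauli_sign P Q = - 1"
  by (induction P Q rule: pauli_sign.induct) (auto simp: commutation_sign_def)

lemma pauli_sign_square [simp]: "pauli_sign P Q * pauli_sign P Q = 1"
  using pauli_sign_cases[of P Q] by auto

lemma pauli_sign_commute: "pauli_sign P Q = pauli_sign Q P"
proof (induction P Q rule: pauli_sign.induct)
  case ("2_1" Q)
  then show ?case by (cases Q) auto
next
  case ("2_2" P)
  then show ?case by (cases P) auto
qed (auto simp: commutation_sign_def)

lemma pauli_sign_identity [simp]: "pauli_sign (replicate n Pauli_I) Q = 1"
proof (induction n arbitrary: Q)
  case (Suc n)
  then show ?case by (cases Q) (auto simp: commutation_sign_def)
qed simp

lemma identity_in_pauli_strings [simp]: "replicate n Pauli_I \<in> pauli_strings n"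
  by (simp add: pauli_strings_def)

text \<open>The signs factor over the positions, hence so does the sum, and for one qubit the four
  rows of signs are the orthogonal rows of a 4 by 4 Hadamard matrix.\<close>

lemma pauli_sign_orthogonal:
  "P \<in> pauli_strings n \<Longrightarrow> P' \<in> pauli_strings n \<Longrightarrow>
    (\<Sum>Q\<in>pauli_strings n. pauli_sign P Q * pauli_sign P' Q) = (if P = P' then 4 ^ n else 0)"
proof (induction n arbitrary: P P')
  case 0
  then show ?case by (simp add: pauli_strings_0)
next
  case (Suc n)
  then obtain x xs y ys where P: "P = x # xs" "P' = y # ys" "xs \<in> pauli_strings n" "ys \<in> pauli_strings n"
    by (auto simp: pauli_strings_Suc)
  have "(\<Sum>Q\<in>pauli_strings (Suc n). pauli_sign P Q * pauli_sign P' Q) =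
      (\<Sum>z\<in>UNIV. \<Sum>Q\<in>pauli_strings n. (commutation_sign x z * commutation_sign y z) * (pauli_sign xs Q * pauli_sign ys Q))"
    by (simp add: sum_pauli_strings_Suc P ac_simps)
  also have "\<dots> = (\<Sum>z\<in>UNIV. commutation_sign x z * commutation_sign y z) *
      (\<Sum>Q\<in>pauli_strings n. pauli_sign xs Q * pauli_sign ys Q)"
    by (simp add: sum_product)
  also have "(\<Sum>z\<in>UNIV. commutation_sign x z * commutation_sign y z) = (if x = y then 4 else 0)"
    by (cases x; cases y) (simp_all add: UNIV_pauli commutation_sign_def)
  finally show ?case using Suc.IH[OF P(3,4)] P by simp
qed

lemma pauli_sign_orthogonal':
  "Q \<in> pauli_strings n \<Longrightarrow> Q' \<in> pauli_strings n \<Longrightarrow>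
    (\<Sum>P\<in>pauli_strings n. pauli_sign P Q * pauli_sign P Q') = (if Q = Q' then 4 ^ n else 0)"
  using pauli_sign_orthogonal[of Q n Q'] by (simp add: pauli_sign_commute)

lemma sum_pauli_sign:
  "P \<in> pauli_strings n \<Longrightarrow> P \<noteq> replicate n Pauli_I \<Longrightarrow> (\<Sum>Q\<in>pauli_strings n. pauli_sign P Q) = 0"
  using pauli_sign_orthogonal[of P n "replicate n Pauli_I"] by simp

text \<open>The identity string has constant sign 1, so its orthogonality relation with itself
  counts the strings.\<close>

lemma card_pauli_strings [simp]: "card (pauli_strings n) = 4 ^ n"
proof -
  have "real (card (pauli_strings n)) = 4 ^ n"
    using pauli_sign_orthogonal[of "replicate n Pauli_I" n "replicate n Pauli_I"] by simp
  then show ?thesis by (metis of_nat_eq_iff of_nat_numeral of_nat_power)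
qed

lemma parseval_pauli_sign:
  "(\<Sum>P\<in>pauli_strings n. (\<Sum>Q\<in>pauli_strings n. pauli_sign P Q * f Q)\<^sup>2) =
    4 ^ n * (\<Sum>Q\<in>pauli_strings n. (f Q)\<^sup>2)"
proof -
  let ?S = "pauli_strings n"
  have "(\<Sum>P\<in>?S. (\<Sum>Q\<in>?S. pauli_sign P Q * f Q)\<^sup>2) =
      (\<Sum>P\<in>?S. \<Sum>Q\<in>?S. \<Sum>Q'\<in>?S. (f Q * f Q') * (pauli_sign P Q * pauli_sign P Q'))"
    by (simp add: power2_eq_square sum_product ac_simps)
  also have "\<dots> = (\<Sum>Q\<in>?S. \<Sum>Q'\<in>?S. (f Q * f Q') * (\<Sum>P\<in>?S. pauli_sign P Q * pauli_sign P Q'))"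
    unfolding sum_distrib_left by (rule sum_swap3[symmetric])
  also have "\<dots> = (\<Sum>Q\<in>?S. \<Sum>Q'\<in>?S. if Q = Q' then 4 ^ n * (f Q)\<^sup>2 else 0)"
    by (intro sum.cong refl) (auto simp: pauli_sign_orthogonal' power2_eq_square)
  also have "\<dots> = 4 ^ n * (\<Sum>Q\<in>?S. (f Q)\<^sup>2)"
    by (simp add: sum_distrib_left)
  finally show ?thesis .
qed

section \<open>Conjugation of Pauli operators and Pauli eigenvalues\<close>

lemma pauli_matrix_conj_sign:
  "pauli_matrix P * pauli_matrix Q * pauli_matrix P = complex_of_real (commutation_sign P Q) \<cdot>\<^sub>m pauli_matrix Q"
  by (cases P; cases Q; intro eq_matI)
    (auto simp: commutation_sign_def mat_of_rows_list_def scalar_prod_def less_Suc_eq numeral_2_eq_2)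

lemma pauli_op_conj_sign:
  "length P = length Q \<Longrightarrow>
    pauli_op P * pauli_op Q * pauli_op P = complex_of_real (pauli_sign P Q) \<cdot>\<^sub>m pauli_op Q"
proof (induction P Q rule: list_induct2)
  case Nil
  show ?case by (intro eq_matI) auto
next
  case (Cons x xs y ys)
  have cx: "pauli_op xs \<in> carrier_mat (2 ^ length ys) (2 ^ length ys)"
    using pauli_op_carrier[of xs] Cons.hyps by simp
  have cxy: "pauli_op xs * pauli_op ys \<in> carrier_mat (2 ^ length ys) (2 ^ length ys)"
    "pauli_matrix x * pauli_matrix y \<in> carrier_mat 2 2"
    using cx by (auto intro!: mult_carrier_mat[where n = 2] pauli_matrix_carrier)
  show ?case
    by (simp add: tensor_mat_mult[OF pauli_matrix_carrier cx pauli_matrix_carrier pauli_op_carrier]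
        tensor_mat_mult[OF cxy(2) cxy(1) pauli_matrix_carrier cx] Cons.IH pauli_matrix_conj_sign
        tensor_mat_smult[OF pauli_matrix_carrier pauli_op_carrier])
qed

lemma pauli_op_carrier' [simp]: "P \<in> pauli_strings n \<Longrightarrow> pauli_op P \<in> carrier_mat (2 ^ n) (2 ^ n)"
  using pauli_op_carrier[of P] by (simp add: pauli_strings_def)

lemma pauli_op_square': "P \<in> pauli_strings n \<Longrightarrow> pauli_op P * pauli_op P = 1\<^sub>m (2 ^ n)"
  using pauli_op_square[of P] by (simp add: pauli_strings_def)

text \<open>Eigenvalues are the sign transform of the error distribution. By orthogonality, adding a
  multiple of one nontrivial character to the uniform distribution moves one eigenvalue only. The
  value is identified by multiplying with \<open>pauli_op P\<close>, whose square is the identity,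
  and comparing a corner entry.\<close>

lemma pauli_eigenvalue_eq:
  assumes P: "P \<in> pauli_strings n"
  shows "pauli_eigenvalue (pauli_channel n p) P = (\<Sum>Q\<in>pauli_strings n. p Q * pauli_sign P Q)"
proof -
  have lP: "length P = n" using P by (simp add: pauli_strings_def)
  let ?l = "pauli_eigenvalue (pauli_channel n p) P" and ?m = "\<Sum>Q\<in>pauli_strings n. p Q * pauli_sign P Q"
  have cP: "pauli_op P \<in> carrier_mat (2 ^ n) (2 ^ n)" using P by simp
  have "pauli_channel n p (pauli_op P) =
      finite_mat_sum (2 ^ n) (\<lambda>Q. complex_of_real (p Q * pauli_sign P Q) \<cdot>\<^sub>m pauli_op P) (pauli_strings n)"
    unfolding pauli_channel_def using lP cP
    by (intro finite_mat_sum_cong) (auto simp: pauli_strings_def pauli_op_conj_sign pauli_sign_commute intro!: eq_matI)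
  also have "\<dots> = complex_of_real ?m \<cdot>\<^sub>m pauli_op P"
    using cP by (intro eq_matI) (auto simp: finite_mat_sum_def sum_distrib_left sum_distrib_right)
  finally have "complex_of_real ?l \<cdot>\<^sub>m pauli_op P = complex_of_real ?m \<cdot>\<^sub>m pauli_op P"
    using pauli_eigenvalue[OF lP, of p] by simp
  then have "(complex_of_real ?l \<cdot>\<^sub>m pauli_op P) * pauli_op P = (complex_of_real ?m \<cdot>\<^sub>m pauli_op P) * pauli_op P"
    by simp
  then have "complex_of_real ?l \<cdot>\<^sub>m 1\<^sub>m (2 ^ n) = complex_of_real ?m \<cdot>\<^sub>m 1\<^sub>m (2 ^ n)"
    using pauli_op_square'[OF P] mult_smult_assoc_mat[OF cP cP] by simp
  then have "(complex_of_real ?l \<cdot>\<^sub>m 1\<^sub>m (2 ^ n)) $$ (0, 0) = (complex_of_real ?m \<cdot>\<^sub>m 1\<^sub>m (2 ^ n)) $$ (0, 0)"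
    by simp
  then have "complex_of_real ?l = complex_of_real ?m" by simp
  then show ?thesis by (simp only: of_real_eq_iff)
qed

lemma mat_adjoint_tensor:
  assumes A: "A \<in> carrier_mat a a" and B: "B \<in> carrier_mat b b"
  shows "mat_adjoint (tensor_mat A B) = tensor_mat (mat_adjoint A) (mat_adjoint B)"
proof (rule eq_matI)
  fix r c assume "r < dim_row (tensor_mat (mat_adjoint A) (mat_adjoint B))"
    "c < dim_col (tensor_mat (mat_adjoint A) (mat_adjoint B))"
  then have r: "r < a * b" and c: "c < a * b" using assms by (auto simp: tensor_mat_def)
  have "0 < b" using r by (cases b) auto
  then have "r div b < a" "c div b < a" "r mod b < b" "c mod b < b"
    using r c by (auto simp: less_mult_imp_div_less)
  then show "mat_adjoint (tensor_mat A B) $$ (r, c) = tensor_mat (mat_adjoint A) (mat_adjoint B) $$ (r, c)"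
    using assms r c by (auto simp: mat_adjoint_index tensor_mat_def)
qed (use assms in \<open>auto simp: tensor_mat_def\<close>)

lemma mat_adjoint_one [simp]: "mat_adjoint (1\<^sub>m d :: complex mat) = 1\<^sub>m d"
  by (rule eq_matI) (auto simp: mat_adjoint_index)

lemma mat_adjoint_pauli_matrix: "mat_adjoint (pauli_matrix P) = pauli_matrix P"
  by (cases P; intro eq_matI)
    (auto simp: mat_adjoint_index mat_of_rows_list_def less_Suc_eq numeral_2_eq_2)

lemma mat_adjoint_pauli_op: "mat_adjoint (pauli_op P) = pauli_op P"
  by (induction P) (auto simp: mat_adjoint_pauli_matrix mat_adjoint_tensor[OF pauli_matrix_carrier pauli_op_carrier])

section \<open>Tensor products\<close>

lemma mult_add_less:
  fixes i k a b :: nat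
  assumes "i < a" "k < b"
  shows "i * b + k < a * b"
proof -
  have "i * b + k < Suc i * b" using assms by simp
  also have "\<dots> \<le> a * b" using assms by (intro mult_right_mono) auto
  finally show ?thesis .
qed

lemma div_mod_less_mult:
  fixes r a b :: nat
  assumes "r < a * b"
  shows "r div b < a" "r mod b < b" "0 < b"
proof -
  show "0 < b" using assms by (cases b) auto
  then show "r div b < a" "r mod b < b" using assms by (auto simp: less_mult_imp_div_less)
qed

lemma sum_mult_index: "(\<Sum>r<a * b. f r) = (\<Sum>i<a. \<Sum>k<b. f (i * b + k :: nat))"
proof -
  have "(\<Sum>r<a * b. f r) = (\<Sum>(i, k)\<in>{..<a} \<times> {..<b}. f (i * b + k))"
    by (rule sum.reindex_bij_witness[where i = "\<lambda>(i, k). i * b + k" and j = "\<lambda>r. (r div b, r mod b)"])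
      (auto simp: div_mod_less_mult intro: mult_add_less)
  then show ?thesis by (simp add: sum.cartesian_product)
qed

lemma tensor_mat_index:
  assumes "A \<in> carrier_mat a a" "B \<in> carrier_mat b b" "i < a" "j < a" "k < b" "l < b"
  shows "tensor_mat A B $$ (i * b + k, j * b + l) = A $$ (i, j) * B $$ (k, l)"
  using assms by (simp add: tensor_mat_def mult_add_less)

lemma tensor_mat_index':
  assumes "A \<in> carrier_mat a a" "B \<in> carrier_mat b b" "r < a * b" "c < a * b"
  shows "tensor_mat A B $$ (r, c) = A $$ (r div b, c div b) * B $$ (r mod b, c mod b)"
  using assms by (simp add: tensor_mat_def)

lemma mat_trace_tensor:
  assumes "A \<in> carrier_mat a a" "B \<in> carrier_mat b b"
  shows "mat_trace (tensor_mat A B) = mat_trace A * mat_trace B"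
proof -
  have "mat_trace (tensor_mat A B) = (\<Sum>i<a. \<Sum>k<b. A $$ (i, i) * B $$ (k, k))"
    using assms unfolding mat_trace_def
    by (simp add: sum_mult_index[symmetric] tensor_mat_def) 
      (simp add: sum_mult_index mult_add_less)
  then show ?thesis using assms by (simp add: mat_trace_def sum_product)
qed

lemma tensor_mat_minus_left:
  assumes "A \<in> carrier_mat a a" "A' \<in> carrier_mat a a" "B \<in> carrier_mat b b"
  shows "tensor_mat (A - A') B = tensor_mat A B - tensor_mat A' B"
  by (rule eq_matI) (use assms in \<open>auto simp: tensor_mat_def div_mod_less_mult left_diff_distrib\<close>)

lemma tensor_mat_minus_right:
  assumes "A \<in> carrier_mat a a" "B \<in> carrier_mat b b" "B' \<in> carrier_mat b b"
  shows "tensor_mat A (B - B') = tensor_mat A B - tensor_mat A B'"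
  by (rule eq_matI) (use assms in \<open>auto simp: tensor_mat_def div_mod_less_mult right_diff_distrib\<close>)

text \<open>Conjugation by a Pauli string with an enlarged ancilla fixes every operator of the form
  identity tensor rest. Reassociation brings (1 \<otimes> s) \<otimes> V into that form.\<close>

lemma tensor_mat_assoc:
  assumes "A \<in> carrier_mat a a" "B \<in> carrier_mat b b" "C \<in> carrier_mat c c"
  shows "tensor_mat (tensor_mat A B) C = tensor_mat A (tensor_mat B C)"
proof (rule eq_matI)
  fix r s assume "r < dim_row (tensor_mat A (tensor_mat B C))" "s < dim_col (tensor_mat A (tensor_mat B C))"
  then have rs: "r < a * b * c" "s < a * b * c" using assms by (auto simp: tensor_mat_def mult.assoc)
  then have rs': "r < a * (b * c)" "s < a * (b * c)" by (auto simp: mult.assoc)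
  note d = div_mod_less_mult[OF rs(1)] div_mod_less_mult[OF rs(2)] div_mod_less_mult[OF rs'(1)] div_mod_less_mult[OF rs'(2)]
  have *: "x div (b * c) = x div c div b" "x mod (b * c) div c = x div c mod b" "x mod (b * c) mod c = x mod c" for x
  proof -
    show "x div (b * c) = x div c div b" by (metis div_mult2_eq mult.commute)
    have e: "x mod (b * c) = c * (x div c mod b) + x mod c" by (metis mod_mult2_eq mult.commute)
    show "x mod (b * c) div c = x div c mod b" "x mod (b * c) mod c = x mod c"
      unfolding e using d(3) by auto
  qed
  show "tensor_mat (tensor_mat A B) C $$ (r, s) = tensor_mat A (tensor_mat B C) $$ (r, s)"
    using assms rs rs' d * by (simp add: tensor_mat_def)
qed (use assms in \<open>auto simp: tensor_mat_def\<close>)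

lemma psd_tensor:
  assumes A: "psd a A" and B: "psd b B"
  shows "psd (a * b) (tensor_mat A B)"
proof -
  obtain u where u: "\<And>i j. i < a \<Longrightarrow> j < a \<Longrightarrow> A $$ (i, j) = (\<Sum>k<a. u k i * cnj (u k j))"
    using psd_gramE[OF A] by blast
  obtain w where w: "\<And>i j. i < b \<Longrightarrow> j < b \<Longrightarrow> B $$ (i, j) = (\<Sum>k<b. w k i * cnj (w k j))"
    using psd_gramE[OF B] by blast
  show ?thesis
  proof (rule psd_gramI[where K = "{..<a} \<times> {..<b}" and u = "\<lambda>(k, l) r. u k (r div b) * w l (r mod b)"])
    fix r c assume rc: "r < a * b" "c < a * b"
    have "tensor_mat A B $$ (r, c) = (\<Sum>k<a. u k (r div b) * cnj (u k (c div b))) * (\<Sum>l<b. w l (r mod b) * cnj (w l (c mod b)))"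
      using rc A B by (simp add: tensor_mat_index'[of A a B b] div_mod_less_mult u w)
    also have "\<dots> = (\<Sum>k<a. \<Sum>l<b. (u k (r div b) * w l (r mod b)) * cnj (u k (c div b) * w l (c mod b)))"
      by (simp add: sum_product ac_simps)
    also have "\<dots> = (\<Sum>x\<in>{..<a} \<times> {..<b}. (case x of (k, l) \<Rightarrow> \<lambda>r. u k (r div b) * w l (r mod b)) r *
        cnj ((case x of (k, l) \<Rightarrow> \<lambda>r. u k (r div b) * w l (r mod b)) c))"
      unfolding sum.cartesian_product by (intro sum.cong refl) auto
    finally show "tensor_mat A B $$ (r, c) = (\<Sum>x\<in>{..<a} \<times> {..<b}. (case x of (k, l) \<Rightarrow> \<lambda>r. u k (r div b) * w l (r mod b)) r *
        cnj ((case x of (k, l) \<Rightarrow> \<lambda>r. u k (r div b) * w l (r mod b)) c))" .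
  qed (use A B in simp)
qed

text \<open>Partial trace is adjoint to tensoring with the identity: a test \<open>Z\<close> on the
  registers left after measuring \<open>E\<close> becomes a product test on all registers.
  Positivity, trace and domination of post-measurement states are derived through this
  pairing.\<close>

lemma mat_trace_tensor_one_times_partial_trace:
  assumes E: "E \<in> carrier_mat a a" and Z: "Z \<in> carrier_mat b b" and X: "X \<in> carrier_mat (a * b) (a * b)"
  shows "mat_trace (Z * partial_trace_fst a b (tensor_mat E (1\<^sub>m b) * X)) = mat_trace (tensor_mat E Z * X)"
proof -
  have EX: "(tensor_mat E (1\<^sub>m b) * X) $$ (i * b + k, i * b + l) = (\<Sum>j<a. E $$ (i, j) * X $$ (j * b + k, i * b + l))"
    if "i < a" "k < b" "l < b" for i k l
  proof -
    have "(tensor_mat E (1\<^sub>m b) * X) $$ (i * b + k, i * b + l) =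
        (\<Sum>j<a. \<Sum>m<b. tensor_mat E (1\<^sub>m b) $$ (i * b + k, j * b + m) * X $$ (j * b + m, i * b + l))"
      using E X that by (subst times_mat_index[of _ "a * b" "a * b" _ "a * b"]) (auto intro!: mult_add_less simp: sum_mult_index)
    also have "\<dots> = (\<Sum>j<a. \<Sum>m<b. if m = k then E $$ (i, j) * X $$ (j * b + m, i * b + l) else 0)"
      using E that by (intro sum.cong refl) (simp add: tensor_mat_index[of E a])
    also have "\<dots> = (\<Sum>j<a. E $$ (i, j) * X $$ (j * b + k, i * b + l))" using that by simp
    finally show ?thesis .
  qed
  have "mat_trace (Z * partial_trace_fst a b (tensor_mat E (1\<^sub>m b) * X)) =
      (\<Sum>k<b. \<Sum>l<b. \<Sum>i<a. \<Sum>j<a. E $$ (i, j) * Z $$ (k, l) * X $$ (j * b + l, i * b + k))"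
    using Z by (subst mat_trace_times[of _ b])
      (auto simp: partial_trace_fst_def EX sum_distrib_left mult.assoc mult.left_commute simp del: index_mult_mat(1) intro!: sum.cong)
  also have "\<dots> = (\<Sum>i<a. \<Sum>k<b. \<Sum>l<b. \<Sum>j<a. E $$ (i, j) * Z $$ (k, l) * X $$ (j * b + l, i * b + k))"
    by (rule sum_swap3)
  also have "\<dots> = (\<Sum>i<a. \<Sum>k<b. \<Sum>j<a. \<Sum>l<b. E $$ (i, j) * Z $$ (k, l) * X $$ (j * b + l, i * b + k))"
    by (intro sum.cong refl sum.swap)
  also have "\<dots> = mat_trace (tensor_mat E Z * X)"
    using E Z X by (subst mat_trace_times[of _ "a * b"]) (auto simp: sum_mult_index tensor_mat_index[of E a Z b] intro!: sum.cong)
  finally show ?thesis .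
qed

section \<open>Linear maps\<close>

lemma linear_mapD:
  assumes "linear_map d e \<Phi>"
  shows "X \<in> carrier_mat d d \<Longrightarrow> \<Phi> X \<in> carrier_mat e e"
    "X \<in> carrier_mat d d \<Longrightarrow> Y \<in> carrier_mat d d \<Longrightarrow> \<Phi> (X + Y) = \<Phi> X + \<Phi> Y"
    "X \<in> carrier_mat d d \<Longrightarrow> \<Phi> (c \<cdot>\<^sub>m X) = c \<cdot>\<^sub>m \<Phi> X"
  using assms by (auto simp: linear_map_def)

lemma linear_map_zero:
  assumes "linear_map d e \<Phi>"
  shows "\<Phi> (0\<^sub>m d d) = 0\<^sub>m e e"
proof -
  have "\<Phi> (0\<^sub>m d d) = \<Phi> (0 \<cdot>\<^sub>m 0\<^sub>m d d)" by simp
  also have "\<dots> = 0 \<cdot>\<^sub>m \<Phi> (0\<^sub>m d d)" by (rule linear_mapD(3)[OF assms]) simp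
  also have "\<dots> = 0\<^sub>m e e" using linear_mapD(1)[OF assms, of "0\<^sub>m d d"] by (intro eq_matI) auto
  finally show ?thesis .
qed

lemma linear_map_finite_mat_sum:
  assumes L: "linear_map d e \<Phi>" and "finite S" "\<And>x. x \<in> S \<Longrightarrow> F x \<in> carrier_mat d d"
  shows "\<Phi> (finite_mat_sum d F S) = finite_mat_sum e (\<lambda>x. \<Phi> (F x)) S"
  using assms(2,3)
proof (induction S)
  case empty
  then show ?case by (simp add: finite_mat_sum_empty linear_map_zero[OF L])
next
  case (insert x S)
  then show ?case by (simp add: finite_mat_sum_insert linear_mapD[OF L])
qed

lemma tensor_mat_smult_right:
  assumes "A \<in> carrier_mat a a" "B \<in> carrier_mat b b"
  shows "tensor_mat A (c \<cdot>\<^sub>m B) = c \<cdot>\<^sub>m tensor_mat A B"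
proof -
  have "1 \<cdot>\<^sub>m A = A" by (rule eq_matI) auto
  then show ?thesis using tensor_mat_smult[OF assms, of 1 c] by simp
qed

lemma linear_map_tensor_left:
  assumes B: "B \<in> carrier_mat b b"
  shows "linear_map a (a * b) (\<lambda>X. tensor_mat X B)"
  unfolding linear_map_def
proof (intro conjI ballI allI)
  fix X Y :: "complex mat" and c assume X: "X \<in> carrier_mat a a"
  show "tensor_mat X B \<in> carrier_mat (a * b) (a * b)" using X B by simp
  show "tensor_mat (c \<cdot>\<^sub>m X) B = c \<cdot>\<^sub>m tensor_mat X B"
    by (rule eq_matI) (use X B in \<open>auto simp: tensor_mat_def div_mod_less_mult\<close>)
  assume Y: "Y \<in> carrier_mat a a"
  show "tensor_mat (X + Y) B = tensor_mat X B + tensor_mat Y B"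
    by (rule eq_matI) (use X Y B in \<open>auto simp: tensor_mat_def div_mod_less_mult distrib_right\<close>)
qed

lemma linear_map_tensor_right:
  assumes A: "A \<in> carrier_mat a a"
  shows "linear_map b (a * b) (tensor_mat A)"
  unfolding linear_map_def
proof (intro conjI ballI allI)
  fix X Y :: "complex mat" and c assume X: "X \<in> carrier_mat b b"
  show "tensor_mat A X \<in> carrier_mat (a * b) (a * b)" using X A by simp
  show "tensor_mat A (c \<cdot>\<^sub>m X) = c \<cdot>\<^sub>m tensor_mat A X" using A X by (rule tensor_mat_smult_right)
  assume Y: "Y \<in> carrier_mat b b"
  show "tensor_mat A (X + Y) = tensor_mat A X + tensor_mat A Y"
    by (rule eq_matI) (use X Y A in \<open>auto simp: tensor_mat_def div_mod_less_mult distrib_left\<close>)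
qed

lemma map_tensor_id_trivial:
  assumes "linear_map d e \<Phi>" "X \<in> carrier_mat d d"
  shows "map_tensor_id d e 1 \<Phi> X = \<Phi> X"
proof -
  have "mat d d (\<lambda>(i, j). X $$ (i, j)) = X" using assms by (intro eq_matI) auto
  then show ?thesis
    using assms linear_mapD(1)[OF assms] by (intro eq_matI) (auto simp: map_tensor_id_def)
qed

lemma completely_positive_psd:
  assumes "completely_positive d e \<Phi>" "psd d X"
  shows "psd e (\<Phi> X)"
proof -
  have "psd (e * 1) (map_tensor_id d e 1 \<Phi> X)"
    using assms unfolding completely_positive_def by (metis mult.right_neutral)
  then show ?thesis using map_tensor_id_trivial[of d e \<Phi> X] assms by (simp add: completely_positive_def)
qed

section \<open>Conjugation by a Pauli string\<close>

text \<open>In \<open>pauli_conj k P\<close> the second factor, on which nothing happens, has dimension \<open>k\<close>.\<close>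

definition pauli_conj :: "nat \<Rightarrow> pauli list \<Rightarrow> complex mat \<Rightarrow> complex mat" where
  "pauli_conj k P X = tensor_mat (pauli_op P) (1\<^sub>m k) * X * tensor_mat (pauli_op P) (1\<^sub>m k)"

context
  fixes n :: nat and P :: "pauli list"
  assumes P: "P \<in> pauli_strings n"
begin

lemma pauli_ext_carrier: "tensor_mat (pauli_op P) (1\<^sub>m k) \<in> carrier_mat (2 ^ n * k) (2 ^ n * k)"
  using P by (intro tensor_mat_carrier) auto

lemma mat_adjoint_pauli_ext: "mat_adjoint (tensor_mat (pauli_op P) (1\<^sub>m k)) = tensor_mat (pauli_op P) (1\<^sub>m k)"
  using P by (simp add: mat_adjoint_tensor[of _ "2 ^ n" _ k] mat_adjoint_pauli_op)

lemma pauli_conj_carrier [simp]: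
  "X \<in> carrier_mat (2 ^ n * k) (2 ^ n * k) \<Longrightarrow> pauli_conj k P X \<in> carrier_mat (2 ^ n * k) (2 ^ n * k)"
  unfolding pauli_conj_def by (intro mult_carrier_mat[of _ _ "2 ^ n * k"] pauli_ext_carrier)

lemma psd_pauli_conj: "psd (2 ^ n * k) X \<Longrightarrow> psd (2 ^ n * k) (pauli_conj k P X)"
  using psd_congruence[OF _ pauli_ext_carrier[of k], of X] by (simp add: mat_adjoint_pauli_ext pauli_conj_def)

text \<open>Cyclicity of the trace moves the Pauli string from the state to the effect, so a bound
  on the effect serves as well as one on the state.\<close>

lemma mat_trace_times_pauli_conj:
  assumes A: "A \<in> carrier_mat (2 ^ n * k) (2 ^ n * k)" and X: "X \<in> carrier_mat (2 ^ n * k) (2 ^ n * k)"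
  shows "mat_trace (A * pauli_conj k P X) = mat_trace (pauli_conj k P A * X)"
proof -
  let ?d = "2 ^ n * k" and ?U = "tensor_mat (pauli_op P) (1\<^sub>m k)"
  note U = pauli_ext_carrier[of k]
  have "mat_trace (A * (?U * X * ?U)) = mat_trace ((A * (?U * X)) * ?U)"
    using A X U assoc_mult_mat[of A ?d ?d "?U * X" ?d ?U ?d] by simp
  also have "\<dots> = mat_trace (?U * (A * (?U * X)))"
    using A X U by (intro mat_trace_comm[of _ ?d]) auto
  also have "?U * (A * (?U * X)) = ?U * A * (?U * X)"
    using A X U assoc_mult_mat[of ?U ?d ?d A ?d "?U * X" ?d] by simp
  also have "\<dots> = ?U * A * ?U * X"
    using A X U assoc_mult_mat[of "?U * A" ?d ?d ?U ?d X ?d] by simp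
  finally show ?thesis by (simp add: pauli_conj_def)
qed

lemma pauli_conj_one_tensor:
  assumes s: "s \<in> carrier_mat k k"
  shows "pauli_conj k P (tensor_mat (1\<^sub>m (2 ^ n)) s) = tensor_mat (1\<^sub>m (2 ^ n)) s"
proof -
  have c: "pauli_op P \<in> carrier_mat (2 ^ n) (2 ^ n)" using P by simp
  have "pauli_conj k P (tensor_mat (1\<^sub>m (2 ^ n)) s) =
      tensor_mat (pauli_op P * 1\<^sub>m (2 ^ n) * pauli_op P) (1\<^sub>m k * s * 1\<^sub>m k)"
    unfolding pauli_conj_def
    using tensor_mat_mult[OF c one_carrier_mat[of k] one_carrier_mat[of "2 ^ n"] s]
      tensor_mat_mult[of "pauli_op P * 1\<^sub>m (2 ^ n)" "2 ^ n" "1\<^sub>m k * s" k "pauli_op P" "1\<^sub>m k"] c s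
    by simp
  also have "pauli_op P * 1\<^sub>m (2 ^ n) * pauli_op P = 1\<^sub>m (2 ^ n)" using P by (simp add: pauli_op_square'[OF P] right_mult_one_mat[OF c])
  finally show ?thesis using s by simp
qed

lemma pauli_conj_one: "pauli_conj k P (1\<^sub>m (2 ^ n * k)) = 1\<^sub>m (2 ^ n * k)"
  using pauli_conj_one_tensor[OF one_carrier_mat[of k]] by (simp add: tensor_mat_one)

lemma mat_trace_pauli_conj:
  assumes X: "X \<in> carrier_mat (2 ^ n * k) (2 ^ n * k)"
  shows "mat_trace (pauli_conj k P X) = mat_trace X"
  using mat_trace_times_pauli_conj[OF one_carrier_mat X] X pauli_conj_carrier[OF X]
  by (simp add: pauli_conj_one)

lemma pauli_conj_minus:
  assumes "X \<in> carrier_mat (2 ^ n * k) (2 ^ n * k)" "Y \<in> carrier_mat (2 ^ n * k) (2 ^ n * k)"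
  shows "pauli_conj k P (X - Y) = pauli_conj k P X - pauli_conj k P Y"
  using assms pauli_ext_carrier[of k] unfolding pauli_conj_def
  by (simp add: mult_minus_distrib_mat[of _ "2 ^ n * k" "2 ^ n * k"] minus_mult_distrib_mat[of _ "2 ^ n * k" "2 ^ n * k"])

lemma psd_one_tensor_minus_pauli_conj:
  assumes s: "s \<in> carrier_mat k k" and X: "X \<in> carrier_mat (2 ^ n * k) (2 ^ n * k)"
    and le: "psd (2 ^ n * k) (tensor_mat (1\<^sub>m (2 ^ n)) s - X)"
  shows "psd (2 ^ n * k) (tensor_mat (1\<^sub>m (2 ^ n)) s - pauli_conj k P X)"
  using psd_pauli_conj[OF le] pauli_conj_minus[OF tensor_mat_carrier[OF one_carrier_mat s] X] pauli_conj_one_tensor[OF s]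
  by simp

lemma linear_map_pauli_conj: "linear_map (2 ^ n * k) (2 ^ n * k) (pauli_conj k P)"
  unfolding linear_map_def pauli_conj_def using pauli_ext_carrier[of k]
  by (auto simp: mult_add_distrib_mat[of _ "2 ^ n * k" "2 ^ n * k"] add_mult_distrib_mat[of _ "2 ^ n * k" "2 ^ n * k"]
      mult_smult_distrib[of _ "2 ^ n * k" "2 ^ n * k"] mult_smult_assoc_mat[of _ "2 ^ n * k" "2 ^ n * k"])

text \<open>The identity factor fixes the ancilla indices, so conjugation acts separately on each
  block in which they are held constant. This is the form in which \<open>map_tensor_id\<close> is
  defined.\<close>

lemma pauli_conj_index:
  assumes X: "X \<in> carrier_mat (2 ^ n * k) (2 ^ n * k)" and r: "r < 2 ^ n * k" and c: "c < 2 ^ n * k"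
  shows "pauli_conj k P X $$ (r, c) =
    (pauli_op P * mat (2 ^ n) (2 ^ n) (\<lambda>(i, j). X $$ (i * k + r mod k, j * k + c mod k)) * pauli_op P) $$ (r div k, c div k)"
proof -
  let ?d = "2 ^ n" and ?U = "tensor_mat (pauli_op P) (1\<^sub>m k)" and ?M = "pauli_op P"
  let ?B = "mat ?d ?d (\<lambda>(i, j). X $$ (i * k + r mod k, j * k + c mod k))"
  have M: "?M \<in> carrier_mat ?d ?d" using P by simp
  note rk = div_mod_less_mult[OF r] and ck = div_mod_less_mult[OF c]
  have Ul: "?U $$ (r, i * k + m) = (if m = r mod k then ?M $$ (r div k, i) else 0)" if "i < ?d" "m < k" for i m
    using M r that rk by (subst tensor_mat_index'[of _ ?d _ k]) (auto intro: mult_add_less)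
  have Ur: "?U $$ (j * k + m, c) = (if m = c mod k then ?M $$ (j, c div k) else 0)" if "j < ?d" "m < k" for j m
    using M c that ck by (subst tensor_mat_index'[of _ ?d _ k]) (auto intro: mult_add_less)
  have 1: "(?U * X) $$ (r, q) = (\<Sum>i<?d. ?M $$ (r div k, i) * X $$ (i * k + r mod k, q))" if q: "q < ?d * k" for q
  proof -
    have "(?U * X) $$ (r, q) = (\<Sum>i<?d. \<Sum>m<k. ?U $$ (r, i * k + m) * X $$ (i * k + m, q))"
      using times_mat_index[OF pauli_ext_carrier[of k] X r q] by (simp add: sum_mult_index)
    also have "\<dots> = (\<Sum>i<?d. \<Sum>m<k. if m = r mod k then ?M $$ (r div k, i) * X $$ (i * k + m, q) else 0)"
      by (intro sum.cong refl) (auto simp: Ul)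
    finally show ?thesis using rk by simp
  qed
  have UX: "?U * X \<in> carrier_mat (?d * k) (?d * k)"
    using X pauli_ext_carrier[of k] by (rule mult_carrier_mat[rotated])
  have "pauli_conj k P X $$ (r, c) = (\<Sum>j<?d. \<Sum>m<k. (?U * X) $$ (r, j * k + m) * ?U $$ (j * k + m, c))"
    unfolding pauli_conj_def using times_mat_index[OF UX pauli_ext_carrier[of k] r c] by (simp add: sum_mult_index)
  also have "\<dots> = (\<Sum>j<?d. \<Sum>m<k. if m = c mod k then (?U * X) $$ (r, j * k + m) * ?M $$ (j, c div k) else 0)"
    by (intro sum.cong refl) (auto simp: Ur)
  also have "\<dots> = (\<Sum>j<?d. (?U * X) $$ (r, j * k + c mod k) * ?M $$ (j, c div k))" using ck by simp
  also have "\<dots> = (\<Sum>j<?d. (\<Sum>i<?d. ?M $$ (r div k, i) * X $$ (i * k + r mod k, j * k + c mod k)) * ?M $$ (j, c div k))"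
    using ck by (intro sum.cong refl) (auto simp: 1 mult_add_less)
  also have "\<dots> = (?M * ?B * ?M) $$ (r div k, c div k)"
    using M rk ck by (subst times_mat_index[of _ ?d ?d _ ?d])
      (auto simp: times_mat_index[of _ ?d ?d _ ?d] simp del: index_mult_mat(1) intro!: sum.cong mult_carrier_mat[of _ _ ?d])
  finally show ?thesis .
qed

end

lemma map_tensor_id_pauli_channel:
  assumes X: "X \<in> carrier_mat (2 ^ n * k) (2 ^ n * k)"
  shows "map_tensor_id (2 ^ n) (2 ^ n) k (pauli_channel n p) X =
    finite_mat_sum (2 ^ n * k) (\<lambda>P. complex_of_real (p P) \<cdot>\<^sub>m pauli_conj k P X) (pauli_strings n)"
proof (rule eq_matI)
  fix r c assume "r < dim_row (finite_mat_sum (2 ^ n * k) (\<lambda>P. complex_of_real (p P) \<cdot>\<^sub>m pauli_conj k P X) (pauli_strings n))"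
    "c < dim_col (finite_mat_sum (2 ^ n * k) (\<lambda>P. complex_of_real (p P) \<cdot>\<^sub>m pauli_conj k P X) (pauli_strings n))"
  then have rc: "r < 2 ^ n * k" "c < 2 ^ n * k" by (auto simp: finite_mat_sum_def)
  let ?B = "mat (2 ^ n) (2 ^ n) (\<lambda>(i, j). X $$ (i * k + r mod k, j * k + c mod k))"
  note rk = div_mod_less_mult[OF rc(1)] and ck = div_mod_less_mult[OF rc(2)]
  have "map_tensor_id (2 ^ n) (2 ^ n) k (pauli_channel n p) X $$ (r, c) =
      (\<Sum>P\<in>pauli_strings n. (complex_of_real (p P) \<cdot>\<^sub>m (pauli_op P * ?B * pauli_op P)) $$ (r div k, c div k))"
    using rc rk ck by (simp add: map_tensor_id_def pauli_channel_def finite_mat_sum_index)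
  also have "\<dots> = (\<Sum>P\<in>pauli_strings n. (complex_of_real (p P) \<cdot>\<^sub>m pauli_conj k P X) $$ (r, c))"
  proof (intro sum.cong refl)
    fix P assume P: "P \<in> pauli_strings n"
    have "pauli_op P * ?B * pauli_op P \<in> carrier_mat (2 ^ n) (2 ^ n)"
      using P by (intro mult_carrier_mat[of _ _ "2 ^ n"]) auto
    then show "(complex_of_real (p P) \<cdot>\<^sub>m (pauli_op P * ?B * pauli_op P)) $$ (r div k, c div k) =
        (complex_of_real (p P) \<cdot>\<^sub>m pauli_conj k P X) $$ (r, c)"
      using rc rk ck pauli_conj_index[OF P X rc] pauli_conj_carrier[OF P X] by (simp del: index_mult_mat)
  qed
  finally show "map_tensor_id (2 ^ n) (2 ^ n) k (pauli_channel n p) X $$ (r, c) =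
      finite_mat_sum (2 ^ n * k) (\<lambda>P. complex_of_real (p P) \<cdot>\<^sub>m pauli_conj k P X) (pauli_strings n) $$ (r, c)"
    using rc by (simp add: finite_mat_sum_index)
qed (auto simp: map_tensor_id_def finite_mat_sum_def)

section \<open>Effects and test functionals\<close>

definition effect :: "nat \<Rightarrow> complex mat \<Rightarrow> bool" where
  "effect d Z \<longleftrightarrow> psd d Z \<and> psd d (1\<^sub>m d - Z)"

text \<open>The Heisenberg picture of what a protocol does from some point on: the probability of
  acceptance as a function of the unnormalised current state. It is complex valued because linearity
  is over the complex matrices.\<close>

definition test_functional :: "nat \<Rightarrow> (complex mat \<Rightarrow> complex) \<Rightarrow> bool" where
  "test_functional d f \<longleftrightarrow>
     (\<forall>X \<in> carrier_mat d d. \<forall>Y \<in> carrier_mat d d. f (X + Y) = f X + f Y) \<and>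
     (\<forall>c. \<forall>X \<in> carrier_mat d d. f (c \<cdot>\<^sub>m X) = c * f X) \<and>
     (\<forall>X. psd d X \<longrightarrow> Im (f X) = 0 \<and> 0 \<le> Re (f X) \<and> Re (f X) \<le> Re (mat_trace X))"

lemma test_functionalD:
  assumes "test_functional d f"
  shows "X \<in> carrier_mat d d \<Longrightarrow> Y \<in> carrier_mat d d \<Longrightarrow> f (X + Y) = f X + f Y"
    "X \<in> carrier_mat d d \<Longrightarrow> f (c \<cdot>\<^sub>m X) = c * f X"
    "psd d X \<Longrightarrow> Im (f X) = 0" "psd d X \<Longrightarrow> 0 \<le> Re (f X)" "psd d X \<Longrightarrow> Re (f X) \<le> Re (mat_trace X)"
  using assms unfolding test_functional_def by blast+

lemma test_functional_finite_mat_sum: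
  assumes f: "test_functional d f" and "finite S" "\<And>x. x \<in> S \<Longrightarrow> F x \<in> carrier_mat d d"
  shows "f (finite_mat_sum d F S) = (\<Sum>x\<in>S. f (F x))"
  using assms(2,3)
proof (induction S)
  case empty
  have "f (0\<^sub>m d d) = f (0 \<cdot>\<^sub>m 0\<^sub>m d d)" by simp
  also have "\<dots> = 0 * f (0\<^sub>m d d)" by (rule test_functionalD(2)[OF f]) simp
  finally show ?case by (simp add: finite_mat_sum_empty)
next
  case (insert x S)
  then show ?case by (simp add: finite_mat_sum_insert test_functionalD(1)[OF f])
qed

text \<open>The backward step of a protocol: one test per branch, pulled back through that branch
  and summed. The upper bound survives because the branches together preserve the trace.\<close>

lemma test_functional_sum:
  assumes f: "\<And>x. x \<in> I \<Longrightarrow> test_functional e (f x)"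
    and L: "\<And>x. x \<in> I \<Longrightarrow> linear_map d e (\<Phi> x)"
    and p: "\<And>x X. x \<in> I \<Longrightarrow> psd d X \<Longrightarrow> psd e (\<Phi> x X)"
    and tr: "\<And>X. psd d X \<Longrightarrow> (\<Sum>x\<in>I. mat_trace (\<Phi> x X)) = mat_trace X"
  shows "test_functional d (\<lambda>X. \<Sum>x\<in>I. f x (\<Phi> x X))"
  unfolding test_functional_def
proof (intro conjI ballI allI impI)
  fix X Y :: "complex mat" assume XY: "X \<in> carrier_mat d d" "Y \<in> carrier_mat d d"
  have "f x (\<Phi> x (X + Y)) = f x (\<Phi> x X) + f x (\<Phi> x Y)" if "x \<in> I" for x
    using linear_mapD[OF L[OF that]] XY test_functionalD(1)[OF f[OF that]] by simp
  then show "(\<Sum>x\<in>I. f x (\<Phi> x (X + Y))) = (\<Sum>x\<in>I. f x (\<Phi> x X)) + (\<Sum>x\<in>I. f x (\<Phi> x Y))"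
    by (simp add: sum.distrib)
next
  fix c and X :: "complex mat" assume X: "X \<in> carrier_mat d d"
  have "f x (\<Phi> x (c \<cdot>\<^sub>m X)) = c * f x (\<Phi> x X)" if "x \<in> I" for x
    using linear_mapD[OF L[OF that]] X test_functionalD(2)[OF f[OF that]] by simp
  then show "(\<Sum>x\<in>I. f x (\<Phi> x (c \<cdot>\<^sub>m X))) = c * (\<Sum>x\<in>I. f x (\<Phi> x X))" by (simp add: sum_distrib_left)
next
  fix X :: "complex mat" assume X: "psd d X"
  note \<Phi> = p[OF _ X]
  show "Im (\<Sum>x\<in>I. f x (\<Phi> x X)) = 0" using test_functionalD(3)[OF f \<Phi>] by (simp add: Im_sum)
  show "0 \<le> Re (\<Sum>x\<in>I. f x (\<Phi> x X))" using test_functionalD(4)[OF f \<Phi>] by (simp add: Re_sum sum_nonneg)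
  have "Re (\<Sum>x\<in>I. f x (\<Phi> x X)) \<le> (\<Sum>x\<in>I. Re (mat_trace (\<Phi> x X)))"
    unfolding Re_sum using test_functionalD(5)[OF f \<Phi>] by (intro sum_mono)
  also have "\<dots> = Re (mat_trace X)" unfolding tr[OF X, symmetric] Re_sum ..
  finally show "Re (\<Sum>x\<in>I. f x (\<Phi> x X)) \<le> Re (mat_trace X)" .
qed

lemma mat_trace_times_rank_one:
  assumes Z: "Z \<in> carrier_mat d d"
  shows "mat_trace (Z * mat d d (\<lambda>(i, j). v i * cnj (v j))) = quad_form d (\<lambda>i j. Z $$ (i, j)) v"
  using Z by (simp add: mat_trace_times[of _ d] quad_form_def ac_simps)

text \<open>Hermiticity comes from polarisation: a complex matrix whose quadratic form is real is
  Hermitian.\<close>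

lemma psd_if_rank_one_traces:
  assumes Z: "Z \<in> carrier_mat d d"
    and im: "\<And>v. Im (mat_trace (Z * mat d d (\<lambda>(i, j). v i * cnj (v j)))) = 0"
    and re: "\<And>v. 0 \<le> Re (mat_trace (Z * mat d d (\<lambda>(i, j). v i * cnj (v j))))"
  shows "psd d Z"
proof (rule psdI[OF Z])
  note im' = im[unfolded mat_trace_times_rank_one[OF Z]]
  show "0 \<le> Re (quad_form d (\<lambda>i j. Z $$ (i, j)) v)" for v
    using re[of v] unfolding mat_trace_times_rank_one[OF Z] .
  have q: "quad_form d (\<lambda>i j. Z $$ (i, j)) (\<lambda>r. (if r = i then 1 else 0) + (if r = j then z else 0)) =
      (Z $$ (i, i) + Z $$ (i, j) * z) + cnj z * (Z $$ (j, i) + Z $$ (j, j) * z)"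
    if ij: "i < d" "j < d" for i j z
  proof -
    let ?v = "\<lambda>r. (if r = i then 1 else 0) + (if r = j then z else 0)"
    have inner: "(\<Sum>c<d. cnj (?v r) * Z $$ (r, c) * ?v c) = cnj (?v r) * (Z $$ (r, i) + Z $$ (r, j) * z)" for r
    proof -
      have "(\<Sum>c<d. cnj (?v r) * Z $$ (r, c) * ?v c) =
          (\<Sum>c<d. (if c = i then cnj (?v r) * Z $$ (r, i) else 0) + (if c = j then cnj (?v r) * Z $$ (r, j) * z else 0))"
        by (intro sum.cong refl) (auto simp: distrib_left)
      then show ?thesis using ij by (simp add: sum.distrib distrib_left)
    qed
    have "quad_form d (\<lambda>i j. Z $$ (i, j)) ?v =
        (\<Sum>r<d. (if r = i then Z $$ (i, i) + Z $$ (i, j) * z else 0) + (if r = j then cnj z * (Z $$ (j, i) + Z $$ (j, j) * z) else 0))"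
      unfolding quad_form_def inner by (intro sum.cong refl) (auto simp: distrib_right)
    then show ?thesis using ij by (simp add: sum.distrib)
  qed
  \<comment> \<open>A unit vector gives a real diagonal entry. The vectors e_i + z e_j with z = 1
    and z = \<i> then compare the imaginary and the real parts of the off-diagonal pair.\<close>
  have d0: "Im (Z $$ (k, k)) = 0" if "k < d" for k
    using im'[of "\<lambda>r. (if r = k then 1 else 0) + (if r = k then 0 else 0)"] unfolding q[OF that that] by simp
  fix i j assume ij: "i < d" "j < d"
  have 1: "Im (Z $$ (i, j)) + Im (Z $$ (j, i)) = 0"
    using im'[of "\<lambda>r. (if r = i then 1 else 0) + (if r = j then 1 else 0)"] d0[OF ij(1)] d0[OF ij(2)]
    unfolding q[OF ij] by simp
  have 2: "Re (Z $$ (i, j)) - Re (Z $$ (j, i)) = 0"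
    using im'[of "\<lambda>r. (if r = i then 1 else 0) + (if r = j then \<i> else 0)"] d0[OF ij(1)] d0[OF ij(2)]
    unfolding q[OF ij] by simp
  show "Z $$ (i, j) = cnj (Z $$ (j, i))" using 1 2 by (simp add: complex_eq_iff)
qed

text \<open>Values on matrix units determine the representing matrix, and values on rank-one
  matrices place it between 0 and 1. As a matrix a test can be squared, which the Cauchy-Schwarz
  argument requires.\<close>

lemma test_functional_effect:
  assumes f: "test_functional d f"
  shows "\<exists>Z. effect d Z \<and> (\<forall>X \<in> carrier_mat d d. f X = mat_trace (Z * X))"
proof -
  define E where "E = (\<lambda>(i, j). mat d d (\<lambda>(r, c). if r = i \<and> c = j then 1 else 0 :: complex))"
  \<comment> \<open>The indices are swapped because the trace of \<open>Z\<close> times the matrix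
    unit at (i, j) is the entry of \<open>Z\<close> at (j, i).\<close>
  define Z where "Z = mat d d (\<lambda>(i, j). f (E (j, i)))"
  have Ec: "E p \<in> carrier_mat d d" for p by (cases p) (simp add: E_def)
  have Zc: "Z \<in> carrier_mat d d" by (simp add: Z_def)
  have rep: "f X = mat_trace (Z * X)" if X: "X \<in> carrier_mat d d" for X
  proof -
    have "X = finite_mat_sum d (\<lambda>p. X $$ p \<cdot>\<^sub>m E p) ({..<d} \<times> {..<d})"
    proof (rule eq_matI)
      fix r c assume "r < dim_row (finite_mat_sum d (\<lambda>p. X $$ p \<cdot>\<^sub>m E p) ({..<d} \<times> {..<d}))"
        "c < dim_col (finite_mat_sum d (\<lambda>p. X $$ p \<cdot>\<^sub>m E p) ({..<d} \<times> {..<d}))"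
      then have rc: "r < d" "c < d" by (auto simp: finite_mat_sum_def)
      have "finite_mat_sum d (\<lambda>p. X $$ p \<cdot>\<^sub>m E p) ({..<d} \<times> {..<d}) $$ (r, c) =
          (\<Sum>p\<in>{..<d} \<times> {..<d}. if p = (r, c) then X $$ p else 0)"
        using rc unfolding finite_mat_sum_index[OF rc] by (intro sum.cong refl) (auto simp: E_def split: if_splits)
      also have "\<dots> = X $$ (r, c)" using rc by simp
      finally show "X $$ (r, c) = finite_mat_sum d (\<lambda>p. X $$ p \<cdot>\<^sub>m E p) ({..<d} \<times> {..<d}) $$ (r, c)" by simp
    qed (use X in \<open>auto simp: finite_mat_sum_def\<close>)
    then have "f X = f (finite_mat_sum d (\<lambda>p. X $$ p \<cdot>\<^sub>m E p) ({..<d} \<times> {..<d}))" by (rule arg_cong)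
    also have "\<dots> = (\<Sum>p\<in>{..<d} \<times> {..<d}. f (X $$ p \<cdot>\<^sub>m E p))"
      by (rule test_functional_finite_mat_sum[OF f]) (auto intro!: Ec smult_carrier_mat)
    also have "\<dots> = (\<Sum>p\<in>{..<d} \<times> {..<d}. X $$ p * f (E p))"
      by (simp add: test_functionalD(2)[OF f Ec])
    also have "\<dots> = (\<Sum>i<d. \<Sum>j<d. X $$ (i, j) * f (E (i, j)))"
      by (simp add: sum.cartesian_product case_prod_beta')
    also have "\<dots> = mat_trace (Z * X)"
      using X Zc by (simp add: mat_trace_times[of _ d]) (subst sum.swap, simp add: Z_def mult.commute)
    finally show ?thesis .
  qed
  have "psd d Z"
  proof (rule psd_if_rank_one_traces[OF Zc])
    fix v
    let ?V = "mat d d (\<lambda>(i, j). v i * cnj (v j))"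
    have "mat_trace (Z * ?V) = f ?V" using rep[of ?V] by simp
    then show "Im (mat_trace (Z * ?V)) = 0" "0 \<le> Re (mat_trace (Z * ?V))"
      using test_functionalD(3,4)[OF f psd_rank_one[of d v]] by simp_all
  qed
  moreover have "psd d (1\<^sub>m d - Z)"
  proof (rule psd_if_rank_one_traces)
    show "1\<^sub>m d - Z \<in> carrier_mat d d" by (rule minus_carrier_mat[OF Zc])
    fix v
    let ?V = "mat d d (\<lambda>(i, j). v i * cnj (v j))"
    have V: "?V \<in> carrier_mat d d" by simp
    have "(1\<^sub>m d - Z) * ?V = ?V - Z * ?V"
      using minus_mult_distrib_mat[OF one_carrier_mat Zc V] left_mult_one_mat[OF V] by simp
    then have "mat_trace ((1\<^sub>m d - Z) * ?V) = mat_trace ?V - f ?V"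
      using mat_trace_minus[OF V mult_carrier_mat[OF Zc V]] rep[OF V] by simp
    then show "Im (mat_trace ((1\<^sub>m d - Z) * ?V)) = 0" "0 \<le> Re (mat_trace ((1\<^sub>m d - Z) * ?V))"
      using test_functionalD(3,5)[OF f psd_rank_one[of d v]] psd_trace(2)[OF psd_rank_one[of d v]] by simp_all
  qed
  ultimately show ?thesis using rep unfolding effect_def by blast
qed

text \<open>With W = 1 - Z, which commutes with Z, one has Z - Z^2 = Z W = Z W Z + W Z W, a sum of
  two congruences, which shows positivity without a square root. Adding W gives 1 - Z^2.\<close>

lemma effect_square:
  assumes "effect d Z"
  shows "psd d (1\<^sub>m d - Z * Z)"
proof -
  define W where "W = 1\<^sub>m d - Z"
  have Z: "psd d Z" and W: "psd d W" using assms by (auto simp: effect_def W_def)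
  have Zc: "Z \<in> carrier_mat d d" and Wc: "W \<in> carrier_mat d d" using Z W by auto
  define V where "V = Z - Z * Z"
  have Vc: "V \<in> carrier_mat d d" unfolding V_def by (intro minus_carrier_mat mult_carrier_mat[OF Zc Zc])
  have ZW: "Z * W = V"
    unfolding W_def V_def using mult_minus_distrib_mat[OF Zc one_carrier_mat Zc] Zc by simp
  have WZ: "W * Z = V"
    unfolding W_def V_def using minus_mult_distrib_mat[OF one_carrier_mat Zc Zc] Zc by simp
  have "Z + W = 1\<^sub>m d" unfolding W_def using Zc by (intro eq_matI) auto
  then have "Z * W * Z + W * Z * W = V"
    using mult_add_distrib_mat[OF Vc Zc Wc] Vc unfolding ZW WZ by simp
  moreover have "psd d (Z * W * Z + W * Z * W)"
    using psd_congruence[OF W Zc] psd_congruence[OF Z Wc] psd_adjoint[OF Z] psd_adjoint[OF W] by (simp add: psd_add)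
  ultimately have "psd d (W + V)" using W psd_add by metis
  moreover have "W + V = 1\<^sub>m d - Z * Z" unfolding W_def V_def using Zc by (intro eq_matI) auto
  ultimately show ?thesis by simp
qed

lemma psd_trace_mono:
  assumes S: "psd d (S - R)" and X: "psd d X" and c: "S \<in> carrier_mat d d" "R \<in> carrier_mat d d"
  shows "Re (mat_trace (R * X)) \<le> Re (mat_trace (S * X))" 
proof -
  have "(S - R) * X = S * X - R * X" by (rule minus_mult_distrib_mat[OF c psd_carrier[OF X]])
  then have "mat_trace ((S - R) * X) = mat_trace (S * X) - mat_trace (R * X)"
    using c X by (simp add: mat_trace_minus[of _ d])
  then show ?thesis using psd_trace_times(1)[OF S X] by simp
qed

section \<open>The trade-off between tests and Pauli perturbations\<close>

lemma quadratic_nonneg_discriminant: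
  fixes A B C :: real
  assumes nonneg: "\<And>s. 0 \<le> C + 2 * s * B + s\<^sup>2 * A" and A: "0 \<le> A"
  shows "B\<^sup>2 \<le> A * C"
proof (cases "A = 0")
  case True
  have "B = 0"
  proof (rule ccontr)
    assume "B \<noteq> 0"
    \<comment> \<open>This \<open>s\<close> makes C + 2 * s * B equal to -1.\<close>
    then show False using nonneg[of "- (C + 1) / (2 * B)"] True by (simp add: field_simps)
  qed
  then show ?thesis using True by simp
next
  case False
  then have "A > 0" using A by simp
  have "0 \<le> A * (C + 2 * (- B / A) * B + (- B / A)\<^sup>2 * A)"
    using nonneg[of "- B / A"] A by (simp add: mult_nonneg_nonneg)
  also have "\<dots> = A * C - B\<^sup>2" using False by (simp add: field_simps power2_eq_square)
  finally show ?thesis by simp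
qed

text \<open>The discriminant inequality for the nonnegative polynomial that sends \<open>s\<close>
  to the sum of the traces of R i (Y i + s)^2. The family over \<open>I\<close> lets outcomes and
  Pauli strings be treated as one block-diagonal system.\<close>

lemma psd_cauchy_schwarz:
  assumes I: "finite I" and R: "\<And>i. i \<in> I \<Longrightarrow> psd d (R i)"
    and Y: "\<And>i. i \<in> I \<Longrightarrow> Y i \<in> carrier_mat d d" "\<And>i. i \<in> I \<Longrightarrow> mat_adjoint (Y i) = Y i"
  shows "(\<Sum>i\<in>I. Re (mat_trace (Y i * R i)))\<^sup>2 \<le>
    (\<Sum>i\<in>I. Re (mat_trace (R i))) * (\<Sum>i\<in>I. Re (mat_trace (R i * (Y i * Y i))))"
proof (rule quadratic_nonneg_discriminant)
  show "0 \<le> (\<Sum>i\<in>I. Re (mat_trace (R i)))" using R psd_trace by (intro sum_nonneg) auto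
  fix s :: real
  have "0 \<le> Re (mat_trace (R i * (Y i * Y i))) + 2 * s * Re (mat_trace (Y i * R i)) + s\<^sup>2 * Re (mat_trace (R i))"
    if i: "i \<in> I" for i
  proof -
    let ?s = "complex_of_real s"
    define W where "W = Y i + ?s \<cdot>\<^sub>m 1\<^sub>m d"
    note c = psd_carrier[OF R[OF i]] Y(1)[OF i]
    have Wc: "W \<in> carrier_mat d d" using c by (simp add: W_def)
    have "mat_adjoint W = W"
    proof (rule eq_matI)
      fix a b assume "a < dim_row W" "b < dim_col W"
      then have ab: "a < d" "b < d" using Wc by auto
      have "mat_adjoint (Y i) $$ (a, b) = Y i $$ (a, b)" using Y(2)[OF i] by simp
      then have "cnj (Y i $$ (b, a)) = Y i $$ (a, b)" using c ab by (simp add: mat_adjoint_index)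
      then show "mat_adjoint W $$ (a, b) = W $$ (a, b)"
        using c ab Wc by (simp add: mat_adjoint_index) (simp add: W_def)
    qed (use Wc in auto)
    then have "psd d (W * W)" using psd_congruence[OF psd_one Wc] Wc by simp
    then have "0 \<le> Re (mat_trace (R i * (W * W)))" by (rule psd_trace_times(1)[OF R[OF i]])
    also have "R i * (W * W) = R i * (Y i * Y i) + (2 * ?s) \<cdot>\<^sub>m (R i * Y i) + (?s * ?s) \<cdot>\<^sub>m R i"
    proof -
      have "W * W = Y i * Y i + (2 * ?s) \<cdot>\<^sub>m Y i + (?s * ?s) \<cdot>\<^sub>m 1\<^sub>m d"
      proof -
        have "W * W = (Y i + ?s \<cdot>\<^sub>m 1\<^sub>m d) * Y i + (Y i + ?s \<cdot>\<^sub>m 1\<^sub>m d) * (?s \<cdot>\<^sub>m 1\<^sub>m d)"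
          using mult_add_distrib_mat[OF Wc c(2), of "?s \<cdot>\<^sub>m 1\<^sub>m d"] unfolding W_def by simp
        also have "(Y i + ?s \<cdot>\<^sub>m 1\<^sub>m d) * Y i = Y i * Y i + ?s \<cdot>\<^sub>m Y i"
          using add_mult_distrib_mat[OF c(2), of "?s \<cdot>\<^sub>m 1\<^sub>m d" "Y i" d] mult_smult_assoc_mat[of "1\<^sub>m d" d d "Y i" d ?s] c by simp
        also have "(Y i + ?s \<cdot>\<^sub>m 1\<^sub>m d) * (?s \<cdot>\<^sub>m 1\<^sub>m d) = ?s \<cdot>\<^sub>m (Y i + ?s \<cdot>\<^sub>m 1\<^sub>m d)"
          using mult_smult_distrib[of "Y i + ?s \<cdot>\<^sub>m 1\<^sub>m d" d d "1\<^sub>m d" d ?s] c by simp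
        also have "Y i * Y i + ?s \<cdot>\<^sub>m Y i + ?s \<cdot>\<^sub>m (Y i + ?s \<cdot>\<^sub>m 1\<^sub>m d) = Y i * Y i + (2 * ?s) \<cdot>\<^sub>m Y i + (?s * ?s) \<cdot>\<^sub>m 1\<^sub>m d"
          using c by (intro eq_matI) (auto simp: algebra_simps)
        finally show ?thesis .
      qed
      then show ?thesis
        using c mult_smult_distrib[OF c(1,2), of "2 * ?s"] mult_smult_distrib[OF c(1) one_carrier_mat, of "?s * ?s"]
        by (simp add: mult_add_distrib_mat[of _ d d _ d])
    qed
    also have "mat_trace \<dots> = mat_trace (R i * (Y i * Y i)) + 2 * ?s * mat_trace (Y i * R i) + ?s * ?s * mat_trace (R i)"
      using c by (simp add: mat_trace_add[of _ d] mat_trace_smult[of _ d] mat_trace_comm[of "R i" d "Y i"])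
    finally show ?thesis by (simp add: power2_eq_square)
  qed
  then have "0 \<le> (\<Sum>i\<in>I. Re (mat_trace (R i * (Y i * Y i))) + 2 * s * Re (mat_trace (Y i * R i)) + s\<^sup>2 * Re (mat_trace (R i)))"
    by (intro sum_nonneg)
  then show "0 \<le> (\<Sum>i\<in>I. Re (mat_trace (R i * (Y i * Y i)))) + 2 * s * (\<Sum>i\<in>I. Re (mat_trace (Y i * R i))) + s\<^sup>2 * (\<Sum>i\<in>I. Re (mat_trace (R i)))"
    by (simp add: sum.distrib sum_distrib_left)
qed

text \<open>The sum of squares is itself a linear functional of the tests: with \<open>c P\<close> as weights it is
  a sum of values of Hermitian operators \<open>Y\<close>, to which the Cauchy-Schwarz inequality applies. The
  average over \<open>Q\<close> then removes all cross terms of \<open>Y\<^sup>2\<close> by orthogonality of the signs.\<close>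

lemma pauli_test_bound:
  fixes R :: "'o \<Rightarrow> pauli list \<Rightarrow> complex mat" and B t :: real
  assumes O: "finite Out" and B: "0 \<le> B" and t: "0 \<le> t"
    and R: "\<And>x Q. x \<in> Out \<Longrightarrow> Q \<in> pauli_strings n \<Longrightarrow> psd d (R x Q)"
    and S: "\<And>x. x \<in> Out \<Longrightarrow> psd d (S x)"
    and RS: "\<And>x Q. x \<in> Out \<Longrightarrow> Q \<in> pauli_strings n \<Longrightarrow> psd d (S x - R x Q)"
    and trR: "(\<Sum>x\<in>Out. \<Sum>Q\<in>pauli_strings n. Re (mat_trace (R x Q))) \<le> 4 ^ n * t"
    and trS: "(\<Sum>x\<in>Out. Re (mat_trace (S x))) \<le> B * t"
    and Z: "\<And>P x. P \<in> pauli_strings n \<Longrightarrow> x \<in> Out \<Longrightarrow> effect d (Z P x)"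
  shows "(\<Sum>P\<in>pauli_strings n. (1 / 4 ^ n * (\<Sum>Q\<in>pauli_strings n. pauli_sign P Q *
    (\<Sum>x\<in>Out. Re (mat_trace (Z P x * R x Q)))))\<^sup>2) \<le> B * t\<^sup>2"
proof -
  let ?S = "pauli_strings n"
  define c where "c P = 1 / 4 ^ n * (\<Sum>Q\<in>?S. pauli_sign P Q * (\<Sum>x\<in>Out. Re (mat_trace (Z P x * R x Q))))" for P
  define q where "q = (\<Sum>P\<in>?S. (c P)\<^sup>2)"
  let ?z = "\<lambda>P Q. complex_of_real (pauli_sign P Q * c P)"
  define Y where "Y x Q = finite_mat_sum d (\<lambda>P. ?z P Q \<cdot>\<^sub>m Z P x) ?S" for x Q
  have Zc: "Z P x \<in> carrier_mat d d" and Zp: "psd d (Z P x)" if "P \<in> ?S" "x \<in> Out" for P x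
    using Z[OF that] by (auto simp: effect_def)
  have Yc: "Y x Q \<in> carrier_mat d d" for x Q by (simp add: Y_def)
  have Yadj: "mat_adjoint (Y x Q) = Y x Q" if x: "x \<in> Out" for x Q
  proof (rule eq_matI)
    fix i j assume "i < dim_row (Y x Q)" "j < dim_col (Y x Q)"
    then have ij: "i < d" "j < d" using Yc[of x Q] by auto
    have sm: "(k \<cdot>\<^sub>m Z P x) $$ (a, b) = k * Z P x $$ (a, b)" if "P \<in> ?S" "a < d" "b < d" for k P a b
      using Zc[OF that(1) x] that by simp
    have "mat_adjoint (Y x Q) $$ (i, j) = cnj (Y x Q $$ (j, i))"
      using ij Yc[of x Q] by (simp add: mat_adjoint_index)
    also have "\<dots> = (\<Sum>P\<in>?S. ?z P Q * cnj (Z P x $$ (j, i)))"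
      using ij unfolding Y_def by (simp add: finite_mat_sum_index sm del: index_smult_mat)
    also have "\<dots> = (\<Sum>P\<in>?S. ?z P Q * Z P x $$ (i, j))"
      using psd_hermitian[OF Zp[OF _ x] ij] by simp
    also have "\<dots> = Y x Q $$ (i, j)"
      using ij unfolding Y_def by (simp add: finite_mat_sum_index sm del: index_smult_mat)
    finally show "mat_adjoint (Y x Q) $$ (i, j) = Y x Q $$ (i, j)" .
  qed (use Yc[of x Q] in auto)
  have YR: "Re (mat_trace (Y x Q * R x Q)) = (\<Sum>P\<in>?S. pauli_sign P Q * c P * Re (mat_trace (Z P x * R x Q)))"
    if "x \<in> Out" "Q \<in> ?S" for x Q
  proof -
    have "mat_trace (Y x Q * R x Q) =
        (\<Sum>P\<in>?S. mat_trace ((?z P Q \<cdot>\<^sub>m Z P x) * R x Q))"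
      unfolding Y_def using that R Zc by (intro mat_trace_finite_mat_sum_times) auto
    also have "\<dots> = (\<Sum>P\<in>?S. ?z P Q * mat_trace (Z P x * R x Q))"
    proof (intro sum.cong refl)
      fix P assume P: "P \<in> ?S"
      note cs = Zc[OF P that(1)] psd_carrier[OF R[OF that]]
      show "mat_trace ((?z P Q \<cdot>\<^sub>m Z P x) * R x Q) =
          ?z P Q * mat_trace (Z P x * R x Q)"
        using cs by (simp only: mult_smult_assoc_mat[OF cs] mat_trace_smult[OF mult_carrier_mat[OF cs]])
    qed
    finally show ?thesis by (simp add: Re_sum)
  qed
  have "4 ^ n * q = (\<Sum>P\<in>?S. c P * (\<Sum>Q\<in>?S. pauli_sign P Q * (\<Sum>x\<in>Out. Re (mat_trace (Z P x * R x Q)))))"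
  proof -
    have "(\<Sum>Q\<in>?S. pauli_sign P Q * (\<Sum>x\<in>Out. Re (mat_trace (Z P x * R x Q)))) = 4 ^ n * c P" for P
      by (simp add: c_def)
    then show ?thesis by (simp add: q_def power2_eq_square sum_distrib_left ac_simps)
  qed
  also have "\<dots> = (\<Sum>P\<in>?S. \<Sum>Q\<in>?S. \<Sum>x\<in>Out. pauli_sign P Q * c P * Re (mat_trace (Z P x * R x Q)))"
    by (simp add: sum_distrib_left ac_simps)
  also have "\<dots> = (\<Sum>x\<in>Out. \<Sum>P\<in>?S. \<Sum>Q\<in>?S. pauli_sign P Q * c P * Re (mat_trace (Z P x * R x Q)))"
    by (rule sum_swap3)
  also have "\<dots> = (\<Sum>x\<in>Out. \<Sum>Q\<in>?S. Re (mat_trace (Y x Q * R x Q)))"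
    by (rule sum.cong[OF refl], subst sum.swap, rule sum.cong[OF refl]) (simp add: YR)
  also have "\<dots> = (\<Sum>i\<in>Out \<times> ?S. Re (mat_trace (Y (fst i) (snd i) * R (fst i) (snd i))))"
    by (simp add: sum.cartesian_product case_prod_beta')
  finally have q1: "4 ^ n * q = (\<Sum>i\<in>Out \<times> ?S. Re (mat_trace (Y (fst i) (snd i) * R (fst i) (snd i))))" .
  have "(4 ^ n * q)\<^sup>2 \<le> (\<Sum>i\<in>Out \<times> ?S. Re (mat_trace (R (fst i) (snd i)))) *
      (\<Sum>i\<in>Out \<times> ?S. Re (mat_trace (R (fst i) (snd i) * (Y (fst i) (snd i) * Y (fst i) (snd i)))))"
    unfolding q1 by (rule psd_cauchy_schwarz) (use O R Yc Yadj in auto)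
  also have "\<dots> = (\<Sum>x\<in>Out. \<Sum>Q\<in>?S. Re (mat_trace (R x Q))) * (\<Sum>x\<in>Out. \<Sum>Q\<in>?S. Re (mat_trace (R x Q * (Y x Q * Y x Q))))"
    by (simp add: sum.cartesian_product case_prod_beta')
  also have "\<dots> \<le> (4 ^ n * t) * (4 ^ n * q * (B * t))"
  proof (rule mult_mono[OF trR])
    have YY: "psd d (Y x Q * Y x Q)" if "x \<in> Out" for x Q
      using psd_congruence[OF psd_one Yc[of x Q]] Yc[of x Q] by (simp add: Yadj[OF that])
    show "0 \<le> (\<Sum>x\<in>Out. \<Sum>Q\<in>?S. Re (mat_trace (R x Q * (Y x Q * Y x Q))))"
      using psd_trace_times(1)[OF R YY] by (intro sum_nonneg) auto
    \<comment> \<open>Replacing \<open>R x Q\<close> by \<open>S x\<close> frees the state from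
      \<open>Q\<close>. Only then does the sum over \<open>Q\<close> act on the signs in
      \<open>Y x Q\<close> alone and cancel the terms with different \<open>P\<close> and
      \<open>P'\<close>.\<close>
    have "(\<Sum>x\<in>Out. \<Sum>Q\<in>?S. Re (mat_trace (R x Q * (Y x Q * Y x Q)))) \<le> (\<Sum>x\<in>Out. \<Sum>Q\<in>?S. Re (mat_trace (S x * (Y x Q * Y x Q))))"
      using RS R S YY by (intro sum_mono psd_trace_mono[where d = d]) auto
    also have "\<dots> \<le> (\<Sum>x\<in>Out. 4 ^ n * q * Re (mat_trace (S x)))"
    proof (rule sum_mono)
      fix x assume x: "x \<in> Out"
      note Sc = psd_carrier[OF S[OF x]]
      define T where "T P P' = Re (mat_trace (S x * (Z P x * Z P' x)))" for P P'
      have "Re (mat_trace (S x * (Y x Q * Y x Q))) =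
          (\<Sum>P\<in>?S. \<Sum>P'\<in>?S. (c P * c P' * T P P') * (pauli_sign P Q * pauli_sign P' Q))" for Q
      proof -
        let ?k = "\<lambda>P. complex_of_real (pauli_sign P Q * c P)"
        have "mat_trace (S x * (Y x Q * Y x Q)) = mat_trace (S x * finite_mat_sum d (\<lambda>P. (?k P \<cdot>\<^sub>m Z P x) * Y x Q) ?S)"
          unfolding Y_def using x Zc by (subst finite_mat_sum_times) auto
        also have "\<dots> = (\<Sum>P\<in>?S. mat_trace (S x * ((?k P \<cdot>\<^sub>m Z P x) * Y x Q)))"
          using Sc x Zc Yc by (intro mat_trace_times_finite_mat_sum) (auto intro!: mult_carrier_mat[where n = d])
        also have "\<dots> = (\<Sum>P\<in>?S. \<Sum>P'\<in>?S. ?k P * ?k P' * mat_trace (S x * (Z P x * Z P' x)))"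
        proof (intro sum.cong refl)
          fix P assume P: "P \<in> ?S"
          note ZP = Zc[OF P x]
          have "S x * ((?k P \<cdot>\<^sub>m Z P x) * Y x Q) = ?k P \<cdot>\<^sub>m (S x * Z P x * Y x Q)"
            using Sc ZP Yc[of x Q] by (simp add: mult_smult_assoc_mat[of _ d d _ d] mult_smult_distrib[of _ d d _ d])
          then have "mat_trace (S x * ((?k P \<cdot>\<^sub>m Z P x) * Y x Q)) = ?k P * mat_trace (S x * Z P x * Y x Q)"
            using Sc ZP Yc[of x Q] by (metis mat_trace_smult mult_carrier_mat)
          also have "mat_trace (S x * Z P x * Y x Q) = (\<Sum>P'\<in>?S. mat_trace (S x * Z P x * (?k P' \<cdot>\<^sub>m Z P' x)))"
            unfolding Y_def using Sc ZP Zc x by (intro mat_trace_times_finite_mat_sum) (auto intro!: mult_carrier_mat[where n = d])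
          also have "\<dots> = (\<Sum>P'\<in>?S. ?k P' * mat_trace (S x * (Z P x * Z P' x)))"
          proof (intro sum.cong refl)
            fix P' assume P': "P' \<in> ?S"
            have "S x * Z P x * (?k P' \<cdot>\<^sub>m Z P' x) = ?k P' \<cdot>\<^sub>m (S x * (Z P x * Z P' x))"
              using Sc ZP Zc[OF P' x] by (simp add: mult_smult_distrib[of _ d d _ d])
            then show "mat_trace (S x * Z P x * (?k P' \<cdot>\<^sub>m Z P' x)) = ?k P' * mat_trace (S x * (Z P x * Z P' x))"
              using Sc ZP Zc[OF P' x] by (metis mat_trace_smult mult_carrier_mat)
          qed
          finally show "mat_trace (S x * ((?k P \<cdot>\<^sub>m Z P x) * Y x Q)) =
              (\<Sum>P'\<in>?S. ?k P * ?k P' * mat_trace (S x * (Z P x * Z P' x)))"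
            by (simp only: sum_distrib_left mult.assoc)
        qed
        also have "Re \<dots> = (\<Sum>P\<in>?S. \<Sum>P'\<in>?S. (c P * c P' * T P P') * (pauli_sign P Q * pauli_sign P' Q))"
          unfolding Re_sum T_def by (intro sum.cong refl) (simp flip: of_real_mult)
        finally show ?thesis .
      qed
      then have "(\<Sum>Q\<in>?S. Re (mat_trace (S x * (Y x Q * Y x Q)))) =
          (\<Sum>Q\<in>?S. \<Sum>P\<in>?S. \<Sum>P'\<in>?S. (c P * c P' * T P P') * (pauli_sign P Q * pauli_sign P' Q))"
        by simp
      also have "\<dots> = (\<Sum>P\<in>?S. \<Sum>P'\<in>?S. (c P * c P' * T P P') * (\<Sum>Q\<in>?S. pauli_sign P Q * pauli_sign P' Q))"
        unfolding sum_distrib_left by (rule sum_swap3[symmetric])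
      also have "\<dots> = (\<Sum>P\<in>?S. \<Sum>P'\<in>?S. if P = P' then 4 ^ n * (c P)\<^sup>2 * T P P else 0)"
        by (intro sum.cong refl) (auto simp: pauli_sign_orthogonal power2_eq_square)
      also have "\<dots> = (\<Sum>P\<in>?S. 4 ^ n * (c P)\<^sup>2 * T P P)" by simp
      also have "\<dots> \<le> (\<Sum>P\<in>?S. 4 ^ n * (c P)\<^sup>2 * Re (mat_trace (S x)))"
      proof (intro sum_mono mult_left_mono)
        fix P assume P: "P \<in> ?S"
        note ZP = Zc[OF P x]
        have "S x * (1\<^sub>m d - Z P x * Z P x) = S x - S x * (Z P x * Z P x)"
          using mult_minus_distrib_mat[OF Sc one_carrier_mat mult_carrier_mat[OF ZP ZP]] Sc by simp
        then have "mat_trace (S x * (1\<^sub>m d - Z P x * Z P x)) = mat_trace (S x) - mat_trace (S x * (Z P x * Z P x))"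
          using Sc ZP by (metis mat_trace_minus mult_carrier_mat)
        then show "T P P \<le> Re (mat_trace (S x))"
          using psd_trace_times(1)[OF S[OF x] effect_square[OF Z[OF P x]]] by (simp add: T_def)
      qed simp
      also have "\<dots> = 4 ^ n * q * Re (mat_trace (S x))"
        by (simp add: q_def sum_distrib_left sum_distrib_right)
      finally show "(\<Sum>Q\<in>?S. Re (mat_trace (S x * (Y x Q * Y x Q)))) \<le> 4 ^ n * q * Re (mat_trace (S x))" .
    qed
    also have "\<dots> = 4 ^ n * q * (\<Sum>x\<in>Out. Re (mat_trace (S x)))" by (simp add: sum_distrib_left)
    also have "\<dots> \<le> 4 ^ n * q * (B * t)"
      using trS by (intro mult_left_mono) (auto simp: q_def sum_nonneg)
    finally show "(\<Sum>x\<in>Out. \<Sum>Q\<in>?S. Re (mat_trace (R x Q * (Y x Q * Y x Q)))) \<le> 4 ^ n * q * (B * t)" .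
  qed (use t in simp)
  \<comment> \<open>The weights \<open>c P\<close> in \<open>Y\<close> are the responses themselves,
    so \<open>q\<close> occurs on both sides and one power of it cancels.\<close>
  finally have "(4 ^ n)\<^sup>2 * q\<^sup>2 \<le> (4 ^ n)\<^sup>2 * (B * t\<^sup>2 * q)"
    by (simp add: power2_eq_square ac_simps)
  then have "q * q \<le> (B * t\<^sup>2) * q" by (simp add: power2_eq_square)
  moreover have "0 \<le> q" by (simp add: q_def sum_nonneg)
  ultimately have "q \<le> B * t\<^sup>2"
  proof (cases "q = 0")
    case False
    with \<open>0 \<le> q\<close> \<open>q * q \<le> (B * t\<^sup>2) * q\<close> show ?thesis by (simp add: mult_le_cancel_right)
  qed (use B in simp)
  then show ?thesis by (simp add: q_def c_def)
qed

lemma four_power: "(4 :: real) ^ n = (2 ^ n)\<^sup>2"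
  by (simp add: power2_eq_square flip: power_mult_distrib)

section \<open>Outcome records\<close>

lemma histories_0 [simp]: "histories Out 0 = {[]}"
  by (auto simp: histories_def)

lemma length_histories: "h \<in> histories Out l \<Longrightarrow> length h = l"
  by (simp add: histories_def)

lemma histories_append: "h \<in> histories Out l \<Longrightarrow> x \<in> Out h \<Longrightarrow> h @ [x] \<in> histories Out (Suc l)"
  by (auto simp: histories_def nth_append less_Suc_eq)

lemma take_histories: "h \<in> histories Out N \<Longrightarrow> l \<le> N \<Longrightarrow> take l h \<in> histories Out l"
  by (auto simp: histories_def min_def)

lemma nth_histories: "h \<in> histories Out N \<Longrightarrow> l < N \<Longrightarrow> h ! l \<in> Out (take l h)"
  by (simp add: histories_def)

lemma histories_Suc: "histories Out (Suc l) = (\<lambda>(h, x). h @ [x]) ` (SIGMA h:histories Out l. Out h)"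
proof
  show "histories Out (Suc l) \<subseteq> (\<lambda>(h, x). h @ [x]) ` (SIGMA h:histories Out l. Out h)"
  proof
    fix h assume h: "h \<in> histories Out (Suc l)"
    have "h = take l h @ [h ! l]"
      using length_histories[OF h] take_Suc_conv_app_nth[of l h] by simp
    moreover have "(take l h, h ! l) \<in> (SIGMA h:histories Out l. Out h)"
      using take_histories[OF h, of l] nth_histories[OF h, of l] by simp
    ultimately show "h \<in> (\<lambda>(h, x). h @ [x]) ` (SIGMA h:histories Out l. Out h)"
      by (metis (no_types, lifting) case_prod_conv image_eqI)
  qed
qed (auto intro: histories_append)

lemma finite_histories:
  "(\<And>k h. k < l \<Longrightarrow> h \<in> histories Out k \<Longrightarrow> finite (Out h)) \<Longrightarrow> finite (histories Out l)"
proof (induction l)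
  case (Suc l)
  have "finite (histories Out l)" by (rule Suc.IH, rule Suc.prems) auto
  with Suc.prems show ?case unfolding histories_Suc by (intro finite_imageI finite_SigmaI) auto
qed simp

lemma sum_histories_Suc:
  assumes "\<And>k h. k < Suc l \<Longrightarrow> h \<in> histories Out k \<Longrightarrow> finite (Out h)"
  shows "(\<Sum>h\<in>histories Out (Suc l). F h) = (\<Sum>h\<in>histories Out l. \<Sum>x\<in>Out h. F (h @ [x]))"
proof -
  have "(\<Sum>h\<in>histories Out (Suc l). F h) = (\<Sum>z\<in>(SIGMA h:histories Out l. Out h). F (fst z @ [snd z]))"
    unfolding histories_Suc by (subst sum.reindex) (auto simp: inj_on_def case_prod_beta')
  moreover have "finite (histories Out l)" by (rule finite_histories, rule assms) auto
  ultimately show ?thesis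
    using assms by (subst sum.Sigma) (auto simp: case_prod_beta')
qed

section \<open>Perturbations of the completely depolarising channel\<close>

definition perturbed :: "nat \<Rightarrow> real \<Rightarrow> pauli list \<Rightarrow> pauli list \<Rightarrow> real" where
  "perturbed n \<theta> P Q = (1 + \<theta> * pauli_sign P Q) / 4 ^ n"

definition uniform :: "nat \<Rightarrow> pauli list \<Rightarrow> real" where
  "uniform n Q = 1 / 4 ^ n"

lemma uniform_distribution: "pauli_distribution n (uniform n)"
  by (simp add: pauli_distribution_def uniform_def)

lemma perturbed_distribution:
  assumes "P \<in> pauli_strings n" "P \<noteq> replicate n Pauli_I" "\<bar>\<theta>\<bar> \<le> 1"
  shows "pauli_distribution n (perturbed n \<theta> P)"
proof -
  have "0 \<le> 1 + \<theta> * pauli_sign P Q" for Q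
    using assms(3) pauli_sign_cases[of P Q] by auto
  moreover have "(\<Sum>Q\<in>pauli_strings n. perturbed n \<theta> P Q) = 1"
    unfolding perturbed_def sum_divide_distrib[symmetric] sum.distrib sum_distrib_left[symmetric]
    using sum_pauli_sign[OF assms(1,2)] by simp
  ultimately show ?thesis by (simp add: pauli_distribution_def perturbed_def)
qed

lemma perturbed_eigenvalue:
  assumes "P \<in> pauli_strings n" "P \<noteq> replicate n Pauli_I"
  shows "pauli_eigenvalue (pauli_channel n (perturbed n \<theta> P)) P = \<theta>"
proof -
  have "(\<Sum>Q\<in>pauli_strings n. perturbed n \<theta> P Q * pauli_sign P Q) =
      (\<Sum>Q\<in>pauli_strings n. (pauli_sign P Q + \<theta>) / 4 ^ n)"
    by (intro sum.cong refl) (simp add: perturbed_def distrib_right mult.assoc)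
  also have "\<dots> = \<theta>"
    unfolding sum_divide_distrib[symmetric] sum.distrib using sum_pauli_sign[OF assms] by simp
  finally show ?thesis using assms by (simp add: pauli_eigenvalue_eq)
qed

lemma uniform_eigenvalue:
  assumes "P \<in> pauli_strings n" "P \<noteq> replicate n Pauli_I"
  shows "pauli_eigenvalue (pauli_channel n (uniform n)) P = 0"
  using assms sum_pauli_sign[OF assms] by (simp add: pauli_eigenvalue_eq uniform_def sum_divide_distrib[symmetric])

text \<open>A learner tells the perturbed channel from the depolarising one by thresholding its estimate,
  because \<open>9 / 4 * \<epsilon>\<close> exceeds twice the accuracy.\<close>

lemma learning_distinguishes:
  assumes learn: "solves_learning n \<epsilon> N rp \<pi>" and \<epsilon>: "0 < \<epsilon>" "\<epsilon> \<le> 1 / 3"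
    and P: "P \<in> pauli_strings n" "P \<noteq> replicate n Pauli_I"
    and fin: "finite (histories (outcomes \<pi>) N)"
    and nonneg: "\<And>p h. pauli_distribution n p \<Longrightarrow> h \<in> histories (outcomes \<pi>) N \<Longrightarrow> 0 \<le> rp \<pi> (pauli_channel n p) h"
    and total: "\<And>p. pauli_distribution n p \<Longrightarrow> (\<Sum>h\<in>histories (outcomes \<pi>) N. rp \<pi> (pauli_channel n p) h) = 1"
  defines "A \<equiv> {h \<in> histories (outcomes \<pi>) N. \<bar>estimate \<pi> h P\<bar> \<le> \<epsilon>}"
  shows "2 / 3 \<le> (\<Sum>h\<in>A. rp \<pi> (pauli_channel n (uniform n)) h)"
    and "(\<Sum>h\<in>A. rp \<pi> (pauli_channel n (perturbed n (9 / 4 * \<epsilon>) P)) h) \<le> 1 / 3"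
proof -
  let ?Ps = "pauli_strings n"
  let ?H = "histories (outcomes \<pi>) N"
  define G where "G p = {h \<in> ?H. Max ((\<lambda>P. \<bar>estimate \<pi> h P - pauli_eigenvalue (pauli_channel n p) P\<bar>) ` ?Ps) \<le> \<epsilon>}" for p
  have G: "2 / 3 \<le> (\<Sum>h\<in>G p. rp \<pi> (pauli_channel n p) h)" if "pauli_distribution n p" for p
    using learn that unfolding solves_learning_def Let_def G_def by blast
  have GP: "\<bar>estimate \<pi> h P - pauli_eigenvalue (pauli_channel n p) P\<bar> \<le> \<epsilon>" if h: "h \<in> G p" for h p
  proof -
    have "\<bar>estimate \<pi> h P - pauli_eigenvalue (pauli_channel n p) P\<bar> \<le>
        Max ((\<lambda>P. \<bar>estimate \<pi> h P - pauli_eigenvalue (pauli_channel n p) P\<bar>) ` ?Ps)"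
      using P by (intro Max_ge) auto
    with h show ?thesis by (simp add: G_def)
  qed
  have GH: "G p \<subseteq> ?H" for p by (auto simp: G_def)
  have AH: "A \<subseteq> ?H" by (auto simp: A_def)
  let ?u = "uniform n" and ?p = "perturbed n (9 / 4 * \<epsilon>) P"
  have pd: "pauli_distribution n ?p" using \<epsilon> by (intro perturbed_distribution P) auto
  have "G ?u \<subseteq> A" using GP[of _ ?u] GH by (auto simp: A_def uniform_eigenvalue[OF P])
  then have "(\<Sum>h\<in>G ?u. rp \<pi> (pauli_channel n ?u) h) \<le> (\<Sum>h\<in>A. rp \<pi> (pauli_channel n ?u) h)"
    using AH fin by (intro sum_mono2) (auto intro: finite_subset nonneg uniform_distribution)
  then show "2 / 3 \<le> (\<Sum>h\<in>A. rp \<pi> (pauli_channel n ?u) h)"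
    using G[OF uniform_distribution] by simp
  have "A \<inter> G ?p = {}"
  proof (rule ccontr)
    assume "A \<inter> G ?p \<noteq> {}"
    then obtain h where "h \<in> A" "h \<in> G ?p" by blast
    then show False using GP[of h ?p] \<epsilon> unfolding perturbed_eigenvalue[OF P] A_def by auto
  qed
  then have "(\<Sum>h\<in>A. rp \<pi> (pauli_channel n ?p) h) + (\<Sum>h\<in>G ?p. rp \<pi> (pauli_channel n ?p) h) =
      (\<Sum>h\<in>A \<union> G ?p. rp \<pi> (pauli_channel n ?p) h)"
    using AH GH fin by (subst sum.union_disjoint) (auto intro: finite_subset[OF GH fin] finite_subset[OF AH fin])
  also have "\<dots> \<le> (\<Sum>h\<in>?H. rp \<pi> (pauli_channel n ?p) h)"
    by (intro sum_mono2) (use AH GH fin nonneg[OF pd] in auto)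
  finally show "(\<Sum>h\<in>A. rp \<pi> (pauli_channel n ?p) h) \<le> 1 / 3"
    using G[OF pd] total[OF pd] by simp
qed

section \<open>Adaptive processes and the hybrid argument\<close>

text \<open>\<open>T Q h x\<close> is one round after the record \<open>h\<close> with outcome \<open>x\<close>, in which the unknown channel
  acts as conjugation by the Pauli string \<open>Q\<close>.\<close>

locale pauli_process =
  fixes n N :: nat and Out :: "nat list \<Rightarrow> nat set" and D :: "nat \<Rightarrow> nat"
    and T :: "pauli list \<Rightarrow> nat list \<Rightarrow> nat \<Rightarrow> complex mat \<Rightarrow> complex mat" and X0 :: "complex mat"
  assumes finite_Out: "\<And>l h. l < N \<Longrightarrow> h \<in> histories Out l \<Longrightarrow> finite (Out h)"
    and linear_T: "\<And>l h x Q. l < N \<Longrightarrow> h \<in> histories Out l \<Longrightarrow> x \<in> Out h \<Longrightarrow> Q \<in> pauli_strings n \<Longrightarrow>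
      linear_map (D l) (D (Suc l)) (T Q h x)"
    and psd_T: "\<And>l h x Q X. l < N \<Longrightarrow> h \<in> histories Out l \<Longrightarrow> x \<in> Out h \<Longrightarrow> Q \<in> pauli_strings n \<Longrightarrow>
      psd (D l) X \<Longrightarrow> psd (D (Suc l)) (T Q h x X)"
    and trace_T: "\<And>l h Q X. l < N \<Longrightarrow> h \<in> histories Out l \<Longrightarrow> Q \<in> pauli_strings n \<Longrightarrow>
      psd (D l) X \<Longrightarrow> (\<Sum>x\<in>Out h. mat_trace (T Q h x X)) = mat_trace X"
    and X0: "density_operator (D 0) X0"
begin

text \<open>\<open>length h\<close> recovers the number of the round, which fixes the output
  dimension.\<close>

definition step :: "(pauli list \<Rightarrow> real) \<Rightarrow> nat list \<Rightarrow> nat \<Rightarrow> complex mat \<Rightarrow> complex mat" where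
  "step p h x X = finite_mat_sum (D (Suc (length h))) (\<lambda>Q. complex_of_real (p Q) \<cdot>\<^sub>m T Q h x X) (pauli_strings n)"

fun state :: "(pauli list \<Rightarrow> real) \<Rightarrow> nat list \<Rightarrow> nat \<Rightarrow> complex mat" where
  "state p h 0 = X0"
| "state p h (Suc l) = step p (take l h) (h ! l) (state p h l)"

text \<open>\<open>accept p A r h X\<close> is the probability that the record ends in \<open>A\<close>, given the state \<open>X\<close> after
  the record \<open>h\<close> with \<open>r\<close> rounds left.\<close>

fun accept :: "(pauli list \<Rightarrow> real) \<Rightarrow> nat list set \<Rightarrow> nat \<Rightarrow> nat list \<Rightarrow> complex mat \<Rightarrow> complex" where
  "accept p A 0 h X = (if h \<in> A then mat_trace X else 0)"
| "accept p A (Suc r) h X = (\<Sum>x\<in>Out h. accept p A r (h @ [x]) (step p h x X))"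

lemma finite_histories_Out: "l \<le> N \<Longrightarrow> finite (histories Out l)"
  by (rule finite_histories, rule finite_Out) auto

lemma sum_histories:
  "l < N \<Longrightarrow> (\<Sum>h\<in>histories Out (Suc l). F h) = (\<Sum>h\<in>histories Out l. \<Sum>x\<in>Out h. F (h @ [x]))"
  by (rule sum_histories_Suc, rule finite_Out) auto

lemma linear_map_step:
  assumes l: "l < N" and h: "h \<in> histories Out l" "x \<in> Out h"
  shows "linear_map (D l) (D (Suc l)) (step p h x)"
  unfolding linear_map_def step_def length_histories[OF h(1)]
proof (intro conjI ballI allI)
  let ?F = "\<lambda>X. finite_mat_sum (D (Suc l)) (\<lambda>Q. complex_of_real (p Q) \<cdot>\<^sub>m T Q h x X) (pauli_strings n)"
  note L = linear_mapD[OF linear_T[OF l h]]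
  fix X Y :: "complex mat" and c assume X: "X \<in> carrier_mat (D l) (D l)"
  have TX: "dim_row (T Q h x X) = D (Suc l)" "dim_col (T Q h x X) = D (Suc l)" if "Q \<in> pauli_strings n" for Q
    using L(1)[OF that X] by auto
  show "?F X \<in> carrier_mat (D (Suc l)) (D (Suc l))" by simp
  show "?F (c \<cdot>\<^sub>m X) = c \<cdot>\<^sub>m ?F X"
    by (rule eq_matI) (auto simp: finite_mat_sum_def L(3)[OF _ X] TX sum_distrib_left mult.left_commute intro!: sum.cong)
  assume Y: "Y \<in> carrier_mat (D l) (D l)"
  have TY: "dim_row (T Q h x Y) = D (Suc l)" "dim_col (T Q h x Y) = D (Suc l)" if "Q \<in> pauli_strings n" for Q
    using L(1)[OF that Y] by auto
  show "?F (X + Y) = ?F X + ?F Y"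
    by (rule eq_matI)
      (auto simp: finite_mat_sum_def L(2)[OF _ X Y] TX TY distrib_left sum.distrib)
qed

lemma psd_step:
  assumes "pauli_distribution n p" "l < N" "h \<in> histories Out l" "x \<in> Out h" "psd (D l) X"
  shows "psd (D (Suc l)) (step p h x X)"
  unfolding step_def length_histories[OF assms(3)]
  by (intro psd_finite_mat_sum psd_smult) (use assms psd_T in \<open>auto simp: pauli_distribution_def\<close>)

lemma trace_step:
  assumes p: "pauli_distribution n p" and l: "l < N" and h: "h \<in> histories Out l" and X: "psd (D l) X"
  shows "(\<Sum>x\<in>Out h. mat_trace (step p h x X)) = mat_trace X"
proof -
  have "mat_trace (step p h x X) = (\<Sum>Q\<in>pauli_strings n. complex_of_real (p Q) * mat_trace (T Q h x X))"
    if "x \<in> Out h" for x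
    using psd_carrier[OF psd_T[OF l h that _ X]] unfolding step_def length_histories[OF h]
    by (simp add: mat_trace_finite_mat_sum mat_trace_smult[of _ "D (Suc l)"])
  then have "(\<Sum>x\<in>Out h. mat_trace (step p h x X)) =
      (\<Sum>Q\<in>pauli_strings n. complex_of_real (p Q) * (\<Sum>x\<in>Out h. mat_trace (T Q h x X)))"
    by (simp add: sum_distrib_left) (rule sum.swap)
  also have "\<dots> = complex_of_real (\<Sum>Q\<in>pauli_strings n. p Q) * mat_trace X"
    using trace_T[OF l h _ X] by (simp add: sum_distrib_right)
  also have "(\<Sum>Q\<in>pauli_strings n. p Q) = 1" using p by (simp add: pauli_distribution_def)
  finally show ?thesis by simp
qed

text \<open>Backward induction over the remaining rounds. The rest of an adaptive protocol, with an
  arbitrary accepting set, thus enters only as a test of the current state.\<close>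

lemma test_functional_accept:
  assumes p: "pauli_distribution n p"
  shows "h \<in> histories Out l \<Longrightarrow> l + r = N \<Longrightarrow> test_functional (D l) (accept p A r h)"
proof (induction r arbitrary: h l)
  case 0
  have "test_functional (D l) (\<lambda>X. if h \<in> A then mat_trace X else 0)"
    unfolding test_functional_def by (auto simp: mat_trace_add mat_trace_smult psd_trace)
  then show ?case by simp
next
  case (Suc r)
  then have l: "l < N" by simp
  note h = Suc.prems(1)
  have "test_functional (D l) (\<lambda>X. \<Sum>x\<in>Out h. accept p A r (h @ [x]) (step p h x X))"
    by (rule test_functional_sum[OF Suc.IH[OF histories_append[OF h]] linear_map_step[OF l h]
      psd_step[OF p l h] trace_step[OF p l h]]) (use Suc.prems(2) in auto)
  then show ?case by simp
qed

lemma accept_step: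
  assumes "pauli_distribution n p" "l + Suc r = N" "h \<in> histories Out l" "x \<in> Out h" "psd (D l) X"
  shows "accept p A r (h @ [x]) (step q h x X) =
    (\<Sum>Q\<in>pauli_strings n. complex_of_real (q Q) * accept p A r (h @ [x]) (T Q h x X))"
proof -
  have f: "test_functional (D (Suc l)) (accept p A r (h @ [x]))"
    using assms by (intro test_functional_accept histories_append) auto
  have c: "T Q h x X \<in> carrier_mat (D (Suc l)) (D (Suc l))" if "Q \<in> pauli_strings n" for Q
    using psd_T[of l h x Q X] assms that by auto
  then show ?thesis
    unfolding step_def length_histories[OF assms(3)]
    by (subst test_functional_finite_mat_sum[OF f]) (auto simp: test_functionalD(2)[OF f])
qed

section \<open>Forward evolution and hybrids\<close>

lemma state_append: "l \<le> length h \<Longrightarrow> state p (h @ g) l = state p h l"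
  by (induction l) (auto simp: nth_append)

lemma psd_state:
  assumes p: "pauli_distribution n p" and h: "h \<in> histories Out k" "k \<le> N"
  shows "l \<le> k \<Longrightarrow> psd (D l) (state p h l)"
proof (induction l)
  case 0
  then show ?case using X0 by (simp add: density_operator_def)
next
  case (Suc l)
  then show ?case
    using psd_step[OF p _ take_histories[OF h(1), of l] nth_histories[OF h(1), of l]] h by simp
qed

text \<open>Acceptance in \<open>A\<close> when the first \<open>l\<close> rounds use
  \<open>q\<close> and the remaining ones \<open>p\<close>; at l = N only \<open>q\<close> is
  left.\<close>

definition hybrid :: "(pauli list \<Rightarrow> real) \<Rightarrow> (pauli list \<Rightarrow> real) \<Rightarrow> nat list set \<Rightarrow> nat \<Rightarrow> real" where
  "hybrid p q A l = (\<Sum>h\<in>histories Out l. Re (accept p A (N - l) h (state q h l)))"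

text \<open>Consecutive hybrids share the state before round \<open>l\<close> and the acceptance
  functional after it. They differ in the mixture used in that round, which enters linearly.\<close>

lemma hybrid_Suc:
  assumes p: "pauli_distribution n p" and q: "pauli_distribution n q" and l: "l < N"
  shows "hybrid p q A l - hybrid p q A (Suc l) =
    (\<Sum>h\<in>histories Out l. \<Sum>Q\<in>pauli_strings n. (p Q - q Q) *
      (\<Sum>x\<in>Out h. Re (accept p A (N - Suc l) (h @ [x]) (T Q h x (state q h l)))))"
proof -
  define r where "r = N - Suc l"
  have r: "N - l = Suc r" "l + Suc r = N" using l by (auto simp: r_def)
  let ?a = "\<lambda>h x X. Re (accept p A r (h @ [x]) X)"
  have 1: "hybrid p q A (Suc l) = (\<Sum>h\<in>histories Out l. \<Sum>x\<in>Out h. ?a h x (step q h x (state q h l)))"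
    unfolding hybrid_def sum_histories[OF l] r_def
    by (intro sum.cong refl) (auto simp: state_append nth_append length_histories)
  have 2: "hybrid p q A l = (\<Sum>h\<in>histories Out l. \<Sum>x\<in>Out h. ?a h x (step p h x (state q h l)))"
    unfolding hybrid_def r(1) by (simp add: Re_sum)
  have 3: "(\<Sum>x\<in>Out h. ?a h x (step p h x (state q h l))) - (\<Sum>x\<in>Out h. ?a h x (step q h x (state q h l))) =
      (\<Sum>Q\<in>pauli_strings n. (p Q - q Q) * (\<Sum>x\<in>Out h. ?a h x (T Q h x (state q h l))))"
    if h: "h \<in> histories Out l" for h
  proof -
    have "?a h x (step q' h x (state q h l)) = (\<Sum>Q\<in>pauli_strings n. q' Q * ?a h x (T Q h x (state q h l)))"
      if "x \<in> Out h" for q' x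
      using accept_step[OF p r(2) h that psd_state[OF q h]] l by (simp add: Re_sum)
    then have "(\<Sum>x\<in>Out h. ?a h x (step p h x (state q h l))) - (\<Sum>x\<in>Out h. ?a h x (step q h x (state q h l))) =
        (\<Sum>x\<in>Out h. \<Sum>Q\<in>pauli_strings n. (p Q - q Q) * ?a h x (T Q h x (state q h l)))"
      by (simp add: left_diff_distrib sum_subtractf)
    then show ?thesis unfolding sum_distrib_left by (subst (asm) sum.swap)
  qed
  show ?thesis unfolding 1 2 r_def[symmetric] by (subst sum_subtractf[symmetric]) (rule sum.cong[OF refl 3])
qed

lemma hybrid_N: "hybrid p q A N = (\<Sum>h\<in>histories Out N \<inter> A. Re (mat_trace (state q h N)))"
  unfolding hybrid_def using finite_histories_Out[of N]
  by (simp add: sum.inter_restrict if_distrib cong: if_cong)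

lemma hybrid_0: "hybrid p q A 0 = Re (accept p A N [] X0)"
  by (simp add: hybrid_def)

lemma hybrid_self:
  assumes "pauli_distribution n p"
  shows "l \<le> N \<Longrightarrow> hybrid p p A l = Re (accept p A N [] X0)"
proof (induction l)
  case (Suc l)
  then show ?case using hybrid_Suc[OF assms assms, of l A] by simp
qed (simp add: hybrid_0)

lemma accept_total:
  assumes p: "pauli_distribution n p"
  shows "l + r = N \<Longrightarrow> h \<in> histories Out l \<Longrightarrow> psd (D l) X \<Longrightarrow> accept p UNIV r h X = mat_trace X"
proof (induction r arbitrary: l h X)
  case (Suc r)
  then have l: "l < N" by simp
  note h = Suc.prems(2) and X = Suc.prems(3)
  have "accept p UNIV (Suc r) h X = (\<Sum>x\<in>Out h. mat_trace (step p h x X))"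
    unfolding accept.simps using Suc.IH[OF _ histories_append[OF h] psd_step[OF p l h _ X]] Suc.prems(1)
    by (intro sum.cong refl) auto
  then show ?case using trace_step[OF p l h X] by simp
qed simp

text \<open>Accepting every record makes the hybrid the total probability, and a hybrid of
  \<open>p\<close> with itself does not change with \<open>l\<close>. At l = 0 it is the trace of
  the initial state.\<close>

lemma sum_trace_state:
  assumes p: "pauli_distribution n p" and l: "l \<le> N"
  shows "(\<Sum>h\<in>histories Out l. Re (mat_trace (state p h l))) = 1"
proof -
  have "hybrid p p UNIV l = (\<Sum>h\<in>histories Out l. Re (mat_trace (state p h l)))"
    unfolding hybrid_def
  proof (intro sum.cong refl)
    fix h assume h: "h \<in> histories Out l"
    then have "psd (D l) (state p h l)" using psd_state[OF p h] l by simp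
    then show "Re (accept p UNIV (N - l) h (state p h l)) = Re (mat_trace (state p h l))"
      using accept_total[OF p, of l "N - l" h] h l by simp
  qed
  then show ?thesis
    using hybrid_self[OF p l] accept_total[OF p, of 0 N "[]" X0] X0 by (simp add: density_operator_def)
qed

text \<open>For each round and record the l^2 bound on the responses becomes an l^1 bound by
  Cauchy-Schwarz over the 4 ^ n strings, whence the factor 2 ^ n. The bound scales with the trace of
  the state, and these traces sum to 1 over the records, so every round costs the same.\<close>

lemma hybrid_bound:
  assumes B: "0 \<le> B" and \<theta>: "0 \<le> \<theta>" "\<theta> \<le> 1"
    and round_bound: "\<And>l h X f. l < N \<Longrightarrow> h \<in> histories Out l \<Longrightarrow> psd (D l) X \<Longrightarrow>
      (\<And>P x. P \<in> pauli_strings n \<Longrightarrow> x \<in> Out h \<Longrightarrow> test_functional (D (Suc l)) (f P x)) \<Longrightarrow>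
      (\<Sum>P\<in>pauli_strings n. (1 / 4 ^ n * (\<Sum>Q\<in>pauli_strings n. pauli_sign P Q *
        (\<Sum>x\<in>Out h. Re (f P x (T Q h x X)))))\<^sup>2) \<le> B * (Re (mat_trace X))\<^sup>2"
  defines "S \<equiv> pauli_strings n - {replicate n Pauli_I}"
  shows "(\<Sum>P\<in>S. \<bar>hybrid (perturbed n \<theta> P) (perturbed n \<theta> P) (A P) N - hybrid (uniform n) (uniform n) (A P) N\<bar>) \<le>
    real N * \<theta> * 2 ^ n * sqrt B"
proof -
  let ?Ps = "pauli_strings n"
  let ?u = "uniform n"
  \<comment> \<open>For the identity string the perturbed weights would sum to 1 + \<theta>. Putting
    the uniform distribution there gives a valid test for every string, so that
    \<open>round_bound\<close> applies to the full set of strings.\<close>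
  define p where "p P = (if P = replicate n Pauli_I then ?u else perturbed n \<theta> P)" for P
  have pd: "pauli_distribution n (p P)" if "P \<in> ?Ps" for P
    using that \<theta> by (auto simp: p_def uniform_distribution intro: perturbed_distribution)
  note ud = uniform_distribution[of n]
  have finS: "finite S" "S \<subseteq> ?Ps" by (auto simp: S_def)
  define c where "c l h P = 1 / 4 ^ n * (\<Sum>Q\<in>?Ps. pauli_sign P Q *
    (\<Sum>x\<in>Out h. Re (accept (p P) (A P) (N - Suc l) (h @ [x]) (T Q h x (state ?u h l)))))" for l h P
  have csum: "(\<Sum>P\<in>S. \<bar>c l h P\<bar>) \<le> 2 ^ n * sqrt B * Re (mat_trace (state ?u h l))"
    if l: "l < N" and h: "h \<in> histories Out l" for l h
  proof -
    let ?t = "Re (mat_trace (state ?u h l))"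
    have st: "psd (D l) (state ?u h l)" using psd_state[OF ud h] l by simp
    have "(\<Sum>P\<in>?Ps. (c l h P)\<^sup>2) \<le> B * ?t\<^sup>2"
      unfolding c_def
    proof (rule round_bound[OF l h st])
      fix P x assume "P \<in> ?Ps" "x \<in> Out h"
      then show "test_functional (D (Suc l)) (accept (p P) (A P) (N - Suc l) (h @ [x]))"
        using l by (intro test_functional_accept pd histories_append[OF h]) auto
    qed
    moreover have "(\<Sum>P\<in>S. \<bar>c l h P\<bar>) \<le> (\<Sum>P\<in>?Ps. \<bar>c l h P\<bar>)"
      using finS by (intro sum_mono2) auto
    moreover have "(\<Sum>P\<in>?Ps. \<bar>c l h P\<bar>)\<^sup>2 \<le> (\<Sum>P\<in>?Ps. \<bar>c l h P\<bar>\<^sup>2) * 4 ^ n"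
      using sum_squared_le_sum_of_squares[of "\<lambda>P. \<bar>c l h P\<bar>" "?Ps"] by simp
    moreover have "(\<Sum>P\<in>?Ps. (c l h P)\<^sup>2) * 4 ^ n \<le> B * ?t\<^sup>2 * 4 ^ n"
      using calculation(1) by (rule mult_right_mono) simp
    ultimately have "(\<Sum>P\<in>?Ps. \<bar>c l h P\<bar>)\<^sup>2 \<le> B * ?t\<^sup>2 * 4 ^ n" unfolding power2_abs by linarith
    also have "\<dots> = (2 ^ n * sqrt B * ?t)\<^sup>2"
      unfolding power_mult_distrib four_power real_sqrt_pow2[OF B] by (simp only: ac_simps)
    finally have "(\<Sum>P\<in>?Ps. \<bar>c l h P\<bar>) \<le> 2 ^ n * sqrt B * ?t"
      by (rule power2_le_imp_le) (use B psd_trace(1)[OF st] in simp)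
    with \<open>(\<Sum>P\<in>S. \<bar>c l h P\<bar>) \<le> _\<close> show ?thesis by simp
  qed
  have diff: "\<bar>hybrid (perturbed n \<theta> P) (perturbed n \<theta> P) (A P) N - hybrid ?u ?u (A P) N\<bar> \<le>
      (\<Sum>l<N. \<Sum>h\<in>histories Out l. \<theta> * \<bar>c l h P\<bar>)" if P: "P \<in> S" for P
  proof -
    have pP: "p P = perturbed n \<theta> P" using P by (simp add: p_def S_def)
    have pd': "pauli_distribution n (p P)" using P finS pd by blast
    \<comment> \<open>The two ends of the telescope: no round is depolarising at l = 0, and all are
      at l = N.\<close>
    have "hybrid (p P) (p P) (A P) N = hybrid (p P) ?u (A P) 0"
      using hybrid_self[OF pd' order.refl] by (simp add: hybrid_0)
    moreover have "hybrid ?u ?u (A P) N = hybrid (p P) ?u (A P) N" by (simp add: hybrid_N)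
    ultimately have "hybrid (p P) (p P) (A P) N - hybrid ?u ?u (A P) N =
        (\<Sum>l<N. hybrid (p P) ?u (A P) l - hybrid (p P) ?u (A P) (Suc l))"
      by (simp add: sum_lessThan_telescope')
    also have "\<dots> = (\<Sum>l<N. \<Sum>h\<in>histories Out l. \<theta> * c l h P)"
    proof (intro sum.cong refl)
      fix l assume "l \<in> {..<N}"
      then have l: "l < N" by simp
      have "(p P) Q - ?u Q = \<theta> * (1 / 4 ^ n * pauli_sign P Q)" for Q
        by (simp add: pP perturbed_def uniform_def add_divide_distrib)
      then show "hybrid (p P) ?u (A P) l - hybrid (p P) ?u (A P) (Suc l) = (\<Sum>h\<in>histories Out l. \<theta> * c l h P)"
        unfolding hybrid_Suc[OF pd' ud l] c_def by (simp add: sum_distrib_left mult.assoc)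
    qed
    also have "\<bar>\<dots>\<bar> \<le> (\<Sum>l<N. \<Sum>h\<in>histories Out l. \<theta> * \<bar>c l h P\<bar>)"
      using \<theta> by (intro order.trans[OF sum_abs] sum_mono) (auto simp: abs_mult intro!: order.trans[OF sum_abs])
    finally show ?thesis unfolding pP .
  qed
  have "(\<Sum>P\<in>S. \<bar>hybrid (perturbed n \<theta> P) (perturbed n \<theta> P) (A P) N - hybrid ?u ?u (A P) N\<bar>) \<le>
      (\<Sum>P\<in>S. \<Sum>l<N. \<Sum>h\<in>histories Out l. \<theta> * \<bar>c l h P\<bar>)"
    by (intro sum_mono diff)
  also have "\<dots> = (\<Sum>l<N. \<Sum>h\<in>histories Out l. \<theta> * (\<Sum>P\<in>S. \<bar>c l h P\<bar>))"
    unfolding sum_distrib_left by (subst sum.swap, rule sum.cong[OF refl], rule sum.swap)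
  also have "\<dots> \<le> (\<Sum>l<N. \<Sum>h\<in>histories Out l. \<theta> * (2 ^ n * sqrt B * Re (mat_trace (state ?u h l))))"
    using \<theta> csum by (intro sum_mono mult_left_mono) auto
  also have "\<dots> = (\<Sum>l<N. \<theta> * (2 ^ n * sqrt B * 1))"
    using sum_trace_state[OF ud] by (intro sum.cong refl) (simp add: sum_distrib_left[symmetric])
  also have "\<dots> = real N * \<theta> * 2 ^ n * sqrt B" by simp
  finally show ?thesis .
qed

end

section \<open>Lower bounds from learning\<close>

text \<open>The weights 2 / 3 and 3 / 2 in the arithmetic-geometric mean are rational stand-ins for
  1 / sqrt 2 and sqrt 2, which are optimal for probabilities 2 / 3 and 1 / 3 of the event. The sharp
  bound would be 2 * sqrt 2 / 3; 17 / 18 is slightly larger.\<close>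

lemma sum_sqrt_le_if_distinguished:
  fixes a b :: "'a \<Rightarrow> real"
  assumes H: "finite H" "A \<subseteq> H"
    and a: "\<And>h. h \<in> H \<Longrightarrow> 0 \<le> a h" "(\<Sum>h\<in>H. a h) = 1" "2 / 3 \<le> (\<Sum>h\<in>A. a h)"
    and b: "\<And>h. h \<in> H \<Longrightarrow> 0 \<le> b h" "(\<Sum>h\<in>H. b h) = 1" "(\<Sum>h\<in>A. b h) \<le> 1 / 3"
  shows "(\<Sum>h\<in>H. sqrt (a h * b h)) \<le> 17 / 18"
proof -
  have amgm: "sqrt (x * y) \<le> (t * x + y / t) / 2" if "0 \<le> x" "0 \<le> y" "0 < t" for x y t :: real
    using arith_geo_mean_sqrt[of "t * x" "y / t"] that by simp
  have split: "(\<Sum>h\<in>H. f h) = (\<Sum>h\<in>A. f h) + (\<Sum>h\<in>H - A. f h)" for f :: "'a \<Rightarrow> real"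
    using sum.subset_diff[OF H(2,1), of f] by simp
  have avg: "(\<Sum>h\<in>X. (t * a h + b h / t) / 2) = (t * (\<Sum>h\<in>X. a h) + (\<Sum>h\<in>X. b h) / t) / 2" for X t
    by (simp only: sum_divide_distrib[symmetric] sum.distrib sum_distrib_left)
  have "(\<Sum>h\<in>A. sqrt (a h * b h)) \<le> (\<Sum>h\<in>A. (2 / 3 * a h + b h / (2 / 3)) / 2)"
    using H a(1) b(1) by (intro sum_mono amgm) auto
  moreover have "(\<Sum>h\<in>H - A. sqrt (a h * b h)) \<le> (\<Sum>h\<in>H - A. (3 / 2 * a h + b h / (3 / 2)) / 2)"
    using a(1) b(1) by (intro sum_mono amgm) auto
  ultimately have "(\<Sum>h\<in>H. sqrt (a h * b h)) \<le>
      (2 / 3 * (\<Sum>h\<in>A. a h) + (\<Sum>h\<in>A. b h) / (2 / 3)) / 2 +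
      (3 / 2 * (\<Sum>h\<in>H - A. a h) + (\<Sum>h\<in>H - A. b h) / (3 / 2)) / 2"
    unfolding split[of "\<lambda>h. sqrt (a h * b h)"] avg by (rule add_mono)
  then show ?thesis using a(2,3) b(2,3) split[of a] split[of b] by argo
qed

text \<open>It rests on y / (1 + y) \<le> ln (1 + y), which is 1 + z \<le> exp z at z = - y / (1 +
  y). The polynomial comparison needs 3 + 4 * y \<ge> 0, the origin of the range 3 / 4.\<close>

lemma exp_le_one_add:
  fixes y :: real
  assumes "\<bar>y\<bar> \<le> 3 / 4"
  shows "exp (y - 4 * y\<^sup>2) \<le> 1 + y"
proof -
  have y: "0 < 1 + y" using assms by auto
  have "0 \<le> y\<^sup>2 * (3 + 4 * y)" using assms by (intro mult_nonneg_nonneg) auto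
  then have "(y - 4 * y\<^sup>2) * (1 + y) \<le> y" by (simp add: algebra_simps power2_eq_square)
  then have "y - 4 * y\<^sup>2 \<le> y / (1 + y)" using y by (simp add: pos_le_divide_eq)
  then have 1: "exp (y - 4 * y\<^sup>2) \<le> exp (y / (1 + y))" by simp
  have "inverse (1 + y) \<le> exp (- (y / (1 + y)))"
    using exp_ge_add_one_self[of "- (y / (1 + y))"] y by (simp add: field_simps)
  then have "exp (y / (1 + y)) \<le> 1 + y"
    using y le_imp_inverse_le[of "inverse (1 + y)" "exp (- (y / (1 + y)))"] by (simp add: exp_minus)
  with 1 show ?thesis by (rule order.trans)
qed

section \<open>Likelihoods of the records of incoherent protocols\<close>

definition record_weight ::
  "nat \<Rightarrow> (nat list \<Rightarrow> nat \<Rightarrow> pauli list \<Rightarrow> real) \<Rightarrow> (pauli list \<Rightarrow> real) \<Rightarrow> nat list \<Rightarrow> real" where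
  "record_weight n g p h = (\<Prod>l<length h. \<Sum>Q\<in>pauli_strings n. p Q * g (take l h) (h ! l) Q)"

lemma record_weight_append:
  "record_weight n g p (h @ [x]) = record_weight n g p h * (\<Sum>Q\<in>pauli_strings n. p Q * g h x Q)"
  by (simp add: record_weight_def nth_append)

text \<open>Here \<open>g h x Q\<close> is the probability of the outcome \<open>x\<close> after the record \<open>h\<close> when the channel is
  conjugation by \<open>Q\<close>; an incoherent protocol depends on the channel only through these numbers.\<close>

lemma incoherent_learning_bound:
  fixes g :: "nat list \<Rightarrow> nat \<Rightarrow> pauli list \<Rightarrow> real"
  assumes n: "1 \<le> n" and \<epsilon>: "0 < \<epsilon>" "\<epsilon> \<le> 1 / 3"
    and fin: "\<And>l h. l < N \<Longrightarrow> h \<in> histories (outcomes \<pi>) l \<Longrightarrow> finite (outcomes \<pi> h)"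
    and g0: "\<And>l h x Q. l < N \<Longrightarrow> h \<in> histories (outcomes \<pi>) l \<Longrightarrow> x \<in> outcomes \<pi> h \<Longrightarrow> Q \<in> pauli_strings n \<Longrightarrow> 0 \<le> g h x Q"
    and g1: "\<And>l h Q. l < N \<Longrightarrow> h \<in> histories (outcomes \<pi>) l \<Longrightarrow> Q \<in> pauli_strings n \<Longrightarrow> (\<Sum>x\<in>outcomes \<pi> h. g h x Q) = 1"
    and gb: "\<And>l h. l < N \<Longrightarrow> h \<in> histories (outcomes \<pi>) l \<Longrightarrow>
      \<exists>b. (\<forall>x\<in>outcomes \<pi> h. \<forall>Q\<in>pauli_strings n. g h x Q \<le> b x) \<and> (\<Sum>x\<in>outcomes \<pi> h. b x) \<le> K"
    and learn: "solves_learning n \<epsilon> N rp \<pi>"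
    and rp: "\<And>p h. pauli_distribution n p \<Longrightarrow> h \<in> histories (outcomes \<pi>) N \<Longrightarrow> rp \<pi> (pauli_channel n p) h = record_weight n g p h"
  shows "4 ^ n / 24 \<le> 2 * (9 / 4 * \<epsilon>)\<^sup>2 * real N * K"
proof -
  let ?Out = "outcomes \<pi>" and ?S = "pauli_strings n" and ?u = "uniform n"
  let ?R = "histories ?Out" and ?W = "record_weight n g"
  define \<theta> where "\<theta> = 9 / 4 * \<epsilon>"
  have \<theta>: "0 < \<theta>" "\<theta> \<le> 3 / 4" using \<epsilon> by (auto simp: \<theta>_def)
  define p where "p P = perturbed n \<theta> P" for P
  define S' where "S' = ?S - {replicate n Pauli_I}"
  have S': "P \<in> ?S" "P \<noteq> replicate n Pauli_I" if "P \<in> S'" for P using that by (auto simp: S'_def)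
  have pd: "pauli_distribution n (p P)" if "P \<in> S'" for P
    unfolding p_def using S'[OF that] \<theta> by (intro perturbed_distribution) auto
  note ud = uniform_distribution[of n]
  have finH: "finite (?R l)" if "l \<le> N" for l
    by (rule finite_histories, rule fin) (use that in auto)
  have sumH: "(\<Sum>h\<in>?R (Suc l). F h) = (\<Sum>h\<in>?R l. \<Sum>x\<in>?Out h. F (h @ [x]))"
    if "l < N" for l and F :: "nat list \<Rightarrow> real"
    by (rule sum_histories_Suc, rule fin) (use that in auto)
  have q0: "0 \<le> q Q" if "pauli_distribution n q" "Q \<in> ?S" for q Q
    using that by (auto simp: pauli_distribution_def)
  have rw0: "l \<le> N \<Longrightarrow> h \<in> ?R l \<Longrightarrow> 0 \<le> ?W q h" if "pauli_distribution n q" for q l h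
    unfolding record_weight_def
  proof (intro prod_nonneg sum_nonneg mult_nonneg_nonneg q0[OF that] ballI)
    fix k Q assume l: "l \<le> N" "h \<in> ?R l" and "k \<in> {..<length h}" and Q: "Q \<in> ?S"
    then have k: "k < l" by (simp add: length_histories)
    show "0 \<le> g (take k h) (h ! k) Q"
      using l k Q by (intro g0[of k] take_histories[of h ?Out l] nth_histories[of h ?Out l]) auto
  qed
  have rw1: "l \<le> N \<Longrightarrow> (\<Sum>h\<in>?R l. ?W q h) = 1" if q: "pauli_distribution n q" for q l
  proof (induction l)
    case 0
    then show ?case by (simp add: record_weight_def)
  next
    case (Suc l)
    then have l: "l < N" by simp
    have "(\<Sum>x\<in>?Out h. \<Sum>Q\<in>?S. q Q * g h x Q) = 1" if "h \<in> ?R l" for h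
      using q g1[OF l that] by (subst sum.swap) (simp add: sum_distrib_left[symmetric] pauli_distribution_def)
    then show ?case
      using Suc l by (simp add: sumH record_weight_append sum_distrib_left[symmetric])
  qed
  define w where "w h x = (\<Sum>Q\<in>?S. ?u Q * g h x Q)" for h x
  define m where "m P h x = 1 / 4 ^ n * (\<Sum>Q\<in>?S. pauli_sign P Q * g h x Q)" for P h x
  \<comment> \<open>The likelihood ratio of one outcome is 1 + \<theta> * \<xi>. If
    \<open>w h x\<close> is zero then so is \<open>m P h x\<close>, and division by zero gives \<xi>
    = 0, so w * \<xi> = m holds in every case.\<close>
  define \<xi> where "\<xi> P h x = m P h x / w h x" for P h x
  have w_eq: "w h x = 1 / 4 ^ n * (\<Sum>Q\<in>?S. g h x Q)" for h x
    by (simp add: w_def uniform_def sum_divide_distrib)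
  have pw: "(\<Sum>Q\<in>?S. p P Q * g h x Q) = w h x + \<theta> * m P h x" for P h x
  proof -
    have "p P Q * g h x Q = ?u Q * g h x Q + \<theta> * (1 / 4 ^ n * (pauli_sign P Q * g h x Q))" for Q
      by (simp add: p_def perturbed_def uniform_def add_divide_distrib distrib_right)
    then show ?thesis by (simp only: sum.distrib sum_distrib_left[symmetric] w_def m_def)
  qed
  have w0: "0 \<le> w h x" if "l < N" "h \<in> ?R l" "x \<in> ?Out h" for l h x
    unfolding w_eq using g0[OF that] by (simp add: sum_nonneg)
  have mw: "\<bar>m P h x\<bar> \<le> w h x" if "l < N" "h \<in> ?R l" "x \<in> ?Out h" for l P h x
  proof -
    have "\<bar>\<Sum>Q\<in>?S. pauli_sign P Q * g h x Q\<bar> \<le> (\<Sum>Q\<in>?S. \<bar>pauli_sign P Q * g h x Q\<bar>)" by (rule sum_abs)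
    also have "\<dots> = (\<Sum>Q\<in>?S. g h x Q)"
    proof (intro sum.cong refl)
      fix Q assume "Q \<in> ?S"
      then show "\<bar>pauli_sign P Q * g h x Q\<bar> = g h x Q"
        using g0[OF that] pauli_sign_cases[of P Q] by (auto simp: abs_mult)
    qed
    finally show ?thesis unfolding m_def w_eq by (simp add: abs_mult divide_right_mono)
  qed
  have \<xi>: "w h x * \<xi> P h x = m P h x" "\<bar>\<xi> P h x\<bar> \<le> 1"
    if "l < N" "h \<in> ?R l" "x \<in> ?Out h" for l P h x
    using mw[OF that, of P] by (auto simp: \<xi>_def divide_le_eq_1)
  have w1: "(\<Sum>x\<in>?Out h. w h x) = 1" if "l < N" "h \<in> ?R l" for l h
    unfolding w_def using g1[OF that] ud
    by (subst sum.swap) (simp add: sum_distrib_left[symmetric] pauli_distribution_def)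
  \<comment> \<open>This removes the first-order term from the mean of \<open>G\<close> below: the
    total outcome probability is 1 for every \<open>Q\<close>, and the signs of a nonidentity string
    cancel.\<close>
  have m1: "(\<Sum>x\<in>?Out h. m P h x) = 0" if "l < N" "h \<in> ?R l" "P \<in> S'" for l h P
  proof -
    have "(\<Sum>x\<in>?Out h. m P h x) = 1 / 4 ^ n * (\<Sum>Q\<in>?S. pauli_sign P Q * (\<Sum>x\<in>?Out h. g h x Q))"
      unfolding m_def sum_distrib_left[symmetric] by (subst sum.swap) (simp add: sum_distrib_left)
    then show ?thesis using g1[OF that(1,2)] sum_pauli_sign[OF S'[OF that(3)]] by simp
  qed
  \<comment> \<open>A lower bound for the log-likelihood ratio of the whole record. It is polynomial
    in \<xi>, so its mean under the depolarising channel can be computed round by round although the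
    rounds are adaptive.\<close>
  define G where "G P h = (\<Sum>l<length h. \<theta> * \<xi> P (take l h) (h ! l) - 4 * (\<theta> * \<xi> P (take l h) (h ! l))\<^sup>2)" for P h
  have G_append: "G P (h @ [x]) = G P h + (\<theta> * \<xi> P h x - 4 * (\<theta> * \<xi> P h x)\<^sup>2)" for P h x
    by (simp add: G_def nth_append)
  have expG: "l \<le> N \<Longrightarrow> h \<in> ?R l \<Longrightarrow> ?W ?u h * exp (G P h) \<le> ?W (p P) h" for P l h
  proof (induction l arbitrary: h)
    case 0
    then show ?case by (simp add: record_weight_def G_def)
  next
    case (Suc l)
    then have l: "l < N" by simp
    obtain h' x where h: "h = h' @ [x]" "h' \<in> ?R l" "x \<in> ?Out h'"
      using Suc.prems(2) unfolding histories_Suc by auto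
    note lhx = l h(2,3)
    let ?y = "\<theta> * \<xi> P h' x"
    have "\<bar>?y\<bar> \<le> 3 / 4 * 1" unfolding abs_mult using \<theta> \<xi>(2)[OF lhx] by (intro mult_mono) auto
    then have "exp (?y - 4 * ?y\<^sup>2) \<le> 1 + ?y" by (intro exp_le_one_add) simp
    then have "w h' x * exp (?y - 4 * ?y\<^sup>2) \<le> w h' x * (1 + ?y)" using w0[OF lhx] by (rule mult_left_mono)
    also have "\<dots> = w h' x + \<theta> * m P h' x" unfolding \<xi>(1)[OF lhx, of P, symmetric] by (simp add: algebra_simps)
    finally have 1: "w h' x * exp (?y - 4 * ?y\<^sup>2) \<le> w h' x + \<theta> * m P h' x" .
    have "?W ?u h * exp (G P h) =
        (?W ?u h' * exp (G P h')) * (w h' x * exp (?y - 4 * ?y\<^sup>2))"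
      unfolding h(1) record_weight_append G_append exp_add w_def by (simp add: ac_simps)
    also have "\<dots> \<le> ?W (p P) h' * (w h' x + \<theta> * m P h' x)"
      using Suc.IH[OF _ h(2)] l 1 w0[OF lhx] rw0[OF ud _ h(2)] by (intro mult_mono) (auto intro: order.trans[OF _ Suc.IH[OF _ h(2)]])
    also have "\<dots> = ?W (p P) h" unfolding h(1) record_weight_append pw ..
    finally show ?case .
  qed
  \<comment> \<open>In units of \<theta>^2, the expected chi-squared divergence contributed by round
    \<open>l\<close> under the depolarising channel.\<close>
  define V where "V P l = (\<Sum>h\<in>?R l. ?W ?u h * (\<Sum>x\<in>?Out h. w h x * (\<xi> P h x)\<^sup>2))" for P l
  have sumG: "l \<le> N \<Longrightarrow> (\<Sum>h\<in>?R l. ?W ?u h * G P h) = - 4 * \<theta>\<^sup>2 * (\<Sum>k<l. V P k)"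
    if P: "P \<in> S'" for l P
  proof (induction l)
    case 0
    then show ?case by (simp add: G_def)
  next
    case (Suc l)
    then have l: "l < N" by simp
    have "(\<Sum>x\<in>?Out h. ?W ?u (h @ [x]) * G P (h @ [x])) =
        ?W ?u h * G P h - 4 * \<theta>\<^sup>2 * (?W ?u h * (\<Sum>x\<in>?Out h. w h x * (\<xi> P h x)\<^sup>2))"
      if h: "h \<in> ?R l" for h
    proof -
      have "(\<Sum>x\<in>?Out h. ?W ?u (h @ [x]) * G P (h @ [x])) =
          (\<Sum>x\<in>?Out h. ?W ?u h * (G P h * w h x + \<theta> * m P h x - 4 * \<theta>\<^sup>2 * (w h x * (\<xi> P h x)\<^sup>2)))"
      proof (intro sum.cong refl)
        fix x assume x: "x \<in> ?Out h"
        show "?W ?u (h @ [x]) * G P (h @ [x]) =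
            ?W ?u h * (G P h * w h x + \<theta> * m P h x - 4 * \<theta>\<^sup>2 * (w h x * (\<xi> P h x)\<^sup>2))"
          unfolding record_weight_append G_append w_def[symmetric] \<xi>(1)[OF l h x, of P, symmetric]
          by (simp add: algebra_simps power2_eq_square)
      qed
      also have "\<dots> = ?W ?u h * (G P h * (\<Sum>x\<in>?Out h. w h x) + \<theta> * (\<Sum>x\<in>?Out h. m P h x)
          - 4 * \<theta>\<^sup>2 * (\<Sum>x\<in>?Out h. w h x * (\<xi> P h x)\<^sup>2))"
        unfolding sum_distrib_left[symmetric] sum_subtractf sum.distrib by simp
      finally show ?thesis unfolding w1[OF l h] m1[OF l h P] by (simp add: algebra_simps)
    qed
    then have "(\<Sum>h\<in>?R (Suc l). ?W ?u h * G P h) =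
        (\<Sum>h\<in>?R l. ?W ?u h * G P h) - 4 * \<theta>\<^sup>2 * V P l"
      unfolding sumH[OF l] V_def sum_distrib_left sum_subtractf[symmetric] by (intro sum.cong refl) simp
    then show ?case using Suc l by (simp add: algebra_simps)
  qed
  have each: "1 / 18 \<le> 2 * \<theta>\<^sup>2 * (\<Sum>k<N. V P k)" if P: "P \<in> S'" for P
  proof -
    \<comment> \<open>The square root in the affinity halves \<open>G\<close>, which turns the
      coefficient 4 into 2. Bounding exp below by its tangent then leaves only the mean of
      \<open>G\<close>.\<close>
    have "1 - 2 * \<theta>\<^sup>2 * (\<Sum>k<N. V P k) = (\<Sum>h\<in>(?R N). ?W ?u h * (1 + G P h / 2))"
      using sumG[OF P, of N] rw1[OF ud, of N] by (simp add: distrib_left sum.distrib sum_divide_distrib[symmetric])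
    also have "\<dots> \<le> (\<Sum>h\<in>(?R N). sqrt (?W ?u h * ?W (p P) h))"
    proof (rule sum_mono)
      fix h assume h: "h \<in> (?R N)"
      let ?a = "?W ?u h"
      have a: "0 \<le> ?a" using rw0[OF ud _ h] by simp
      have "?a * (1 + G P h / 2) \<le> ?a * exp (G P h / 2)"
        using a exp_ge_add_one_self[of "G P h / 2"] by (intro mult_left_mono) auto
      also have "\<dots> = sqrt (?a * (?a * exp (G P h)))"
      proof -
        have "?a * (?a * exp (G P h)) = (?a * exp (G P h / 2))\<^sup>2"
          by (simp add: power_mult_distrib power2_eq_square flip: exp_add)
        then show ?thesis using a by simp
      qed
      also have "\<dots> \<le> sqrt (?a * ?W (p P) h)"
        using a expG[OF _ h, of P] by (intro real_sqrt_le_mono mult_left_mono) auto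
      finally show "?a * (1 + G P h / 2) \<le> sqrt (?a * ?W (p P) h)" .
    qed
    also have "\<dots> \<le> 17 / 18"
    proof (rule sum_sqrt_le_if_distinguished)
      let ?A = "{h \<in> (?R N). \<bar>estimate \<pi> h P\<bar> \<le> \<epsilon>}"
      have 1: "0 \<le> rp \<pi> (pauli_channel n q) h" if "pauli_distribution n q" "h \<in> (?R N)" for q h
        using rw0[OF that(1) _ that(2)] rp[OF that] by simp
      have 2: "(\<Sum>h\<in>(?R N). rp \<pi> (pauli_channel n q) h) = 1" if "pauli_distribution n q" for q
        using rw1[OF that, of N] rp[OF that] by simp
      note dist = learning_distinguishes[OF learn \<epsilon> S'[OF P] finH[OF order.refl] 1 2]
      show "2 / 3 \<le> (\<Sum>h\<in>?A. ?W ?u h)" using dist(1) rp[OF ud] by simp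
      show "(\<Sum>h\<in>?A. ?W (p P) h) \<le> 1 / 3"
        using dist(2) rp[OF pd[OF P]] unfolding p_def \<theta>_def by simp
    qed (use finH[OF order.refl] rw0[OF ud order.refl] rw0[OF pd[OF P] order.refl] rw1[OF ud order.refl]
        rw1[OF pd[OF P] order.refl] in auto)
    finally show ?thesis by simp
  qed
  have Vsum: "(\<Sum>P\<in>S'. V P l) \<le> K" if l: "l < N" for l
  proof -
    have "(\<Sum>P\<in>S'. V P l) = (\<Sum>h\<in>?R l. ?W ?u h * (\<Sum>x\<in>?Out h. \<Sum>P\<in>S'. w h x * (\<xi> P h x)\<^sup>2))"
      unfolding V_def by (subst sum.swap, rule sum.cong[OF refl], subst sum.swap[of _ _ "?Out _"]) (simp add: sum_distrib_left)
    also have "\<dots> \<le> (\<Sum>h\<in>?R l. ?W ?u h * K)"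
    proof (intro sum_mono mult_left_mono)
      fix h assume h: "h \<in> ?R l"
      show "0 \<le> ?W ?u h" using rw0[OF ud _ h] l by simp
      obtain b where b: "\<And>x Q. x \<in> ?Out h \<Longrightarrow> Q \<in> ?S \<Longrightarrow> g h x Q \<le> b x" "(\<Sum>x\<in>?Out h. b x) \<le> K"
        using gb[OF l h] by blast
      have "(\<Sum>P\<in>S'. w h x * (\<xi> P h x)\<^sup>2) \<le> b x" if x: "x \<in> ?Out h" for x
      proof (cases "w h x = 0")
        case True
        have "0 \<le> b x" using g0[OF l h x identity_in_pauli_strings] b(1)[OF x identity_in_pauli_strings] by simp
        then show ?thesis using True by simp
      next
        case False
        then have wpos: "0 < w h x" using w0[OF l h x] by simp
        \<comment> \<open>After Parseval over all strings, one factor of g^2 is replaced by the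
          uniform bound \<open>b x\<close> and the other averages back to \<open>w h x\<close>,
          which cancels the denominator in w * \<xi>^2 = m^2 / w.\<close>
        have "(\<Sum>P\<in>S'. (m P h x)\<^sup>2) \<le> (\<Sum>P\<in>?S. (m P h x)\<^sup>2)" by (intro sum_mono2) (auto simp: S'_def)
        also have "\<dots> = (1 / 4 ^ n)\<^sup>2 * (4 ^ n * (\<Sum>Q\<in>?S. (g h x Q)\<^sup>2))"
          unfolding m_def power_mult_distrib sum_distrib_left[symmetric] parseval_pauli_sign ..
        also have "\<dots> \<le> (1 / 4 ^ n)\<^sup>2 * (4 ^ n * (\<Sum>Q\<in>?S. b x * g h x Q))"
          using b(1)[OF x] g0[OF l h x] by (intro mult_left_mono sum_mono) (auto simp: power2_eq_square intro: mult_right_mono)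
        also have "\<dots> = w h x * b x"
          unfolding w_eq sum_distrib_left[symmetric] by (simp add: power2_eq_square)
        finally have "(\<Sum>P\<in>S'. (m P h x)\<^sup>2) / w h x \<le> b x" using wpos by (simp add: pos_divide_le_eq mult.commute)
        then show ?thesis using wpos by (simp add: \<xi>_def power_divide sum_divide_distrib power2_eq_square)
      qed
      then have "(\<Sum>x\<in>?Out h. \<Sum>P\<in>S'. w h x * (\<xi> P h x)\<^sup>2) \<le> (\<Sum>x\<in>?Out h. b x)" by (rule sum_mono)
      then show "(\<Sum>x\<in>?Out h. \<Sum>P\<in>S'. w h x * (\<xi> P h x)\<^sup>2) \<le> K" using b(2) by simp
    qed
    also have "\<dots> = K" using rw1[OF ud, of l] l by (simp add: sum_distrib_right[symmetric])
    finally show ?thesis .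
  qed
  have card: "real (card S') = 4 ^ n - 1" by (simp add: S'_def card_Diff_singleton of_nat_diff)
  \<comment> \<open>For n \<ge> 1 at least three quarters of the strings are not the identity, and 3
    / 4 * 1 / 18 = 1 / 24.\<close>
  have "(4 :: real) ^ 1 \<le> 4 ^ n" using n by (intro power_increasing) auto
  then have "4 ^ n / 24 \<le> real (card S') * (1 / 18)" unfolding card by simp
  also have "\<dots> = (\<Sum>P\<in>S'. 1 / 18)" by simp
  also have "\<dots> \<le> (\<Sum>P\<in>S'. 2 * \<theta>\<^sup>2 * (\<Sum>k<N. V P k))" by (intro sum_mono each)
  also have "\<dots> = 2 * \<theta>\<^sup>2 * (\<Sum>k<N. \<Sum>P\<in>S'. V P k)" unfolding sum_distrib_left[symmetric] by (subst sum.swap) simp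
  also have "\<dots> \<le> 2 * \<theta>\<^sup>2 * (\<Sum>k<N. K)" by (intro mult_left_mono sum_mono Vsum) auto
  finally show ?thesis by (simp add: \<theta>_def)
qed

text \<open>Learning forces a change of at least 1 / 3 in the probability of a small estimate for
  each nonidentity \<open>P\<close>, while \<open>hybrid_bound\<close> limits the sum of these
  changes. Each model has to supply \<open>round_bound\<close>.\<close>

lemma (in pauli_process) coherent_learning_bound:
  assumes n: "1 \<le> n" and \<epsilon>: "0 < \<epsilon>" "\<epsilon> \<le> 1 / 3" and B: "0 \<le> B"
    and learn: "solves_learning n \<epsilon> N rp \<pi>" and Out: "outcomes \<pi> = Out"
    and rp: "\<And>p h. pauli_distribution n p \<Longrightarrow> h \<in> histories Out N \<Longrightarrow>
      rp \<pi> (pauli_channel n p) h = Re (mat_trace (state p h N))"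
    and round_bound: "\<And>l h X f. l < N \<Longrightarrow> h \<in> histories Out l \<Longrightarrow> psd (D l) X \<Longrightarrow>
      (\<And>P x. P \<in> pauli_strings n \<Longrightarrow> x \<in> Out h \<Longrightarrow> test_functional (D (Suc l)) (f P x)) \<Longrightarrow>
      (\<Sum>P\<in>pauli_strings n. (1 / 4 ^ n * (\<Sum>Q\<in>pauli_strings n. pauli_sign P Q *
        (\<Sum>x\<in>Out h. Re (f P x (T Q h x X)))))\<^sup>2) \<le> B * (Re (mat_trace X))\<^sup>2"
  shows "4 ^ n / 4 \<le> real N * (9 / 4 * \<epsilon>) * 2 ^ n * sqrt B"
proof -
  let ?H = "histories Out N" and ?u = "uniform n"
  define \<theta> where "\<theta> = 9 / 4 * \<epsilon>"
  have \<theta>: "0 < \<theta>" "\<theta> \<le> 1" using \<epsilon> by (auto simp: \<theta>_def)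
  define S where "S = pauli_strings n - {replicate n Pauli_I}"
  have S: "P \<in> pauli_strings n" "P \<noteq> replicate n Pauli_I" if "P \<in> S" for P using that by (auto simp: S_def)
  define A where "A P = {h. \<bar>estimate \<pi> h P\<bar> \<le> \<epsilon>}" for P
  note ud = uniform_distribution[of n]
  have 1: "0 \<le> rp \<pi> (pauli_channel n q) h" if "pauli_distribution n q" "h \<in> ?H" for q h
    using psd_trace(1)[OF psd_state[OF that order.refl order.refl]] rp[OF that] by simp
  have 2: "(\<Sum>h\<in>?H. rp \<pi> (pauli_channel n q) h) = 1" if "pauli_distribution n q" for q
    using sum_trace_state[OF that order.refl] rp[OF that] by simp
  have hyb: "hybrid q q (A P) N = (\<Sum>h\<in>{h \<in> ?H. \<bar>estimate \<pi> h P\<bar> \<le> \<epsilon>}. rp \<pi> (pauli_channel n q) h)"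
    if "pauli_distribution n q" for q P
    unfolding hybrid_N by (intro sum.cong) (auto simp: A_def rp[OF that])
  have each: "1 / 3 \<le> \<bar>hybrid (perturbed n \<theta> P) (perturbed n \<theta> P) (A P) N - hybrid ?u ?u (A P) N\<bar>" if P: "P \<in> S" for P
  proof -
    have pd: "pauli_distribution n (perturbed n \<theta> P)"
      using S[OF P] \<theta> by (intro perturbed_distribution) auto
    note dist = learning_distinguishes[OF learn \<epsilon> S[OF P], unfolded Out, OF finite_histories_Out[OF order.refl] 1 2]
    show ?thesis using dist unfolding hyb[OF pd] hyb[OF ud] \<theta>_def[symmetric] by simp
  qed
  have card: "real (card S) = 4 ^ n - 1" by (simp add: S_def card_Diff_singleton of_nat_diff)
  have "(4 :: real) ^ 1 \<le> 4 ^ n" using n by (intro power_increasing) auto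
  then have "4 ^ n / 4 \<le> real (card S) * (1 / 3)" unfolding card by simp
  also have "\<dots> = (\<Sum>P\<in>S. 1 / 3)" by simp
  also have "\<dots> \<le> (\<Sum>P\<in>S. \<bar>hybrid (perturbed n \<theta> P) (perturbed n \<theta> P) (A P) N - hybrid ?u ?u (A P) N\<bar>)"
    by (intro sum_mono each)
  also have "\<dots> \<le> real N * \<theta> * 2 ^ n * sqrt B"
    unfolding S_def using B \<theta> round_bound by (intro hybrid_bound) auto
  finally show ?thesis by (simp add: \<theta>_def)
qed

section \<open>Conditional min-entropy as an operator inequality\<close>

text \<open>A supremum is not assumed to be attained: any admissible \<kappa> above - \<eta> - 1 is
  taken, which costs the factor 2. The factor 2 powr (- \<kappa>) is absorbed into \<open>s\<close>,
  so that one trace bound carries the entropy.\<close>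

lemma hmin_ge_operator_bound:
  assumes h: "ereal (- \<eta>) \<le> hmin dS dA \<rho>"
  shows "\<exists>s. psd dA s \<and> psd (dS * dA) (tensor_mat (1\<^sub>m dS) s - \<rho>) \<and> Re (mat_trace s) \<le> 2 * 2 powr \<eta>"
proof -
  have "ereal (- \<eta> - 1) < ereal (- \<eta>)" by simp
  also note h
  finally obtain \<sigma> \<kappa> where \<sigma>: "density_operator dA \<sigma>" and \<kappa>: "- \<eta> - 1 < \<kappa>"
    and le: "loewner_le (dS * dA) \<rho> (complex_of_real (2 powr (- \<kappa>)) \<cdot>\<^sub>m tensor_mat (1\<^sub>m dS) \<sigma>)"
    unfolding hmin_def less_SUP_iff by auto
  define s where "s = complex_of_real (2 powr (- \<kappa>)) \<cdot>\<^sub>m \<sigma>"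
  have p: "psd dA \<sigma>" "mat_trace \<sigma> = 1" using \<sigma> by (auto simp: density_operator_def)
  have "tensor_mat (1\<^sub>m dS) s = complex_of_real (2 powr (- \<kappa>)) \<cdot>\<^sub>m tensor_mat (1\<^sub>m dS) \<sigma>"
    unfolding s_def using p by (intro tensor_mat_smult_right[of _ dS _ dA]) auto
  then have "psd (dS * dA) (tensor_mat (1\<^sub>m dS) s - \<rho>)" using le by (simp add: loewner_le_def)
  moreover have "psd dA s" unfolding s_def using p by (intro psd_smult) auto
  moreover have "Re (mat_trace s) \<le> 2 * 2 powr \<eta>"
  proof -
    have "mat_trace s = complex_of_real (2 powr (- \<kappa>))"
      unfolding s_def using p by (simp add: mat_trace_smult[of _ dA])
    moreover have "2 powr (- \<kappa>) \<le> 2 powr (1 + \<eta>)" using \<kappa> by (intro powr_mono) auto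
    ultimately show ?thesis by (simp add: powr_add)
  qed
  ultimately show ?thesis by blast
qed

lemma psd_trace_zero:
  assumes X: "psd d X" and t: "Re (mat_trace X) \<le> 0"
  shows "X = 0\<^sub>m d d"
proof -
  obtain u where u: "\<And>i j. i < d \<Longrightarrow> j < d \<Longrightarrow> X $$ (i, j) = (\<Sum>k<d. u k i * cnj (u k j))"
    using psd_gramE[OF X] by blast
  have "Re (mat_trace X) = (\<Sum>i<d. Re (X $$ (i, i)))"
    using psd_carrier[OF X] by (auto simp: mat_trace_def)
  also have "\<dots> = (\<Sum>i<d. \<Sum>k<d. (cmod (u k i))\<^sup>2)"
  proof (rule sum.cong[OF refl])
    fix i assume "i \<in> {..<d}"
    then have "X $$ (i, i) = of_real (\<Sum>k<d. (cmod (u k i))\<^sup>2)"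
      by (simp only: lessThan_iff u complex_norm_square[symmetric] of_real_sum)
    then show "Re (X $$ (i, i)) = (\<Sum>k<d. (cmod (u k i))\<^sup>2)" by (simp only: Re_complex_of_real)
  qed
  finally have "Re (mat_trace X) = (\<Sum>i<d. \<Sum>k<d. (cmod (u k i))\<^sup>2)" .
  then have "(\<Sum>i<d. \<Sum>k<d. (cmod (u k i))\<^sup>2) = 0"
    using t by (intro antisym sum_nonneg) auto
  then have "u k i = 0" if "k < d" "i < d" for k i
    using that by (simp add: sum_nonneg_eq_0_iff sum_nonneg)
  then show ?thesis using u carrier_matD[OF psd_carrier[OF X]] by (intro eq_matI) auto
qed

text \<open>Weighting each \<sigma> with 2 powr \<eta> and the trace of its effect turns the
  normalised inequalities into bounds on the effects themselves, and the averaging condition into a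
  multiple of the identity. An effect of trace zero vanishes, so zero dominates it.\<close>

lemma povm_hmin_ge_operator_bound:
  assumes E: "\<And>x. x \<in> Out \<Longrightarrow> psd (dS * dA) (E x)" and fin: "finite Out"
    and h: "povm_hmin_ge dS dA Out E \<eta>"
  shows "\<exists>s. (\<forall>x\<in>Out. psd dA (s x) \<and> psd (dS * dA) (tensor_mat (1\<^sub>m dS) (s x) - E x)) \<and>
    finite_mat_sum dA s Out = complex_of_real (2 powr \<eta> * real dS) \<cdot>\<^sub>m 1\<^sub>m dA"
proof -
  define Out' where "Out' = {x \<in> Out. 0 < Re (mat_trace (E x))}"
  obtain \<sigma> where \<sigma>: "\<And>x. x \<in> Out' \<Longrightarrow> density_operator dA (\<sigma> x)"
    and le: "\<And>x. x \<in> Out' \<Longrightarrow> loewner_le (dS * dA) ((1 / mat_trace (E x)) \<cdot>\<^sub>m E x)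
      (complex_of_real (2 powr \<eta>) \<cdot>\<^sub>m tensor_mat (1\<^sub>m dS) (\<sigma> x))"
    and sum: "finite_mat_sum dA (\<lambda>x. mat_trace (E x) \<cdot>\<^sub>m \<sigma> x) Out' = of_nat dS \<cdot>\<^sub>m 1\<^sub>m dA"
    using h unfolding povm_hmin_ge_def Let_def Out'_def by blast
  define t where "t x = Re (mat_trace (E x))" for x
  have tr: "mat_trace (E x) = complex_of_real (t x)" if "x \<in> Out" for x
    using psd_trace(2)[OF E[OF that]] by (simp add: t_def complex_eq_iff)
  define s where "s x = (if x \<in> Out' then complex_of_real (2 powr \<eta> * t x) \<cdot>\<^sub>m \<sigma> x else 0\<^sub>m dA dA)" for x
  have "psd dA (s x) \<and> psd (dS * dA) (tensor_mat (1\<^sub>m dS) (s x) - E x)" if x: "x \<in> Out" for x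
  proof (cases "x \<in> Out'")
    case True
    have tpos: "0 < t x" using True by (simp add: t_def Out'_def)
    have \<sigma>p: "psd dA (\<sigma> x)" using \<sigma>[OF True] by (simp add: density_operator_def)
    have c: "tensor_mat (1\<^sub>m dS) (\<sigma> x) \<in> carrier_mat (dS * dA) (dS * dA)" "E x \<in> carrier_mat (dS * dA) (dS * dA)"
      using \<sigma>p E[OF x] by (auto intro: tensor_mat_carrier)
    have "psd (dS * dA) (complex_of_real (t x) \<cdot>\<^sub>m (complex_of_real (2 powr \<eta>) \<cdot>\<^sub>m tensor_mat (1\<^sub>m dS) (\<sigma> x) - (1 / mat_trace (E x)) \<cdot>\<^sub>m E x))"
      using le[OF True] tpos by (intro psd_smult) (auto simp: loewner_le_def)
    also have "complex_of_real (t x) \<cdot>\<^sub>m (complex_of_real (2 powr \<eta>) \<cdot>\<^sub>m tensor_mat (1\<^sub>m dS) (\<sigma> x) - (1 / mat_trace (E x)) \<cdot>\<^sub>m E x)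
        = complex_of_real (2 powr \<eta> * t x) \<cdot>\<^sub>m tensor_mat (1\<^sub>m dS) (\<sigma> x) - E x"
      unfolding tr[OF x] using c tpos by (intro eq_matI) (auto simp: right_diff_distrib)
    also have "complex_of_real (2 powr \<eta> * t x) \<cdot>\<^sub>m tensor_mat (1\<^sub>m dS) (\<sigma> x) = tensor_mat (1\<^sub>m dS) (s x)"
      unfolding s_def using True \<sigma>p by (simp add: tensor_mat_smult_right[of _ dS _ dA])
    finally show ?thesis unfolding s_def using True \<sigma>p tpos psd_smult[OF \<sigma>p, of "2 powr \<eta> * t x"] by simp
  next
    case False
    then have "E x = 0\<^sub>m (dS * dA) (dS * dA)"
      using x E[OF x] by (intro psd_trace_zero) (auto simp: Out'_def)
    moreover have "tensor_mat (1\<^sub>m dS) (0\<^sub>m dA dA) = 0\<^sub>m (dS * dA) (dS * dA)"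
      by (intro eq_matI) (auto simp: tensor_mat_def div_mod_less_mult)
    moreover have "0\<^sub>m (dS * dA) (dS * dA) - 0\<^sub>m (dS * dA) (dS * dA) = (0\<^sub>m (dS * dA) (dS * dA) :: complex mat)"
      by (intro eq_matI) auto
    ultimately show ?thesis using False by (simp only: s_def if_False psd_zero simp_thms)
  qed
  moreover have "finite_mat_sum dA s Out = complex_of_real (2 powr \<eta> * real dS) \<cdot>\<^sub>m 1\<^sub>m dA"
  proof (rule eq_matI)
    fix i j assume "i < dim_row (complex_of_real (2 powr \<eta> * real dS) \<cdot>\<^sub>m 1\<^sub>m dA)"
      "j < dim_col (complex_of_real (2 powr \<eta> * real dS) \<cdot>\<^sub>m 1\<^sub>m dA)"
    then have ij: "i < dA" "j < dA" by auto
    have \<sigma>c: "\<sigma> x \<in> carrier_mat dA dA" if "x \<in> Out'" for x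
      using \<sigma>[OF that] by (simp add: density_operator_def)
    have "finite_mat_sum dA s Out $$ (i, j) = (\<Sum>x\<in>Out'. s x $$ (i, j))"
      unfolding finite_mat_sum_index[OF ij] using fin ij
      by (intro sum.mono_neutral_right) (auto simp: s_def Out'_def)
    also have "\<dots> = complex_of_real (2 powr \<eta>) * (\<Sum>x\<in>Out'. (mat_trace (E x) \<cdot>\<^sub>m \<sigma> x) $$ (i, j))"
      unfolding sum_distrib_left
    proof (intro sum.cong refl)
      fix x assume x: "x \<in> Out'"
      then have "x \<in> Out" by (simp add: Out'_def)
      then show "s x $$ (i, j) = complex_of_real (2 powr \<eta>) * (mat_trace (E x) \<cdot>\<^sub>m \<sigma> x) $$ (i, j)"
        using x \<sigma>c[OF x] ij by (simp add: s_def tr)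
    qed
    also have "(\<Sum>x\<in>Out'. (mat_trace (E x) \<cdot>\<^sub>m \<sigma> x) $$ (i, j)) = (of_nat dS \<cdot>\<^sub>m 1\<^sub>m dA) $$ (i, j)"
      unfolding sum[symmetric] finite_mat_sum_index[OF ij] ..
    finally show "finite_mat_sum dA s Out $$ (i, j) = (complex_of_real (2 powr \<eta> * real dS) \<cdot>\<^sub>m 1\<^sub>m dA) $$ (i, j)"
      using ij by simp
  qed (auto simp: finite_mat_sum_def)
  ultimately show ?thesis by blast
qed

section \<open>Composition of linear maps and tests\<close>

lemma linear_map_compose:
  "linear_map d e \<Phi> \<Longrightarrow> linear_map e f \<Psi> \<Longrightarrow> linear_map d f (\<lambda>X. \<Psi> (\<Phi> X))"
  unfolding linear_map_def by simp

lemma linear_map_partial_trace_times: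
  assumes M: "M \<in> carrier_mat (a * b) (a * b)"
  shows "linear_map (a * b) b (\<lambda>X. partial_trace_fst a b (M * X))"
  unfolding linear_map_def
proof (intro conjI ballI allI)
  fix X Y :: "complex mat" and c assume X: "X \<in> carrier_mat (a * b) (a * b)"
  show "partial_trace_fst a b (M * X) \<in> carrier_mat b b" by (simp add: partial_trace_fst_def)
  note MX = mult_carrier_mat[OF M X]
  show "partial_trace_fst a b (M * (c \<cdot>\<^sub>m X)) = c \<cdot>\<^sub>m partial_trace_fst a b (M * X)"
    unfolding mult_smult_distrib[OF M X]
    by (rule eq_matI) (use MX in \<open>auto simp: partial_trace_fst_def mult_add_less sum_distrib_left simp del: index_mult_mat\<close>)
  assume Y: "Y \<in> carrier_mat (a * b) (a * b)"
  note MY = mult_carrier_mat[OF M Y]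
  show "partial_trace_fst a b (M * (X + Y)) = partial_trace_fst a b (M * X) + partial_trace_fst a b (M * Y)"
    unfolding mult_add_distrib_mat[OF M X Y]
    by (rule eq_matI) (use MX MY in \<open>auto simp: partial_trace_fst_def mult_add_less sum.distrib simp del: index_mult_mat\<close>)
qed

lemma linear_map_pauli_channel:
  assumes L: "linear_map (2 ^ n * k) e L" and X: "X \<in> carrier_mat (2 ^ n * k) (2 ^ n * k)"
  shows "L (map_tensor_id (2 ^ n) (2 ^ n) k (pauli_channel n p) X) =
    finite_mat_sum e (\<lambda>Q. complex_of_real (p Q) \<cdot>\<^sub>m L (pauli_conj k Q X)) (pauli_strings n)"
proof -
  have "L (map_tensor_id (2 ^ n) (2 ^ n) k (pauli_channel n p) X) =
      finite_mat_sum e (\<lambda>Q. L (complex_of_real (p Q) \<cdot>\<^sub>m pauli_conj k Q X)) (pauli_strings n)"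
    unfolding map_tensor_id_pauli_channel[OF X]
    by (rule linear_map_finite_mat_sum[OF L]) (auto intro!: smult_carrier_mat pauli_conj_carrier X)
  also have "\<dots> = finite_mat_sum e (\<lambda>Q. complex_of_real (p Q) \<cdot>\<^sub>m L (pauli_conj k Q X)) (pauli_strings n)"
    by (rule finite_mat_sum_cong) (rule linear_mapD(3)[OF L pauli_conj_carrier[OF _ X]])
  finally show ?thesis .
qed

lemma mat_trace_pauli_channel:
  assumes A: "A \<in> carrier_mat (2 ^ n * k) (2 ^ n * k)" and X: "X \<in> carrier_mat (2 ^ n * k) (2 ^ n * k)"
  shows "mat_trace (A * map_tensor_id (2 ^ n) (2 ^ n) k (pauli_channel n p) X) =
    (\<Sum>Q\<in>pauli_strings n. complex_of_real (p Q) * mat_trace (A * pauli_conj k Q X))"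
proof -
  have c: "pauli_conj k Q X \<in> carrier_mat (2 ^ n * k) (2 ^ n * k)" if "Q \<in> pauli_strings n" for Q
    using that X by (rule pauli_conj_carrier)
  have "mat_trace (A * map_tensor_id (2 ^ n) (2 ^ n) k (pauli_channel n p) X) =
      (\<Sum>Q\<in>pauli_strings n. mat_trace (A * (complex_of_real (p Q) \<cdot>\<^sub>m pauli_conj k Q X)))"
    unfolding map_tensor_id_pauli_channel[OF X]
    by (rule mat_trace_times_finite_mat_sum[OF A]) (intro smult_carrier_mat c)
  also have "\<dots> = (\<Sum>Q\<in>pauli_strings n. complex_of_real (p Q) * mat_trace (A * pauli_conj k Q X))"
    by (intro sum.cong refl) (simp only: mult_smult_distrib[OF A c] mat_trace_smult[OF mult_carrier_mat[OF A c]])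
  finally show ?thesis .
qed

lemma finite_mat_sum_one_tensor:
  assumes "finite I" "\<And>x. x \<in> I \<Longrightarrow> psd k (s x)" "finite_mat_sum k s I = c \<cdot>\<^sub>m 1\<^sub>m k"
  shows "finite_mat_sum (d * k) (\<lambda>x. tensor_mat (1\<^sub>m d) (s x)) I = c \<cdot>\<^sub>m 1\<^sub>m (d * k)"
proof -
  have "finite_mat_sum (d * k) (\<lambda>x. tensor_mat (1\<^sub>m d) (s x)) I = tensor_mat (1\<^sub>m d) (finite_mat_sum k s I)"
    by (rule linear_map_finite_mat_sum[OF linear_map_tensor_right[OF one_carrier_mat], symmetric])
      (use assms in auto)
  then show ?thesis
    unfolding assms(3) by (simp add: tensor_mat_smult_right[of _ d _ k] tensor_mat_one)
qed

lemma sum_povm_trace: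
  assumes I: "finite I" and E: "povm d I E" and X: "X \<in> carrier_mat (d * b) (d * b)"
  shows "(\<Sum>x\<in>I. mat_trace (tensor_mat (E x) (1\<^sub>m b) * X)) = mat_trace X"
proof -
  have c: "E x \<in> carrier_mat d d" if "x \<in> I" for x using E that by (simp add: povm_def)
  have "(\<Sum>x\<in>I. mat_trace (tensor_mat (E x) (1\<^sub>m b) * X)) =
      mat_trace (finite_mat_sum (d * b) (\<lambda>x. tensor_mat (E x) (1\<^sub>m b)) I * X)"
    using X c by (intro mat_trace_finite_mat_sum_times[symmetric]) auto
  also have "finite_mat_sum (d * b) (\<lambda>x. tensor_mat (E x) (1\<^sub>m b)) I = 1\<^sub>m (d * b)"
    using E c linear_map_finite_mat_sum[OF linear_map_tensor_left[OF one_carrier_mat[of b], of d] I, of E]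
    by (simp add: povm_def tensor_mat_one)
  finally show ?thesis using X by simp
qed

lemma mat_trace_partial_trace:
  assumes "E \<in> carrier_mat a a" "X \<in> carrier_mat (a * b) (a * b)"
  shows "mat_trace (partial_trace_fst a b (tensor_mat E (1\<^sub>m b) * X)) = mat_trace (tensor_mat E (1\<^sub>m b) * X)"
proof -
  have "partial_trace_fst a b (tensor_mat E (1\<^sub>m b) * X) \<in> carrier_mat b b" by (simp add: partial_trace_fst_def)
  then show ?thesis
    using mat_trace_tensor_one_times_partial_trace[OF assms(1) one_carrier_mat assms(2)] by simp
qed

lemma mat_trace_partial_trace_times:
  assumes "E \<in> carrier_mat a a" "Z \<in> carrier_mat b b" "X \<in> carrier_mat (a * b) (a * b)"
  shows "mat_trace (partial_trace_fst a b (tensor_mat E (1\<^sub>m b) * X) * Z) = mat_trace (tensor_mat E Z * X)"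
proof -
  have "partial_trace_fst a b (tensor_mat E (1\<^sub>m b) * X) \<in> carrier_mat b b" by (simp add: partial_trace_fst_def)
  then show ?thesis
    using mat_trace_tensor_one_times_partial_trace[OF assms] assms(2) by (simp add: mat_trace_comm[of _ b Z])
qed

text \<open>The product of E \<otimes> 1 with X need not be Hermitian, but pairing its partial trace
  with a rank-one V gives the trace of (E \<otimes> V) X, which is real and nonnegative.\<close>

lemma psd_partial_trace:
  assumes E: "psd a E" and X: "psd (a * b) X"
  shows "psd b (partial_trace_fst a b (tensor_mat E (1\<^sub>m b) * X))"
proof (rule psd_if_rank_one_traces)
  show "partial_trace_fst a b (tensor_mat E (1\<^sub>m b) * X) \<in> carrier_mat b b" by (simp add: partial_trace_fst_def)
  fix v
  let ?V = "mat b b (\<lambda>(i, j). v i * cnj (v j))"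
  have V: "psd b ?V" by (rule psd_rank_one)
  note tr = mat_trace_partial_trace_times[OF psd_carrier[OF E] psd_carrier[OF V] psd_carrier[OF X]]
  show "Im (mat_trace (partial_trace_fst a b (tensor_mat E (1\<^sub>m b) * X) * ?V)) = 0"
    "0 \<le> Re (mat_trace (partial_trace_fst a b (tensor_mat E (1\<^sub>m b) * X) * ?V))"
    unfolding tr using psd_trace_times[OF psd_tensor[OF E V] X] by simp_all
qed

section \<open>The three models\<close>

lemma incoherent_bound:
  assumes n: "1 \<le> n" and \<epsilon>: "0 < \<epsilon>" "\<epsilon> \<le> 1 / 3"
    and valid: "valid_incoherent n N \<pi>"
    and h: "incoherent_inputs_hmin_ge n N \<eta> \<pi> \<or> incoherent_povms_hmin_ge n N \<eta> \<pi>"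
    and learn: "solves_learning n \<epsilon> N (incoherent_prob n N) \<pi>"
  shows "1 / 500 * (1 / \<epsilon> ^ 2) * 2 powr (real n - \<eta>) \<le> real N"
proof -
  let ?E = "inc_povm \<pi>" and ?\<rho> = "inc_input \<pi>" and ?c = "complex_of_real (2 powr \<eta> * real (2 ^ n))"
  let ?O = "outcomes \<pi>"
  let ?H = "histories ?O" and ?Ps = "pauli_strings n"
  let ?k = "inc_anc_dim \<pi>"
  let ?d = "2 ^ n * ?k"
  \<comment> \<open>Common to both alternatives. Restricted inputs give 2 ^ n times the trace of the
    bound on the ancilla, with the factor 2 from the supremum; restricted measurements give half of
    \<open>K\<close>.\<close>
  define K where "K = 2 * 2 powr \<eta> * 2 ^ n"
  define g where "g h x Q = Re (mat_trace (?E h x * pauli_conj ?k Q (?\<rho> h)))" for h x Q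
  note v = valid[unfolded valid_incoherent_def, rule_format]
  have fin: "finite (?O h)" if "l < N" "h \<in> ?H l" for l h
    using v[OF that] by simp
  have \<rho>: "psd ?d (?\<rho> h)" "mat_trace (?\<rho> h) = 1" if "l < N" "h \<in> ?H l" for l h
    using v[OF that] by (auto simp: density_operator_def)
  have E: "psd ?d (?E h x)" if "l < N" "h \<in> ?H l" "x \<in> ?O h" for l h x
    using v[OF that(1,2)] that(3) by (auto simp: povm_def)
  have sumE: "finite_mat_sum ?d (?E h) (?O h) = 1\<^sub>m ?d" if "l < N" "h \<in> ?H l" for l h
    using v[OF that] by (auto simp: povm_def)
  have "4 ^ n / 24 \<le> 2 * (9 / 4 * \<epsilon>)\<^sup>2 * real N * K"
  proof (rule incoherent_learning_bound[where g = g and K = K, OF n \<epsilon> fin _ _ _ learn])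
    fix l h assume l: "l < N" and hh: "h \<in> ?H l"
    note \<rho>' = \<rho>[OF l hh] and E' = E[OF l hh]
    note \<rho>c = psd_carrier[OF \<rho>'(1)]
    show "0 \<le> g h x Q" if "x \<in> ?O h" "Q \<in> ?Ps" for x Q
      unfolding g_def using that by (intro psd_trace_times(1)[of ?d] E' psd_pauli_conj \<rho>')
    have total: "(\<Sum>x\<in>?O h. mat_trace (?E h x * Y)) = mat_trace Y" if Y: "Y \<in> carrier_mat ?d ?d" for Y
    proof -
      have "(\<Sum>x\<in>?O h. mat_trace (?E h x * Y)) =
          mat_trace (finite_mat_sum ?d (?E h) (?O h) * Y)"
        using Y E' by (intro mat_trace_finite_mat_sum_times[symmetric]) auto
      then show ?thesis using Y by (simp add: sumE[OF l hh])
    qed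
    show "(\<Sum>x\<in>?O h. g h x Q) = 1" if "Q \<in> ?Ps" for Q
      unfolding g_def Re_sum[symmetric] total[OF pauli_conj_carrier[OF that \<rho>c]]
      using \<rho>'(2) by (simp add: mat_trace_pauli_conj[OF that \<rho>c])
    show "\<exists>b. (\<forall>x\<in>?O h. \<forall>Q\<in>?Ps. g h x Q \<le> b x) \<and> (\<Sum>x\<in>?O h. b x) \<le> K"
      using h
    proof
      assume "incoherent_inputs_hmin_ge n N \<eta> \<pi>"
      then have "ereal (- \<eta>) \<le> hmin (2 ^ n) ?k (?\<rho> h)"
        using l hh by (simp add: incoherent_inputs_hmin_ge_def)
      then obtain s where s: "psd ?k s" "psd ?d (tensor_mat (1\<^sub>m (2 ^ n)) s - ?\<rho> h)"
        "Re (mat_trace s) \<le> 2 * 2 powr \<eta>" using hmin_ge_operator_bound by blast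
      let ?S = "tensor_mat (1\<^sub>m (2 ^ n)) s"
      have Sc: "?S \<in> carrier_mat ?d ?d" using s by simp
      have "g h x Q \<le> Re (mat_trace (?E h x * ?S))" if x: "x \<in> ?O h" and Q: "Q \<in> ?Ps" for x Q
      proof -
        have "psd ?d (?S - pauli_conj ?k Q (?\<rho> h))"
          by (rule psd_one_tensor_minus_pauli_conj[OF Q psd_carrier[OF s(1)] \<rho>c s(2)])
        from psd_trace_mono[OF this E'[OF x] Sc pauli_conj_carrier[OF Q \<rho>c]] show ?thesis
          unfolding g_def using Sc pauli_conj_carrier[OF Q \<rho>c] psd_carrier[OF E'[OF x]]
          by (simp add: mat_trace_comm[of "?E h x" ?d])
      qed
      moreover have "(\<Sum>x\<in>?O h. Re (mat_trace (?E h x * ?S))) \<le> K"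
      proof -
        have "(\<Sum>x\<in>?O h. Re (mat_trace (?E h x * ?S))) = 2 ^ n * Re (mat_trace s)"
          unfolding Re_sum[symmetric] total[OF Sc] using mat_trace_tensor[OF one_carrier_mat psd_carrier[OF s(1)], of "2 ^ n"] by simp
        also have "\<dots> \<le> 2 ^ n * (2 * 2 powr \<eta>)" using s(3) by (intro mult_left_mono) auto
        also have "\<dots> = K" by (simp add: K_def)
        finally show ?thesis .
      qed
      ultimately show ?thesis by (intro exI[of _ "\<lambda>x. Re (mat_trace (?E h x * ?S))"]) auto
    next
      assume "incoherent_povms_hmin_ge n N \<eta> \<pi>"
      then have ph: "povm_hmin_ge (2 ^ n) ?k (?O h) (?E h) \<eta>"
        using l hh by (simp add: incoherent_povms_hmin_ge_def)
      obtain s where s: "\<And>x. x \<in> ?O h \<Longrightarrow> psd ?k (s x)"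
          "\<And>x. x \<in> ?O h \<Longrightarrow> psd ?d (tensor_mat (1\<^sub>m (2 ^ n)) (s x) - ?E h x)"
        and sum: "finite_mat_sum ?k s (?O h) = ?c \<cdot>\<^sub>m 1\<^sub>m ?k"
        using povm_hmin_ge_operator_bound[where E = "?E h", OF E' fin[OF l hh] ph] by blast
      let ?S = "\<lambda>x. tensor_mat (1\<^sub>m (2 ^ n)) (s x)"
      have Sc: "?S x \<in> carrier_mat ?d ?d" if "x \<in> ?O h" for x using s that by simp
      have "g h x Q \<le> Re (mat_trace (?S x * ?\<rho> h))" if x: "x \<in> ?O h" and Q: "Q \<in> ?Ps" for x Q
      proof -
        note Ec = psd_carrier[OF E'[OF x]]
        have "psd ?d (?S x - pauli_conj ?k Q (?E h x))"
          by (rule psd_one_tensor_minus_pauli_conj[OF Q psd_carrier[OF s(1)[OF x]] Ec s(2)[OF x]])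
        from psd_trace_mono[OF this \<rho>'(1) Sc[OF x] pauli_conj_carrier[OF Q Ec]] show ?thesis
          unfolding g_def mat_trace_times_pauli_conj[OF Q Ec \<rho>c] .
      qed
      moreover have "(\<Sum>x\<in>?O h. Re (mat_trace (?S x * ?\<rho> h))) \<le> K"
      proof -
        have "(\<Sum>x\<in>?O h. mat_trace (?S x * ?\<rho> h)) =
            mat_trace (finite_mat_sum ?d ?S (?O h) * ?\<rho> h)"
          using \<rho>c Sc by (intro mat_trace_finite_mat_sum_times[symmetric]) auto
        also have "finite_mat_sum ?d ?S (?O h) = ?c \<cdot>\<^sub>m 1\<^sub>m ?d"
          by (rule finite_mat_sum_one_tensor[OF fin[OF l hh] s(1) sum])
        also have "mat_trace (?c \<cdot>\<^sub>m 1\<^sub>m ?d * ?\<rho> h) = ?c"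
          using \<rho>c \<rho>'(2) mult_smult_assoc_mat[OF one_carrier_mat \<rho>c] mat_trace_smult[OF \<rho>c] by simp
        finally have "(\<Sum>x\<in>?O h. Re (mat_trace (?S x * ?\<rho> h))) = 2 powr \<eta> * 2 ^ n"
          unfolding Re_sum[symmetric] by simp
        then show ?thesis by (simp add: K_def)
      qed
      ultimately show ?thesis by (intro exI[of _ "\<lambda>x. Re (mat_trace (?S x * ?\<rho> h))"]) auto
    qed
  next
    fix p :: "pauli list \<Rightarrow> real" and h assume hh: "h \<in> ?H N"
    show "incoherent_prob n N \<pi> (pauli_channel n p) h = record_weight n g p h"
      unfolding incoherent_prob_def record_weight_def length_histories[OF hh]
    proof (intro prod.cong refl)
      fix l assume "l \<in> {..<N}"
      then have l: "l < N" by simp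
      note th = take_histories[OF hh less_imp_le[OF l]] and nh = nth_histories[OF hh l]
      show "Re (mat_trace (?E (take l h) (h ! l) *
          map_tensor_id (2 ^ n) (2 ^ n) ?k (pauli_channel n p) (?\<rho> (take l h)))) =
          (\<Sum>Q\<in>?Ps. p Q * g (take l h) (h ! l) Q)"
        unfolding mat_trace_pauli_channel[OF psd_carrier[OF E[OF l th nh]] psd_carrier[OF \<rho>(1)[OF l th]]]
        by (simp add: g_def Re_sum)
    qed
  qed
  then have "2 ^ n * (2 ^ n / 24) \<le> 2 ^ n * (81 / 4 * \<epsilon>\<^sup>2 * real N * 2 powr \<eta>)"
    by (simp add: K_def four_power power2_eq_square algebra_simps)
  then have "2 ^ n / 24 \<le> 81 / 4 * \<epsilon>\<^sup>2 * real N * 2 powr \<eta>" by (subst (asm) mult_le_cancel_left_pos) auto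
  then have "2 ^ n \<le> 500 * \<epsilon>\<^sup>2 * real N * 2 powr \<eta>"
  proof -
    have "0 \<le> \<epsilon>\<^sup>2 * real N * 2 powr \<eta>" by simp
    with \<open>2 ^ n / 24 \<le> _\<close> show ?thesis by linarith
  qed
  then have "2 ^ n / 2 powr \<eta> \<le> 500 * \<epsilon>\<^sup>2 * real N" by (simp add: pos_divide_le_eq)
  then show ?thesis using \<epsilon> by (simp add: powr_diff powr_realpow field_simps)
qed

section \<open>The two coherent models\<close>

lemma coherent_arithmetic:
  fixes \<epsilon> \<eta> :: real
  assumes \<epsilon>: "0 < \<epsilon>" and le: "4 ^ n / 4 \<le> real N * (9 / 4 * \<epsilon>) * 2 ^ n * sqrt (2 * 2 powr \<eta> * 2 ^ n)"
  shows "1 / 500 * (1 / \<epsilon>) * 2 powr ((real n - \<eta>) / 2) \<le> real N"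
proof -
  define r q where "r = sqrt (2 ^ n :: real)" and "q = sqrt (2 powr \<eta>)"
  have rq: "0 < r" "0 < q" by (auto simp: r_def q_def)
  have r2: "(2 :: real) ^ n = r * r" by (simp add: r_def)
  have "sqrt (2 * 2 powr \<eta> * 2 ^ n) = sqrt 2 * (q * r)" by (simp add: r_def q_def real_sqrt_mult)
  also have "\<dots> \<le> 2 * (q * r)" using rq by (intro mult_right_mono) (auto intro: real_le_lsqrt)
  finally have "real N * (9 / 4 * \<epsilon>) * 2 ^ n * sqrt (2 * 2 powr \<eta> * 2 ^ n) \<le> real N * (9 / 4 * \<epsilon>) * 2 ^ n * (2 * (q * r))"
    using \<epsilon> by (intro mult_left_mono) auto
  with le have "(r * r * r) * (r / 4) \<le> (r * r * r) * (9 / 2 * real N * \<epsilon> * q)"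
    by (simp add: four_power r2 power2_eq_square algebra_simps)
  then have "r / 4 \<le> 9 / 2 * real N * \<epsilon> * q" using rq by (subst (asm) mult_le_cancel_left_pos) auto
  moreover have "0 \<le> real N * \<epsilon> * q" using rq \<epsilon> by simp
  \<comment> \<open>The estimate gives 18 here; 500 is the constant shared with the incoherent
    bound.\<close>
  ultimately have "r \<le> 500 * real N * \<epsilon> * q" by simp
  moreover have "2 powr ((real n - \<eta>) / 2) = r / q"
  proof -
    have "r / q = (2 powr real n) powr (1 / 2) / (2 powr \<eta>) powr (1 / 2)"
      by (simp add: r_def q_def powr_half_sqrt powr_realpow)
    also have "\<dots> = 2 powr (real n / 2 - \<eta> / 2)" by (simp add: powr_powr powr_diff)
    finally show ?thesis by (simp add: diff_divide_distrib)
  qed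
  ultimately have "2 powr ((real n - \<eta>) / 2) \<le> 500 * real N * \<epsilon>" using rq by (simp add: pos_divide_le_eq)
  then show ?thesis using \<epsilon> by (simp add: field_simps)
qed

lemma input_restricted_bound:
  assumes n: "1 \<le> n" and \<epsilon>: "0 < \<epsilon>" "\<epsilon> \<le> 1 / 3"
    and valid: "valid_input_restricted n N \<pi>"
    and hm: "input_restricted_hmin_ge n N \<eta> \<pi>"
    and learn: "solves_learning n \<epsilon> N (input_restricted_prob n N) \<pi>"
  shows "1 / 500 * (1 / \<epsilon>) * 2 powr ((real n - \<eta>) / 2) \<le> real N"
proof -
  let ?J = "ir_instrument \<pi>" and ?\<rho> = "ir_input \<pi>"
  let ?O = "outcomes \<pi>"
  let ?H = "histories ?O" and ?Ps = "pauli_strings n"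
  let ?D = "ir_mem_dim \<pi>" and ?k = "ir_anc_dim \<pi>"
  let ?d = "\<lambda>l. 2 ^ n * ?k l"
  note v = valid[unfolded valid_input_restricted_def]
  have v': "finite (?O h) \<and> density_operator (?d l) (?\<rho> h) \<and>
      instrument (?D l * ?d l) (?D (Suc l)) (?O h) (?J h)"
    if "l < N" "h \<in> ?H l" for l h
    using v that by blast
  have \<rho>: "psd (?d l) (?\<rho> h)" "mat_trace (?\<rho> h) = 1" if "l < N" "h \<in> ?H l" for l h
    using v'[OF that] by (auto simp: density_operator_def)
  have J: "completely_positive (?D l * ?d l) (?D (Suc l)) (?J h x)"
    if "l < N" "h \<in> ?H l" "x \<in> ?O h" for l h x
    using v'[OF that(1,2)] that(3) unfolding instrument_def by blast
  have Jlin: "linear_map (?D l * ?d l) (?D (Suc l)) (?J h x)"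
    if "l < N" "h \<in> ?H l" "x \<in> ?O h" for l h x
    using J[OF that] by (simp add: completely_positive_def)
  have Jtr: "(\<Sum>x\<in>?O h. mat_trace (?J h x X)) = mat_trace X"
    if "l < N" "h \<in> ?H l" "X \<in> carrier_mat (?D l * ?d l) (?D l * ?d l)" for l h X
    using v'[OF that(1,2)] that(3) unfolding instrument_def by blast
  define T where "T Q h x X = ?J h x (tensor_mat X (pauli_conj (?k (length h)) Q (?\<rho> h)))" for Q h x X
  have T_eq: "T Q h x X = ?J h x (tensor_mat X (pauli_conj (?k l) Q (?\<rho> h)))"
    if "length h = l" for l Q h x X using that by (simp add: T_def)
  interpret pauli_process n N "?O" ?D T "1\<^sub>m 1"
  proof
    fix l h assume l: "l < N" and h: "h \<in> ?H l"
    note \<rho>c = psd_carrier[OF \<rho>(1)[OF l h]]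
    show "finite (?O h)" using v'[OF l h] by simp
    fix x Q assume Q: "Q \<in> ?Ps"
    note cc = pauli_conj_carrier[OF Q \<rho>c]
    show "linear_map (?D l) (?D (Suc l)) (T Q h x)" if "x \<in> ?O h"
      using linear_map_compose[OF linear_map_tensor_left[OF cc, of "?D l"] Jlin[OF l h that]]
      unfolding T_def length_histories[OF h] .
    fix X assume X: "psd (?D l) X"
    show "psd (?D (Suc l)) (T Q h x X)" if "x \<in> ?O h"
      unfolding T_def length_histories[OF h]
      by (intro completely_positive_psd[OF J[OF l h that]] psd_tensor X psd_pauli_conj Q \<rho> l h)
    show "(\<Sum>x\<in>?O h. mat_trace (T Q h x X)) = mat_trace X"
      unfolding T_def length_histories[OF h]
      using Jtr[OF l h tensor_mat_carrier[OF psd_carrier[OF X] cc]] mat_trace_tensor[OF psd_carrier[OF X] cc]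
        mat_trace_pauli_conj[OF Q \<rho>c] \<rho>(2)[OF l h] by simp
  next
    show "density_operator (?D 0) (1\<^sub>m 1)" using v by (simp add: density_operator_def psd_one)
  qed
  have mem: "l \<le> N \<Longrightarrow> ir_memory n \<pi> (pauli_channel n p) h l = state p h l"
    if p: "pauli_distribution n p" and h: "h \<in> ?H N" for p h l
  proof (induction l)
    case (Suc l)
    then have l: "l < N" by simp
    note th = take_histories[OF h less_imp_le[OF l]] and nh = nth_histories[OF h l]
    have st: "psd (?D l) (state p h l)" using psd_state[OF p h order.refl] l by simp
    show ?case
      using Suc.IH l
        linear_map_pauli_channel[OF linear_map_compose[OF linear_map_tensor_right[OF psd_carrier[OF st], of "?d l"]
          Jlin[OF l th nh]] psd_carrier[OF \<rho>(1)[OF l th]], of p]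
      by (simp add: step_def T_eq[OF length_histories[OF th]] length_histories[OF h] min_absorb2 del: One_nat_def)
  qed (simp del: One_nat_def)
  have "4 ^ n / 4 \<le> real N * (9 / 4 * \<epsilon>) * 2 ^ n * sqrt (2 * 2 powr \<eta> * 2 ^ n)"
  proof (rule coherent_learning_bound[OF n \<epsilon> _ learn refl])
    show "(0 :: real) \<le> 2 * 2 powr \<eta> * 2 ^ n" by simp
    show "input_restricted_prob n N \<pi> (pauli_channel n p) h = Re (mat_trace (state p h N))"
      if "pauli_distribution n p" "h \<in> ?H N" for p h
      using mem[OF that order.refl] by (simp add: input_restricted_prob_def)
  next
    fix l h X f assume l: "l < N" and h: "h \<in> ?H l" and X: "psd (?D l) X"
      and f: "\<And>P x. P \<in> ?Ps \<Longrightarrow> x \<in> ?O h \<Longrightarrow> test_functional (?D (Suc l)) (f P x)"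
    let ?e = "?D l * ?d l"
    note \<rho>' = \<rho>[OF l h]
    note \<rho>c = psd_carrier[OF \<rho>'(1)] and Xc = psd_carrier[OF X]
    have "ereal (- \<eta>) \<le> hmin (2 ^ n) (?k l) (?\<rho> h)"
      using hm l h by (simp add: input_restricted_hmin_ge_def)
    then obtain s where s: "psd (?k l) s" "psd (?d l) (tensor_mat (1\<^sub>m (2 ^ n)) s - ?\<rho> h)"
      "Re (mat_trace s) \<le> 2 * 2 powr \<eta>" using hmin_ge_operator_bound by blast
    let ?S = "tensor_mat (1\<^sub>m (2 ^ n)) s"
    have Sc: "?S \<in> carrier_mat (?d l) (?d l)" using s by simp
    \<comment> \<open>The instrument and all later tests fuse into one effect on memory, system and
      ancilla. The string \<open>Q\<close> then occurs in the fresh input alone, where the entropy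
      bound applies.\<close>
    have "\<exists>Z. effect ?e Z \<and> (\<forall>Y \<in> carrier_mat ?e ?e. (\<Sum>x\<in>?O h. f P x (?J h x Y)) = mat_trace (Z * Y))"
      if P: "P \<in> ?Ps" for P
      by (rule test_functional_effect, rule test_functional_sum[OF f[OF P] Jlin[OF l h]])
        (auto intro: completely_positive_psd[OF J[OF l h]] Jtr[OF l h])
    then have "\<forall>P\<in>?Ps. \<exists>Z. effect ?e Z \<and> (\<forall>Y \<in> carrier_mat ?e ?e.
        (\<Sum>x\<in>?O h. f P x (?J h x Y)) = mat_trace (Z * Y))" by blast
    from bchoice[OF this] obtain Z where Z: "\<And>P. P \<in> ?Ps \<Longrightarrow> effect ?e (Z P)"
      and fZ: "\<And>P Y. P \<in> ?Ps \<Longrightarrow> Y \<in> carrier_mat ?e ?e \<Longrightarrow>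
        (\<Sum>x\<in>?O h. f P x (?J h x Y)) = mat_trace (Z P * Y)"
      by blast
    define R where "R Q = tensor_mat X (pauli_conj (?k l) Q (?\<rho> h))" for Q
    have Rp: "psd ?e (R Q)" if "Q \<in> ?Ps" for Q
      unfolding R_def by (intro psd_tensor X psd_pauli_conj that \<rho>')
    have "(\<Sum>P\<in>?Ps. (1 / 4 ^ n * (\<Sum>Q\<in>?Ps. pauli_sign P Q *
        (\<Sum>x\<in>{()}. Re (mat_trace (Z P * R Q)))))\<^sup>2) \<le> (2 * 2 powr \<eta> * 2 ^ n) * (Re (mat_trace X))\<^sup>2"
    \<comment> \<open>A single outcome index suffices, since the sum over outcomes is already inside
      \<open>Z P\<close>. The memory is uncorrelated with the fresh input, so tensoring with
      \<open>X\<close> preserves the domination by 1 \<otimes> s.\<close>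
    proof (rule pauli_test_bound[where d = ?e and R = "\<lambda>_. R" and S = "\<lambda>_. tensor_mat X ?S" and Z = "\<lambda>P _. Z P"])
      show "psd ?e (R Q)" if "Q \<in> ?Ps" for Q by (rule Rp[OF that])
      have "psd (?d l) ?S" by (intro psd_tensor psd_one s)
      then show "psd ?e (tensor_mat X ?S)" by (rule psd_tensor[OF X])
      show "psd ?e (tensor_mat X ?S - R Q)" if Q: "Q \<in> ?Ps" for Q
      proof -
        have "psd (?d l) (?S - pauli_conj (?k l) Q (?\<rho> h))"
          by (rule psd_one_tensor_minus_pauli_conj[OF Q psd_carrier[OF s(1)] \<rho>c s(2)])
        then show ?thesis
          unfolding R_def tensor_mat_minus_right[OF Xc Sc pauli_conj_carrier[OF Q \<rho>c], symmetric] by (intro psd_tensor X)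
      qed
      have trR: "mat_trace (R Q) = mat_trace X" if "Q \<in> ?Ps" for Q
        unfolding R_def mat_trace_tensor[OF Xc pauli_conj_carrier[OF that \<rho>c]] mat_trace_pauli_conj[OF that \<rho>c] by (simp add: \<rho>')
      show "(\<Sum>x\<in>{()}. \<Sum>Q\<in>?Ps. Re (mat_trace (R Q))) \<le> 4 ^ n * Re (mat_trace X)"
        by (simp add: trR)
      have "mat_trace (tensor_mat X ?S) = mat_trace X * (2 ^ n * mat_trace s)"
        using mat_trace_tensor[OF Xc Sc] mat_trace_tensor[OF one_carrier_mat psd_carrier[OF s(1)], of "2 ^ n"] by simp
      moreover obtain r :: real where r: "(2 :: complex) ^ n = complex_of_real r" "r = 2 ^ n" by simp
      ultimately have "Re (mat_trace (tensor_mat X ?S)) = Re (mat_trace X) * (r * Re (mat_trace s))"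
        using psd_trace(2)[OF X] psd_trace(2)[OF s(1)] unfolding r(1) by simp
      also have "\<dots> \<le> Re (mat_trace X) * (2 ^ n * (2 * 2 powr \<eta>))"
        unfolding r(2) using s(3) psd_trace(1)[OF X] by (intro mult_left_mono) auto
      finally show "(\<Sum>x\<in>{()}. Re (mat_trace (tensor_mat X ?S))) \<le> 2 * 2 powr \<eta> * 2 ^ n * Re (mat_trace X)"
        by (simp add: ac_simps)
    qed (use Z psd_trace(1)[OF X] in auto)
    moreover have "Re (mat_trace (Z P * R Q)) = (\<Sum>x\<in>?O h. Re (f P x (T Q h x X)))"
      if "P \<in> ?Ps" "Q \<in> ?Ps" for P Q
      using fZ[OF that(1) psd_carrier[OF Rp[OF that(2)]]]
      by (simp add: R_def T_def length_histories[OF h] flip: Re_sum)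
    ultimately show "(\<Sum>P\<in>?Ps. (1 / 4 ^ n * (\<Sum>Q\<in>?Ps. pauli_sign P Q *
        (\<Sum>x\<in>?O h. Re (f P x (T Q h x X)))))\<^sup>2) \<le> (2 * 2 powr \<eta> * 2 ^ n) * (Re (mat_trace X))\<^sup>2"
      by simp
  qed
  then show ?thesis by (rule coherent_arithmetic[OF \<epsilon>(1)])
qed

lemma measurement_restricted_bound:
  assumes n: "1 \<le> n" and \<epsilon>: "0 < \<epsilon>" "\<epsilon> \<le> 1 / 3"
    and valid: "valid_measurement_restricted n N \<pi>"
    and hm: "measurement_restricted_hmin_ge n N \<eta> \<pi>"
    and learn: "solves_learning n \<epsilon> N (measurement_restricted_prob n N) \<pi>"
  shows "1 / 500 * (1 / \<epsilon>) * 2 powr ((real n - \<eta>) / 2) \<le> real N"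
proof -
  let ?M = "mr_map \<pi>" and ?c = "complex_of_real (2 powr \<eta> * real (2 ^ n))"
  let ?O = "outcomes \<pi>"
  let ?H = "histories ?O" and ?Ps = "pauli_strings n"
  let ?D = "mr_rest_dim n N \<pi>" and ?k = "mr_anc_dim \<pi>"
  let ?d = "\<lambda>l. 2 ^ n * ?k l"
  note v = valid[unfolded valid_measurement_restricted_def]
  have D: "?D l = ?d l * ?D (Suc l)" if "l < N" for l
    using that by (simp add: mr_rest_dim_def prod.atLeast_Suc_lessThan)
  \<comment> \<open>The bracketing in which the channel sees the qubits of round \<open>l\<close> as
    first factor and all else, later rounds included, as ancilla. \<open>D\<close> instead splits
    off what is measured.\<close>
  have D': "?D l = 2 ^ n * (?k l * ?D (Suc l))" if "l < N" for l
    using D[OF that] by (simp add: mult.assoc)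
  have fin: "finite (?O h)" and E: "povm (?d l) (?O h) (mr_povm \<pi> h)"
    if "l < N" "h \<in> ?H l" for l h
    using v that by blast+
  have Ep: "psd (?d l) (mr_povm \<pi> h x)" if "l < N" "h \<in> ?H l" "x \<in> ?O h" for l h x
    using E[OF that(1,2)] that(3) by (simp add: povm_def)
  have M: "completely_positive (?D (Suc l)) (?D (Suc l)) (?M (h @ [x]))"
      "\<And>X. X \<in> carrier_mat (?D (Suc l)) (?D (Suc l)) \<Longrightarrow> mat_trace (?M (h @ [x]) X) = mat_trace X"
    if "l < N" "h \<in> ?H l" "x \<in> ?O h" for l h x
    using v that histories_append[OF that(2,3)] unfolding cptp_def by blast+
  have Mlin: "linear_map (?D (Suc l)) (?D (Suc l)) (?M (h @ [x]))"
    if "l < N" "h \<in> ?H l" "x \<in> ?O h" for l h x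
    using M(1)[OF that] by (simp add: completely_positive_def)
  define pt where "pt l h x Y = partial_trace_fst (?d l) (?D (Suc l)) (tensor_mat (mr_povm \<pi> h x) (1\<^sub>m (?D (Suc l))) * Y)" for l h x Y
  define cj where "cj l Q X = pauli_conj (?k l * ?D (Suc l)) Q X" for l Q X
  define T where "T Q h x X = ?M (h @ [x]) (pt (length h) h x (cj (length h) Q X))" for Q h x X
  have ptlin: "linear_map (?D l) (?D (Suc l)) (pt l h x)" if "l < N" "h \<in> ?H l" "x \<in> ?O h" for l h x
    unfolding pt_def D[OF that(1)] using psd_carrier[OF Ep[OF that]]
    by (intro linear_map_partial_trace_times tensor_mat_carrier) auto
  have ptpsd: "psd (?D (Suc l)) (pt l h x Y)" if "l < N" "h \<in> ?H l" "x \<in> ?O h" "psd (?D l) Y" for l h x Y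
    unfolding pt_def using that(4) unfolding D[OF that(1)] by (intro psd_partial_trace Ep[OF that(1-3)])
  have pttr: "(\<Sum>x\<in>?O h. mat_trace (pt l h x Y)) = mat_trace Y"
    if "l < N" "h \<in> ?H l" "Y \<in> carrier_mat (?D l) (?D l)" for l h Y
  proof -
    have Y: "Y \<in> carrier_mat (?d l * ?D (Suc l)) (?d l * ?D (Suc l))" using that(3) D[OF that(1)] by simp
    show ?thesis unfolding pt_def
      using mat_trace_partial_trace[OF psd_carrier[OF Ep[OF that(1,2)]] Y] sum_povm_trace[OF fin[OF that(1,2)] E[OF that(1,2)] Y] by simp
  qed
  have cjlin: "linear_map (?D l) (?D l) (cj l Q)" if "l < N" "Q \<in> ?Ps" for l Q
    unfolding cj_def D'[OF that(1)] by (rule linear_map_pauli_conj[OF that(2)])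
  have cjpsd: "psd (?D l) (cj l Q X)" if "l < N" "Q \<in> ?Ps" "psd (?D l) X" for l Q X
    using that(3) unfolding cj_def D'[OF that(1)] by (rule psd_pauli_conj[OF that(2)])
  have cjtr: "mat_trace (cj l Q X) = mat_trace X" if "l < N" "Q \<in> ?Ps" "X \<in> carrier_mat (?D l) (?D l)" for l Q X
    using that(3) unfolding cj_def D'[OF that(1)] by (rule mat_trace_pauli_conj[OF that(2)])
  have T_eq: "T Q h x X = ?M (h @ [x]) (pt l h x (cj l Q X))"
    if "length h = l" for l Q h x X using that by (simp add: T_def)
  interpret pauli_process n N "?O" ?D T "mr_initial \<pi>"
  proof
    fix l h assume l: "l < N" and h: "h \<in> ?H l"
    show "finite (?O h)" by (rule fin[OF l h])
    fix x Q assume Q: "Q \<in> ?Ps"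
    show "linear_map (?D l) (?D (Suc l)) (T Q h x)" if x: "x \<in> ?O h"
      using linear_map_compose[OF linear_map_compose[OF cjlin[OF l Q] ptlin[OF l h x]] Mlin[OF l h x]]
      unfolding T_def length_histories[OF h] .
    fix X assume X: "psd (?D l) X"
    show "psd (?D (Suc l)) (T Q h x X)" if x: "x \<in> ?O h"
      unfolding T_def length_histories[OF h]
      by (intro completely_positive_psd[OF M(1)[OF l h x]] ptpsd[OF l h x] cjpsd[OF l Q X])
    show "(\<Sum>x\<in>?O h. mat_trace (T Q h x X)) = mat_trace X"
      unfolding T_def length_histories[OF h]
      using M(2)[OF l h _ psd_carrier[OF ptpsd[OF l h _ cjpsd[OF l Q X]]]]
        pttr[OF l h psd_carrier[OF cjpsd[OF l Q X]]] cjtr[OF l Q psd_carrier[OF X]] by simp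
  next
    show "density_operator (?D 0) (mr_initial \<pi>)" using v by blast
  qed
  have mem: "l \<le> N \<Longrightarrow> mr_state n N \<pi> (pauli_channel n p) h l = state p h l"
    if p: "pauli_distribution n p" and h: "h \<in> ?H N" for p h l
  proof (induction l)
    case (Suc l)
    then have l: "l < N" by simp
    note th = take_histories[OF h less_imp_le[OF l]] and nh = nth_histories[OF h l]
    have st: "psd (?D l) (state p h l)" using psd_state[OF p h order.refl] l by simp
    have tk: "take (Suc l) h = take l h @ [h ! l]" using l length_histories[OF h] by (simp add: take_Suc_conv_app_nth)
    have "linear_map (2 ^ n * (?k l * ?D (Suc l))) (?D (Suc l)) (\<lambda>Y. ?M (take l h @ [h ! l]) (pt l (take l h) (h ! l) Y))"
      using linear_map_compose[OF ptlin[OF l th nh] Mlin[OF l th nh]] unfolding D'[OF l] .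
    from linear_map_pauli_channel[OF this, of "state p h l" p] show ?case
      using Suc.IH l psd_carrier[OF st]
      by (simp add: step_def T_eq[OF length_histories[OF th]] length_histories[OF h] min_absorb2 tk Let_def cj_def D'[OF l] flip: pt_def)
  qed simp
  have "4 ^ n / 4 \<le> real N * (9 / 4 * \<epsilon>) * 2 ^ n * sqrt (2 * 2 powr \<eta> * 2 ^ n)"
  proof (rule coherent_learning_bound[OF n \<epsilon> _ learn refl])
    show "(0 :: real) \<le> 2 * 2 powr \<eta> * 2 ^ n" by simp
    show "measurement_restricted_prob n N \<pi> (pauli_channel n p) h = Re (mat_trace (state p h N))"
      if "pauli_distribution n p" "h \<in> ?H N" for p h
      using mem[OF that order.refl] by (simp add: measurement_restricted_prob_def)
  next
    fix l h X f assume l: "l < N" and h: "h \<in> ?H l" and X: "psd (?D l) X"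
      and f: "\<And>P x. P \<in> ?Ps \<Longrightarrow> x \<in> ?O h \<Longrightarrow> test_functional (?D (Suc l)) (f P x)"
    let ?C = "?D (Suc l)" and ?E = "mr_povm \<pi> h"
    note Ep' = Ep[OF l h]
    have ph: "povm_hmin_ge (2 ^ n) (?k l) (?O h) ?E \<eta>"
      using hm l h by (simp add: measurement_restricted_hmin_ge_def)
    obtain s where s: "\<And>x. x \<in> ?O h \<Longrightarrow> psd (?k l) (s x)"
        "\<And>x. x \<in> ?O h \<Longrightarrow> psd (?d l) (tensor_mat (1\<^sub>m (2 ^ n)) (s x) - ?E x)"
      and sum: "finite_mat_sum (?k l) s (?O h) = ?c \<cdot>\<^sub>m 1\<^sub>m (?k l)"
      using povm_hmin_ge_operator_bound[where E = "mr_povm \<pi> h", OF Ep' fin[OF l h] ph] by blast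
    let ?S = "\<lambda>x. tensor_mat (1\<^sub>m (2 ^ n)) (s x)"
    have Sp: "psd (?d l) (?S x)" if "x \<in> ?O h" for x using s(1)[OF that] by (intro psd_tensor psd_one)
    have Xd: "psd (?d l * ?C) X" using X D[OF l] by simp
    have Xc: "X \<in> carrier_mat (2 ^ n * (?k l * ?C)) (2 ^ n * (?k l * ?C))" using psd_carrier[OF X] unfolding D'[OF l] .
    have cjd: "psd (?d l * ?C) (cj l Q X)" if "Q \<in> ?Ps" for Q using cjpsd[OF l that X] D[OF l] by simp
    \<comment> \<open>The tests stay separate for each outcome, because the entropy bound concerns
      the single effects. The sum over a one-element set brings the map into the form of
      \<open>test_functional_sum\<close>.\<close>
    have "\<exists>Z. effect ?C Z \<and> (\<forall>Y \<in> carrier_mat ?C ?C. (\<Sum>y\<in>{()}. f P x (?M (h @ [x]) Y)) = mat_trace (Z * Y))"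
      if P: "P \<in> ?Ps" and x: "x \<in> ?O h" for P x
      by (rule test_functional_effect, rule test_functional_sum[OF f[OF P x] Mlin[OF l h x]])
        (auto intro: completely_positive_psd[OF M(1)[OF l h x]] M(2)[OF l h x])
    then have "\<forall>z\<in>?Ps \<times> ?O h. \<exists>Z. effect ?C Z \<and> (\<forall>Y \<in> carrier_mat ?C ?C.
        (\<Sum>y\<in>{()}. f (fst z) (snd z) (?M (h @ [snd z]) Y)) = mat_trace (Z * Y))" by auto
    from bchoice[OF this] obtain Z' where Z': "\<forall>z\<in>?Ps \<times> ?O h. effect ?C (Z' z) \<and> (\<forall>Y \<in> carrier_mat ?C ?C.
        (\<Sum>y\<in>{()}. f (fst z) (snd z) (?M (h @ [snd z]) Y)) = mat_trace (Z' z * Y))" by blast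
    define Z where "Z P x = Z' (P, x)" for P x
    have Z: "effect ?C (Z P x)" if "P \<in> ?Ps" "x \<in> ?O h" for P x
      using bspec[OF Z', of "(P, x)"] that by (simp add: Z_def)
    have fZ: "f P x (?M (h @ [x]) Y) = mat_trace (Z P x * Y)"
      if "P \<in> ?Ps" "x \<in> ?O h" "Y \<in> carrier_mat ?C ?C" for P x Y
      using bspec[OF Z', of "(P, x)"] that by (simp add: Z_def)
    define R where "R x Q = pt l h x (cj l Q X)" for x Q
    \<comment> \<open>The post-measurement operator with the effect replaced by its bound 1
      \<otimes> s. Conjugating \<open>X\<close> first would not change it, since the conjugation
      passes to this bound and fixes it; so it dominates \<open>R x Q\<close> for every
      \<open>Q\<close>.\<close>
    define SS where "SS x = partial_trace_fst (?d l) ?C (tensor_mat (?S x) (1\<^sub>m ?C) * X)" for x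
    have Rp: "psd ?C (R x Q)" if "x \<in> ?O h" "Q \<in> ?Ps" for x Q
      unfolding R_def by (rule ptpsd[OF l h that(1) cjpsd[OF l that(2) X]])
    have SSp: "psd ?C (SS x)" if "x \<in> ?O h" for x
      unfolding SS_def by (rule psd_partial_trace[OF Sp[OF that] Xd])
    have "(\<Sum>P\<in>?Ps. (1 / 4 ^ n * (\<Sum>Q\<in>?Ps. pauli_sign P Q *
        (\<Sum>x\<in>?O h. Re (mat_trace (Z P x * R x Q)))))\<^sup>2) \<le> (2 * 2 powr \<eta> * 2 ^ n) * (Re (mat_trace X))\<^sup>2"
    proof (rule pauli_test_bound[where d = ?C and S = SS])
      show "psd ?C (SS x - R x Q)" if x: "x \<in> ?O h" and Q: "Q \<in> ?Ps" for x Q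
      proof (rule psd_if_rank_one_traces)
        note Rc = psd_carrier[OF Rp[OF x Q]] and SSc = psd_carrier[OF SSp[OF x]]
        show "SS x - R x Q \<in> carrier_mat ?C ?C" by (rule minus_carrier_mat[OF Rc])
        fix w
        let ?V = "mat ?C ?C (\<lambda>(i, j). w i * cnj (w j))"
        have V: "psd ?C ?V" by (rule psd_rank_one)
        note Vc = psd_carrier[OF V] and Sc = psd_carrier[OF Sp[OF x]] and Ec = psd_carrier[OF Ep'[OF x]]
        note sc = psd_carrier[OF s(1)[OF x]]
        have as: "tensor_mat (?S x) ?V = tensor_mat (1\<^sub>m (2 ^ n)) (tensor_mat (s x) ?V)"
          by (rule tensor_mat_assoc[OF one_carrier_mat sc Vc])
        have "mat_trace (SS x * ?V) = mat_trace (tensor_mat (?S x) ?V * X)"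
          unfolding SS_def by (rule mat_trace_partial_trace_times[OF Sc Vc psd_carrier[OF Xd]])
        also have "\<dots> = mat_trace (tensor_mat (?S x) ?V * cj l Q X)"
          unfolding as cj_def
          using mat_trace_times_pauli_conj[OF Q _ Xc, of "tensor_mat (1\<^sub>m (2 ^ n)) (tensor_mat (s x) ?V)"]
            pauli_conj_one_tensor[OF Q tensor_mat_carrier[OF sc Vc]] tensor_mat_carrier[OF one_carrier_mat tensor_mat_carrier[OF sc Vc]]
          by simp
        finally have 1: "mat_trace (SS x * ?V) = mat_trace (tensor_mat (?S x) ?V * cj l Q X)" .
        have 2: "mat_trace (R x Q * ?V) = mat_trace (tensor_mat (?E x) ?V * cj l Q X)"
          unfolding R_def pt_def by (rule mat_trace_partial_trace_times[OF Ec Vc psd_carrier[OF cjd[OF Q]]])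
        note cSV = tensor_mat_carrier[OF Sc Vc] and cEV = tensor_mat_carrier[OF Ec Vc] and cX = psd_carrier[OF cjd[OF Q]]
        have "mat_trace ((SS x - R x Q) * ?V) = mat_trace (SS x * ?V) - mat_trace (R x Q * ?V)"
          using minus_mult_distrib_mat[OF SSc Rc Vc] mat_trace_minus[OF mult_carrier_mat[OF SSc Vc] mult_carrier_mat[OF Rc Vc]] by simp
        also have "\<dots> = mat_trace ((tensor_mat (?S x) ?V - tensor_mat (?E x) ?V) * cj l Q X)"
          unfolding 1 2 minus_mult_distrib_mat[OF cSV cEV cX]
          by (rule mat_trace_minus[OF mult_carrier_mat[OF cSV cX] mult_carrier_mat[OF cEV cX], symmetric])
        also have "\<dots> = mat_trace (tensor_mat (?S x - ?E x) ?V * cj l Q X)"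
          by (simp only: tensor_mat_minus_left[OF Sc Ec Vc])
        finally have 3: "mat_trace ((SS x - R x Q) * ?V) = mat_trace (tensor_mat (?S x - ?E x) ?V * cj l Q X)" .
        show "Im (mat_trace ((SS x - R x Q) * ?V)) = 0" "0 \<le> Re (mat_trace ((SS x - R x Q) * ?V))"
          unfolding 3 using psd_trace_times[OF psd_tensor[OF s(2)[OF x] V] cjd[OF Q]] by simp_all
      qed
      have "(\<Sum>x\<in>?O h. \<Sum>Q\<in>?Ps. Re (mat_trace (R x Q))) =
          (\<Sum>Q\<in>?Ps. Re (\<Sum>x\<in>?O h. mat_trace (R x Q)))"
        unfolding Re_sum by (rule sum.swap)
      also have "\<dots> = (\<Sum>Q\<in>?Ps. Re (mat_trace X))"
        unfolding R_def using pttr[OF l h psd_carrier[OF cjpsd[OF l _ X]]] cjtr[OF l _ psd_carrier[OF X]] by simp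
      finally show "(\<Sum>x\<in>?O h. \<Sum>Q\<in>?Ps. Re (mat_trace (R x Q))) \<le> 4 ^ n * Re (mat_trace X)" by simp
      have "(\<Sum>x\<in>?O h. mat_trace (SS x)) = (\<Sum>x\<in>?O h. mat_trace (tensor_mat (?S x) (1\<^sub>m ?C) * X))"
        unfolding SS_def using mat_trace_partial_trace[OF psd_carrier[OF Sp] psd_carrier[OF Xd]] by simp
      also have "\<dots> = mat_trace (finite_mat_sum (?d l * ?C) (\<lambda>x. tensor_mat (?S x) (1\<^sub>m ?C)) (?O h) * X)"
        by (rule mat_trace_finite_mat_sum_times[OF psd_carrier[OF Xd], symmetric])
          (intro tensor_mat_carrier psd_carrier[OF Sp] one_carrier_mat)
      also have "finite_mat_sum (?d l * ?C) (\<lambda>x. tensor_mat (?S x) (1\<^sub>m ?C)) (?O h) =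
          ?c \<cdot>\<^sub>m 1\<^sub>m (?d l * ?C)"
      proof -
        have "finite_mat_sum (?d l * ?C) (\<lambda>x. tensor_mat (?S x) (1\<^sub>m ?C)) (?O h) =
            tensor_mat (finite_mat_sum (?d l) ?S (?O h)) (1\<^sub>m ?C)"
          by (rule linear_map_finite_mat_sum[OF linear_map_tensor_left[OF one_carrier_mat] fin[OF l h], symmetric])
            (rule psd_carrier[OF Sp])
        also have "finite_mat_sum (?d l) ?S (?O h) = ?c \<cdot>\<^sub>m 1\<^sub>m (?d l)"
          by (rule finite_mat_sum_one_tensor[OF fin[OF l h] s(1) sum])
        also have "tensor_mat \<dots> (1\<^sub>m ?C) = ?c \<cdot>\<^sub>m 1\<^sub>m (?d l * ?C)"
          using linear_mapD(3)[OF linear_map_tensor_left[OF one_carrier_mat[of ?C], of "?d l"] one_carrier_mat]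
          by (simp only: tensor_mat_one)
        finally show ?thesis .
      qed
      also have "mat_trace (?c \<cdot>\<^sub>m 1\<^sub>m (?d l * ?C) * X) =
          ?c * mat_trace X"
        using mult_smult_assoc_mat[OF one_carrier_mat psd_carrier[OF Xd]] mat_trace_smult[OF psd_carrier[OF Xd]]
          left_mult_one_mat[OF psd_carrier[OF Xd]] by simp
      finally have "(\<Sum>x\<in>?O h. Re (mat_trace (SS x))) = 2 powr \<eta> * 2 ^ n * Re (mat_trace X)"
        unfolding Re_sum[symmetric] by simp
      then show "(\<Sum>x\<in>?O h. Re (mat_trace (SS x))) \<le> 2 * 2 powr \<eta> * 2 ^ n * Re (mat_trace X)"
        using psd_trace(1)[OF X] by simp
    qed (use Z Rp SSp psd_trace(1)[OF X] fin[OF l h] in auto)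
    moreover have "Re (mat_trace (Z P x * R x Q)) = Re (f P x (T Q h x X))"
      if "P \<in> ?Ps" "Q \<in> ?Ps" "x \<in> ?O h" for P Q x
      using fZ[OF that(1,3) psd_carrier[OF Rp[OF that(3,2)]]] by (simp add: R_def T_def length_histories[OF h])
    ultimately show "(\<Sum>P\<in>?Ps. (1 / 4 ^ n * (\<Sum>Q\<in>?Ps. pauli_sign P Q *
        (\<Sum>x\<in>?O h. Re (f P x (T Q h x X)))))\<^sup>2) \<le> (2 * 2 powr \<eta> * 2 ^ n) * (Re (mat_trace X))\<^sup>2"
      by simp
  qed
  then show ?thesis by (rule coherent_arithmetic[OF \<epsilon>(1)])
qed

theorem corollary1:
  shows "\<exists>c::real. 0 < c \<and>
    (\<forall>(n::nat) (\<epsilon>::real) (\<eta>::real). 1 \<le> n \<longrightarrow> 0 < \<epsilon> \<longrightarrow> \<epsilon> \<le> 1 / 3 \<longrightarrow> 0 \<le> \<eta> \<longrightarrow>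
      (\<forall>(N::nat) (\<pi>::incoherent_protocol).
         valid_incoherent n N \<pi> \<longrightarrow>
         incoherent_inputs_hmin_ge n N \<eta> \<pi> \<or> incoherent_povms_hmin_ge n N \<eta> \<pi> \<longrightarrow>
         solves_learning n \<epsilon> N (incoherent_prob n N) \<pi> \<longrightarrow>
         real N \<ge> c * (1 / \<epsilon> ^ 2) * 2 powr (real n - \<eta>)) \<and>
      (\<forall>(N::nat) (\<pi>::input_restricted_protocol).
         valid_input_restricted n N \<pi> \<longrightarrow>
         input_restricted_hmin_ge n N \<eta> \<pi> \<longrightarrow>
         solves_learning n \<epsilon> N (input_restricted_prob n N) \<pi> \<longrightarrow>
         real N \<ge> c * (1 / \<epsilon>) * 2 powr ((real n - \<eta>) / 2)) \<and>
      (\<forall>(N::nat) (\<pi>::measurement_restricted_protocol).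
         valid_measurement_restricted n N \<pi> \<longrightarrow>
         measurement_restricted_hmin_ge n N \<eta> \<pi> \<longrightarrow>
         solves_learning n \<epsilon> N (measurement_restricted_prob n N) \<pi> \<longrightarrow>
         real N \<ge> c * (1 / \<epsilon>) * 2 powr ((real n - \<eta>) / 2)))"
  by (intro exI[of _ "1 / 500"] conjI allI impI)
    (simp, (blast intro: incoherent_bound input_restricted_bound measurement_restricted_bound)+)

end
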